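(* Let $\mathcal C$ be a pivotal monoidal category, $V\in\mathcal C$ an object and $n\ge 1$ an integer. Then $\left(E_V^{(n)}\right)^n=\mathrm{id}$. If $k$ is an algebraically closed field of characteristic zero and $\mathcal C$ is a $k$-linear pivotal monoidal category, then for any object $V\in\mathcal C$ and all positive integers $n,r$ the $(n,r)$-th Frobenius-Schur indicator $\nu_{n,r}(V)$ is a cyclotomic integer in $\mathbb Q_n\subset k$, and $\nu_{n,n-r}(V)=\overline{\nu_{n,r}(V)}$.
   Context: Conventions. In a monoidal category the associativity isomorphism is $\Phi\colon (U\otimes V)\otimes W\to U\otimes (V\otimes W)$ and the unit object $I$ is strict: $V\otimes I=V=I\otimes V$. An object also denotes its identity morphism; $\mathcal C(X,Y)$ is the set of morphisms. In $k$-linear monoidal categories the tensor product is bilinear and morphism spaces are finite-dimensional. A (left) dual of $V$ is $(V^\vee,\mathrm{ev}_V\colon V^\vee\otimes V\to I,\mathrm{db}_V\colon I\to V\otimes V^\vee)$ with $(V\otimes \mathrm{ev}_V)\Phi(\mathrm{db}_V\otimes V)=\mathrm{id}_V$ and $(\mathrm{ev}_V\otimes V^\vee)\Phi^{-1}(V^\vee\otimes\mathrm{db}_V)=\mathrm{id}_{V^\vee}$. A category is rigid if all left duals exist; a choice is fixed with $I^\vee=I$ (and identity $\mathrm{ev}_I$, $\mathrm{db}_I$). Then $(-)^\vee$ is a contravariant functor, with $f^\vee$ for $f\colon V\to W$ determined by $\mathrm{ev}_V(f^\vee\otimes V)=\mathrm{ev}_W(W^\vee\otimes f)$, and $(-)^{\vee\vee}$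 is canonically a monoidal functor (via the canonical isomorphisms $W^\vee\otimes V^\vee\cong(V\otimes W)^\vee$ given by uniqueness of duals). A pivotal monoidal category is a rigid monoidal category with a pivotal structure: a monoidal natural isomorphism $j_V\colon V\to V^{\vee\vee}$. Put $V^{\otimes 0}=I$, $V^{\otimes(n+1)}=V\otimes V^{\otimes n}$, and let $\Phi^{(n)}\colon V^{\otimes(n-1)}\otimes V\to V^{\otimes n}$ be the canonical associativity isomorphism ($\Phi^{(1)}=\mathrm{id}$, $\Phi^{(n+1)}=(V\otimes\Phi^{(n)})\Phi$). Let $A=A_{V,W}\colon\mathcal C(I,V\otimes W)\to\mathcal C(V^\vee,W)$ be the bijection $A(f)=(\mathrm{ev}_V\otimes W)\Phi^{-1}(V^\vee\otimes f)$, with inverse $A^{-1}(g)=(V\otimes g)\mathrm{db}_V$. Let $T_{VW}\colon\mathcal C(V^\vee,W)\to\mathcal C(W^\vee,V)$, $T_{VW}(f)=j_V^{-1}f^\vee$. Put $E_{VW}=A_{W,V}^{-1}\,T_{VW}\,A_{V,W}\colon\mathcal C(I,V\otimes W)\to\mathcal C(I,W\otimes V)$ and, for $n\ge1$, $E_V^{(n)}\colon\mathcal C(I,V^{\otimes n})\to\mathcal C(I,V^{\otimes n})$, $E_V^{(n)}(f)=\Phi^{(n)}E_{V,V^{\otimes(n-1)}}(f)$. All these maps are bijective. For $k$-linear $\mathcal C$ the $(n,r)$-th Frobenius-Schur indicator is $\nu_{n,r}(V)=\mathrm{Tr}\big((E_V^{(n)})^r\big)\in k$; the same formula is used for $r\le0$,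 with inverse powers of the bijection $E_V^{(n)}$. $\mathbb Q_n\subset k$ denotes the $n$-th cyclotomic field (generated over $\mathbb Q$ by the $n$-th roots of unity in $k$), a cyclotomic integer is an algebraic integer in it, and $\overline{\phantom{x}}$ is complex conjugation on $\mathbb Q_n$, i.e. the field automorphism sending each $n$-th root of unity to its inverse. *)

theory Defs
  imports
    "Jordan_Normal_Form.VS_Connect"
    "HOL-Algebra.Generated_Fields"
    "HOL-Algebra.QuotRing"
    "HOL-Computational_Algebra.Polynomial"
begin

section \<open>Monoidal categories with strict unit\<close>

record ('o, 'm) category =
  Obj :: "'o set"
  Arr :: "'m set"
  Dom :: "'m \<Rightarrow> 'o"
  Cod :: "'m \<Rightarrow> 'o"
  Idn :: "'o \<Rightarrow> 'm"
  Comp :: "'m \<Rightarrow> 'm \<Rightarrow> 'm"  (infixr \<open>\<cdot>\<index>\<close> 55)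

definition Hom :: "('o, 'm, 'z) category_scheme \<Rightarrow> 'o \<Rightarrow> 'o \<Rightarrow> 'm set" where
  "Hom C X Y = {f \<in> Arr C. Dom C f = X \<and> Cod C f = Y}"

locale category =
  fixes C (structure)
  assumes Dom_closed: "f \<in> Arr C \<Longrightarrow> Dom C f \<in> Obj C"
    and Cod_closed: "f \<in> Arr C \<Longrightarrow> Cod C f \<in> Obj C"
    and Idn_Hom: "X \<in> Obj C \<Longrightarrow> Idn C X \<in> Hom C X X"
    and Comp_Hom: "\<lbrakk>f \<in> Hom C X Y; g \<in> Hom C Y Z\<rbrakk> \<Longrightarrow> g \<cdot> f \<in> Hom C X Z"
    and Comp_Idn: "f \<in> Hom C X Y \<Longrightarrow> f \<cdot> Idn C X = f"
    and Idn_Comp: "f \<in> Hom C X Y \<Longrightarrow> Idn C Y \<cdot> f = f"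
    and Comp_assoc: "\<lbrakk>f \<in> Hom C X Y; g \<in> Hom C Y Z; h \<in> Hom C Z W\<rbrakk>
      \<Longrightarrow> (h \<cdot> g) \<cdot> f = h \<cdot> (g \<cdot> f)"

definition is_inverse :: "('o, 'm, 'z) category_scheme \<Rightarrow> 'm \<Rightarrow> 'm \<Rightarrow> bool" where
  "is_inverse C f g \<longleftrightarrow> g \<in> Hom C (Cod C f) (Dom C f)
     \<and> g \<cdot>\<^bsub>C\<^esub> f = Idn C (Dom C f) \<and> f \<cdot>\<^bsub>C\<^esub> g = Idn C (Cod C f)"

definition is_iso :: "('o, 'm, 'z) category_scheme \<Rightarrow> 'm \<Rightarrow> bool" where
  "is_iso C f \<longleftrightarrow> f \<in> Arr C \<and> (\<exists>g. is_inverse C f g)"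

definition Inv :: "('o, 'm, 'z) category_scheme \<Rightarrow> 'm \<Rightarrow> 'm" where
  "Inv C f = (THE g. is_inverse C f g)"

record ('o, 'm) monoidal_category = "('o, 'm) category" +
  TensorO :: "'o \<Rightarrow> 'o \<Rightarrow> 'o"  (infixr \<open>\<otimes>\<^sub>o\<index>\<close> 70)
  TensorA :: "'m \<Rightarrow> 'm \<Rightarrow> 'm"  (infixr \<open>\<otimes>\<^sub>a\<index>\<close> 70)
  Unit :: 'o
  Assoc :: "'o \<Rightarrow> 'o \<Rightarrow> 'o \<Rightarrow> 'm"

text \<open>The unit is strict, \<open>V \<otimes> I = V = I \<otimes> V\<close> with identity unitors. Naturality of the unitors
  is then \<open>Tensor_Unit\<close> and \<open>Unit_Tensor\<close>, and the triangle axiom is \<open>triangle\<close>.\<close>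

locale monoidal_category = category C for C (structure) +
  assumes Unit_Obj: "Unit C \<in> Obj C"
    and TensorO_Obj: "\<lbrakk>X \<in> Obj C; Y \<in> Obj C\<rbrakk> \<Longrightarrow> X \<otimes>\<^sub>o Y \<in> Obj C"
    and TensorA_Hom: "\<lbrakk>f \<in> Hom C X Y; g \<in> Hom C X' Y'\<rbrakk>
      \<Longrightarrow> f \<otimes>\<^sub>a g \<in> Hom C (X \<otimes>\<^sub>o X') (Y \<otimes>\<^sub>o Y')"
    and TensorA_Idn: "\<lbrakk>X \<in> Obj C; Y \<in> Obj C\<rbrakk> \<Longrightarrow> Idn C X \<otimes>\<^sub>a Idn C Y = Idn C (X \<otimes>\<^sub>o Y)"
    and TensorA_Comp: "\<lbrakk>f \<in> Hom C X Y; g \<in> Hom C Y Z; f' \<in> Hom C X' Y'; g' \<in> Hom C Y' Z'\<rbrakk>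
      \<Longrightarrow> (g \<cdot> f) \<otimes>\<^sub>a (g' \<cdot> f') = (g \<otimes>\<^sub>a g') \<cdot> (f \<otimes>\<^sub>a f')"
    and Assoc_Hom: "\<lbrakk>U \<in> Obj C; V \<in> Obj C; W \<in> Obj C\<rbrakk>
      \<Longrightarrow> Assoc C U V W \<in> Hom C ((U \<otimes>\<^sub>o V) \<otimes>\<^sub>o W) (U \<otimes>\<^sub>o (V \<otimes>\<^sub>o W))"
    and Assoc_iso: "\<lbrakk>U \<in> Obj C; V \<in> Obj C; W \<in> Obj C\<rbrakk> \<Longrightarrow> is_iso C (Assoc C U V W)"
    and Assoc_natural: "\<lbrakk>f \<in> Hom C U U'; g \<in> Hom C V V'; h \<in> Hom C W W'\<rbrakk>
      \<Longrightarrow> Assoc C U' V' W' \<cdot> ((f \<otimes>\<^sub>a g) \<otimes>\<^sub>a h) = (f \<otimes>\<^sub>a (g \<otimes>\<^sub>a h)) \<cdot> Assoc C U V W"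
    and pentagon: "\<lbrakk>U \<in> Obj C; V \<in> Obj C; W \<in> Obj C; X \<in> Obj C\<rbrakk>
      \<Longrightarrow> Assoc C U V (W \<otimes>\<^sub>o X) \<cdot> Assoc C (U \<otimes>\<^sub>o V) W X
        = (Idn C U \<otimes>\<^sub>a Assoc C V W X) \<cdot> Assoc C U (V \<otimes>\<^sub>o W) X \<cdot> (Assoc C U V W \<otimes>\<^sub>a Idn C X)"
    and TensorO_Unit: "X \<in> Obj C \<Longrightarrow> X \<otimes>\<^sub>o Unit C = X"
    and Unit_TensorO: "X \<in> Obj C \<Longrightarrow> Unit C \<otimes>\<^sub>o X = X"
    and Tensor_Unit: "f \<in> Arr C \<Longrightarrow> f \<otimes>\<^sub>a Idn C (Unit C) = f"
    and Unit_Tensor: "f \<in> Arr C \<Longrightarrow> Idn C (Unit C) \<otimes>\<^sub>a f = f"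
    and triangle: "\<lbrakk>V \<in> Obj C; W \<in> Obj C\<rbrakk> \<Longrightarrow> Assoc C V (Unit C) W = Idn C (V \<otimes>\<^sub>o W)"

section \<open>Rigid and pivotal monoidal categories\<close>

record ('o, 'm) rigid_category = "('o, 'm) monoidal_category" +
  Dual :: "'o \<Rightarrow> 'o"
  Ev :: "'o \<Rightarrow> 'm"
  Db :: "'o \<Rightarrow> 'm"

locale rigid_category = monoidal_category C for C (structure) +
  assumes Dual_Obj: "V \<in> Obj C \<Longrightarrow> Dual C V \<in> Obj C"
    and Ev_Hom: "V \<in> Obj C \<Longrightarrow> Ev C V \<in> Hom C (Dual C V \<otimes>\<^sub>o V) (Unit C)"
    and Db_Hom: "V \<in> Obj C \<Longrightarrow> Db C V \<in> Hom C (Unit C) (V \<otimes>\<^sub>o Dual C V)"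
    and zigzag_Obj: "V \<in> Obj C \<Longrightarrow>
      (Idn C V \<otimes>\<^sub>a Ev C V) \<cdot> Assoc C V (Dual C V) V \<cdot> (Db C V \<otimes>\<^sub>a Idn C V) = Idn C V"
    and zigzag_Dual: "V \<in> Obj C \<Longrightarrow>
      (Ev C V \<otimes>\<^sub>a Idn C (Dual C V)) \<cdot> Inv C (Assoc C (Dual C V) V (Dual C V))
        \<cdot> (Idn C (Dual C V) \<otimes>\<^sub>a Db C V) = Idn C (Dual C V)"
    and Dual_Unit: "Dual C (Unit C) = Unit C"
    and Ev_Unit: "Ev C (Unit C) = Idn C (Unit C)"
    and Db_Unit: "Db C (Unit C) = Idn C (Unit C)"

definition dual_arr :: "('o, 'm, 'z) rigid_category_scheme \<Rightarrow> 'm \<Rightarrow> 'm" where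
  "dual_arr C f = (let V = Dom C f; W = Cod C f in
     THE g. g \<in> Hom C (Dual C W) (Dual C V)
       \<and> Ev C V \<cdot>\<^bsub>C\<^esub> (g \<otimes>\<^sub>a\<^bsub>C\<^esub> Idn C V) = Ev C W \<cdot>\<^bsub>C\<^esub> (Idn C (Dual C W) \<otimes>\<^sub>a\<^bsub>C\<^esub> f))"

text \<open>The evaluation \<open>(W\<^sup>\<or> \<otimes> V\<^sup>\<or>) \<otimes> (V \<otimes> W) \<rightarrow> I\<close> that makes \<open>W\<^sup>\<or> \<otimes> V\<^sup>\<or>\<close> a dual of \<open>V \<otimes> W\<close>; the
  canonical isomorphism \<open>W\<^sup>\<or> \<otimes> V\<^sup>\<or> \<rightarrow> (V \<otimes> W)\<^sup>\<or>\<close> is the unique morphism compatible with the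
  evaluations.\<close>

definition tensor_ev :: "('o, 'm, 'z) rigid_category_scheme \<Rightarrow> 'o \<Rightarrow> 'o \<Rightarrow> 'm" where
  "tensor_ev C V W = Ev C W \<cdot>\<^bsub>C\<^esub>
     (Idn C (Dual C W) \<otimes>\<^sub>a\<^bsub>C\<^esub>
       ((Ev C V \<otimes>\<^sub>a\<^bsub>C\<^esub> Idn C W) \<cdot>\<^bsub>C\<^esub> Inv C (Assoc C (Dual C V) V W))) \<cdot>\<^bsub>C\<^esub>
     Assoc C (Dual C W) (Dual C V) (V \<otimes>\<^sub>o\<^bsub>C\<^esub> W)"

definition dual_tensor :: "('o, 'm, 'z) rigid_category_scheme \<Rightarrow> 'o \<Rightarrow> 'o \<Rightarrow> 'm" where
  "dual_tensor C V W =
     (THE g. g \<in> Hom C (Dual C W \<otimes>\<^sub>o\<^bsub>C\<^esub> Dual C V) (Dual C (V \<otimes>\<^sub>o\<^bsub>C\<^esub> W))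
       \<and> Ev C (V \<otimes>\<^sub>o\<^bsub>C\<^esub> W) \<cdot>\<^bsub>C\<^esub> (g \<otimes>\<^sub>a\<^bsub>C\<^esub> Idn C (V \<otimes>\<^sub>o\<^bsub>C\<^esub> W)) = tensor_ev C V W)"

text \<open>The monoidal structure \<open>V\<^sup>\<or>\<^sup>\<or> \<otimes> W\<^sup>\<or>\<^sup>\<or> \<rightarrow> (W\<^sup>\<or> \<otimes> V\<^sup>\<or>)\<^sup>\<or> \<rightarrow> (V \<otimes> W)\<^sup>\<or>\<^sup>\<or>\<close> of the double dual functor.
  Its unit constraint is the identity, since \<open>I\<^sup>\<or> = I\<close>.\<close>

definition bidual_tensor :: "('o, 'm, 'z) rigid_category_scheme \<Rightarrow> 'o \<Rightarrow> 'o \<Rightarrow> 'm" where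
  "bidual_tensor C V W =
     Inv C (dual_arr C (dual_tensor C V W)) \<cdot>\<^bsub>C\<^esub> dual_tensor C (Dual C W) (Dual C V)"

record ('o, 'm) pivotal_category = "('o, 'm) rigid_category" +
  Piv :: "'o \<Rightarrow> 'm"

locale pivotal_category = rigid_category C for C (structure) +
  assumes Piv_Hom: "V \<in> Obj C \<Longrightarrow> Piv C V \<in> Hom C V (Dual C (Dual C V))"
    and Piv_iso: "V \<in> Obj C \<Longrightarrow> is_iso C (Piv C V)"
    and Piv_natural: "f \<in> Hom C V W \<Longrightarrow> Piv C W \<cdot> f = dual_arr C (dual_arr C f) \<cdot> Piv C V"
    and Piv_tensor: "\<lbrakk>V \<in> Obj C; W \<in> Obj C\<rbrakk>
      \<Longrightarrow> Piv C (V \<otimes>\<^sub>o W) = bidual_tensor C V W \<cdot> (Piv C V \<otimes>\<^sub>a Piv C W)"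
    and Piv_Unit: "Piv C (Unit C) = Idn C (Unit C)"

section \<open>The maps \<open>E\<close>\<close>

primrec tensor_pow :: "('o, 'm, 'z) monoidal_category_scheme \<Rightarrow> 'o \<Rightarrow> nat \<Rightarrow> 'o" where
  "tensor_pow C V 0 = Unit C"
| "tensor_pow C V (Suc n) = V \<otimes>\<^sub>o\<^bsub>C\<^esub> tensor_pow C V n"

text \<open>\<open>assoc_pow C V n\<close> is \<open>\<Phi>\<^sup>(\<^sup>n\<^sup>)\<close>, which only exists for \<open>n \<ge> 1\<close>.\<close>

fun assoc_pow :: "('o, 'm, 'z) monoidal_category_scheme \<Rightarrow> 'o \<Rightarrow> nat \<Rightarrow> 'm" where
  "assoc_pow C V (Suc 0) = Idn C V"
| "assoc_pow C V (Suc (Suc n)) =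
     (Idn C V \<otimes>\<^sub>a\<^bsub>C\<^esub> assoc_pow C V (Suc n)) \<cdot>\<^bsub>C\<^esub> Assoc C V (tensor_pow C V n) V"

definition A_map :: "('o, 'm, 'z) rigid_category_scheme \<Rightarrow> 'o \<Rightarrow> 'o \<Rightarrow> 'm \<Rightarrow> 'm" where
  "A_map C V W f = (Ev C V \<otimes>\<^sub>a\<^bsub>C\<^esub> Idn C W) \<cdot>\<^bsub>C\<^esub> Inv C (Assoc C (Dual C V) V W)
     \<cdot>\<^bsub>C\<^esub> (Idn C (Dual C V) \<otimes>\<^sub>a\<^bsub>C\<^esub> f)"

definition A_inv :: "('o, 'm, 'z) rigid_category_scheme \<Rightarrow> 'o \<Rightarrow> 'o \<Rightarrow> 'm \<Rightarrow> 'm" where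
  "A_inv C V W g = (Idn C V \<otimes>\<^sub>a\<^bsub>C\<^esub> g) \<cdot>\<^bsub>C\<^esub> Db C V"

definition T_map :: "('o, 'm, 'z) pivotal_category_scheme \<Rightarrow> 'o \<Rightarrow> 'o \<Rightarrow> 'm \<Rightarrow> 'm" where
  "T_map C V W f = Inv C (Piv C V) \<cdot>\<^bsub>C\<^esub> dual_arr C f"

definition E_map :: "('o, 'm, 'z) pivotal_category_scheme \<Rightarrow> 'o \<Rightarrow> 'o \<Rightarrow> 'm \<Rightarrow> 'm" where
  "E_map C V W f = A_inv C W V (T_map C V W (A_map C V W f))"

definition E_pow :: "('o, 'm, 'z) pivotal_category_scheme \<Rightarrow> 'o \<Rightarrow> nat \<Rightarrow> 'm \<Rightarrow> 'm" where
  "E_pow C V n f = assoc_pow C V n \<cdot>\<^bsub>C\<^esub> E_map C V (tensor_pow C V (n - 1)) f"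

section \<open>Linear pivotal categories and Frobenius-Schur indicators\<close>

text \<open>\<open>Add\<close> and \<open>Scale\<close> are only meaningful on parallel morphisms, that is, on each morphism space.\<close>

record ('o, 'm, 'k) linear_pivotal_category = "('o, 'm) pivotal_category" +
  Zero :: "'o \<Rightarrow> 'o \<Rightarrow> 'm"
  Add :: "'m \<Rightarrow> 'm \<Rightarrow> 'm"
  Scale :: "'k \<Rightarrow> 'm \<Rightarrow> 'm"

definition hom_space ::
  "('o, 'm, 'k, 'z) linear_pivotal_category_scheme \<Rightarrow> 'o \<Rightarrow> 'o \<Rightarrow> ('k, 'm) module" where
  "hom_space C X Y = \<lparr>carrier = Hom C X Y, mult = undefined, one = undefined,
     zero = Zero C X Y, add = Add C, smult = Scale C\<rparr>"

locale linear_pivotal_category = pivotal_category C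
  for C :: "('o, 'm, 'k::field, 'z) linear_pivotal_category_scheme" (structure) +
  assumes Hom_vectorspace: "\<lbrakk>X \<in> Obj C; Y \<in> Obj C\<rbrakk>
      \<Longrightarrow> vectorspace class_ring (hom_space C X Y)"
    and Hom_fin_dim: "\<lbrakk>X \<in> Obj C; Y \<in> Obj C\<rbrakk>
      \<Longrightarrow> vectorspace.fin_dim class_ring (hom_space C X Y)"
    and Comp_Add_left: "\<lbrakk>f \<in> Hom C X Y; g \<in> Hom C Y Z; g' \<in> Hom C Y Z\<rbrakk>
      \<Longrightarrow> Add C g g' \<cdot> f = Add C (g \<cdot> f) (g' \<cdot> f)"
    and Comp_Add_right: "\<lbrakk>f \<in> Hom C X Y; f' \<in> Hom C X Y; g \<in> Hom C Y Z\<rbrakk>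
      \<Longrightarrow> g \<cdot> Add C f f' = Add C (g \<cdot> f) (g \<cdot> f')"
    and Comp_Scale_left: "\<lbrakk>f \<in> Hom C X Y; g \<in> Hom C Y Z\<rbrakk>
      \<Longrightarrow> Scale C a g \<cdot> f = Scale C a (g \<cdot> f)"
    and Comp_Scale_right: "\<lbrakk>f \<in> Hom C X Y; g \<in> Hom C Y Z\<rbrakk>
      \<Longrightarrow> g \<cdot> Scale C a f = Scale C a (g \<cdot> f)"
    and TensorA_Add_left: "\<lbrakk>f \<in> Hom C X Y; f' \<in> Hom C X Y; g \<in> Hom C X' Y'\<rbrakk>
      \<Longrightarrow> Add C f f' \<otimes>\<^sub>a g = Add C (f \<otimes>\<^sub>a g) (f' \<otimes>\<^sub>a g)"
    and TensorA_Add_right: "\<lbrakk>f \<in> Hom C X Y; g \<in> Hom C X' Y'; g' \<in> Hom C X' Y'\<rbrakk>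
      \<Longrightarrow> f \<otimes>\<^sub>a Add C g g' = Add C (f \<otimes>\<^sub>a g) (f \<otimes>\<^sub>a g')"
    and TensorA_Scale_left: "\<lbrakk>f \<in> Hom C X Y; g \<in> Hom C X' Y'\<rbrakk>
      \<Longrightarrow> Scale C a f \<otimes>\<^sub>a g = Scale C a (f \<otimes>\<^sub>a g)"
    and TensorA_Scale_right: "\<lbrakk>f \<in> Hom C X Y; g \<in> Hom C X' Y'\<rbrakk>
      \<Longrightarrow> f \<otimes>\<^sub>a Scale C a g = Scale C a (f \<otimes>\<^sub>a g)"

text \<open>The trace of an endomorphism of a finite-dimensional space, as the sum of the diagonal matrix
  entries with respect to a chosen basis (the choice does not matter).\<close>

definition coordinates ::
  "('k::field, 'v, 'z) module_scheme \<Rightarrow> 'v set \<Rightarrow> 'v \<Rightarrow> 'v \<Rightarrow> 'k" where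
  "coordinates M B v = (THE a. a \<in> extensional B \<and> module.lincomb M a B = v)"

definition lin_trace :: "('k::field, 'v, 'z) module_scheme \<Rightarrow> ('v \<Rightarrow> 'v) \<Rightarrow> 'k" where
  "lin_trace M T =
     (let B = SOME B. finite B \<and> vectorspace.basis class_ring M B
      in \<Sum>b\<in>B. coordinates M B (T b) b)"

definition E_power :: "('o, 'm, 'z) pivotal_category_scheme \<Rightarrow> 'o \<Rightarrow> nat \<Rightarrow> int \<Rightarrow> 'm \<Rightarrow> 'm" where
  "E_power C V n r =
     (if 0 \<le> r then E_pow C V n ^^ nat r
      else inv_into (Hom C (Unit C) (tensor_pow C V n)) (E_pow C V n) ^^ nat (- r))"

definition FS_indicator ::
  "('o, 'm, 'k::field, 'z) linear_pivotal_category_scheme \<Rightarrow> nat \<Rightarrow> int \<Rightarrow> 'o \<Rightarrow> 'k" where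
  "FS_indicator C n r V =
     lin_trace (hom_space C (Unit C) (tensor_pow C V n)) (E_power C V n r)"

section \<open>Cyclotomic fields\<close>

definition cyclotomic_field :: "nat \<Rightarrow> 'k::field_char_0 set" where
  "cyclotomic_field n = generate_field class_ring (\<rat> \<union> {\<zeta>. \<zeta> ^ n = 1})"

text \<open>The automorphism is made \<open>undefined\<close> outside the cyclotomic field, so that it is unique as a
  HOL function.\<close>

definition cyclotomic_conj :: "nat \<Rightarrow> 'k::field_char_0 \<Rightarrow> 'k" where
  "cyclotomic_conj n = (let K = class_ring\<lparr>carrier := cyclotomic_field n\<rparr> in
     THE \<sigma>. \<sigma> \<in> ring_iso K K \<and> \<sigma> \<in> extensional (cyclotomic_field n)
       \<and> (\<forall>\<zeta>. \<zeta> ^ n = 1 \<longrightarrow> \<sigma> \<zeta> = inverse \<zeta>))"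

end

theory Submission
  imports Defs "Jordan_Normal_Form.Char_Poly" "HOL-Computational_Algebra.Field_as_Ring"
begin

text \<open>
  The map \<open>E\<close> carries the first leg of a morphism \<open>I \<rightarrow> V \<otimes> W\<close> around to the back, where it
  reappears through the pivotal isomorphism. The idea is to say this without a choice of direction:
  bend the leg \<open>V\<close> of \<open>f : I \<rightarrow> V \<otimes> W\<close> down on the left with \<open>ev\<^sub>V\<close> (this is \<open>A_map\<close>), and bend the leg
  \<open>V\<close> of \<open>g : I \<rightarrow> W \<otimes> V\<close> down on the right with the evaluation \<open>V \<otimes> V\<^sup>\<or> \<rightarrow> I\<close> that the pivotal structure
  provides (this is \<open>A_right\<close>). Then \<open>E f = g\<close> holds exactly when both bendings agree as morphisms
  \<open>V\<^sup>\<or> \<rightarrow> W\<close> (\<open>A_right_E_map\<close>, \<open>E_map_eqI\<close>). Bending \<open>V \<otimes> W\<close> on the left or on the right amounts to bending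
  \<open>V\<close> and \<open>W\<close> one after the other (\<open>A_map_dual_tensor\<close>, \<open>A_right_dual_tensor\<close>; the monoidality of the
  pivotal structure enters in the second), and a bending on the left commutes with a bending on the
  right (\<open>A_right_A_map_commute\<close>). So rotating the block \<open>V \<otimes> W\<close> past \<open>U\<close> is the same as rotating \<open>V\<close>
  and then \<open>W\<close> (\<open>E_map_tensor\<close>). By iteration, rotating the \<open>n\<close> legs of \<open>V\<^sup>\<otimes>\<^sup>n\<close> one at a time is
  rotating all of \<open>V\<^sup>\<otimes>\<^sup>n\<close> past the unit object (\<open>E_pow_iterate\<close>), which changes nothing by naturality
  (\<open>E_map_Unit_right\<close>).

  In the linear case \<open>E\<^sup>(\<^sup>n\<^sup>)\<close> is therefore a linear map \<open>T\<close> with \<open>T\<^sup>n = id\<close> on a finite-dimensional space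
  over an algebraically closed field of characteristic zero. Averaging over the cyclic group generated
  by \<open>T\<close> shows that eigenvectors span, so some basis consists of eigenvectors, with eigenvalues
  \<open>\<lambda>\<^sub>b\<close> that are \<open>n\<close>-th roots of unity. As traces do not depend on the basis, the indicators for all
  integers \<open>r\<close> are the power sums \<open>\<Sum>\<^sub>b \<lambda>\<^sub>b\<^sup>r\<close> (\<open>FS_indicator_power_sum\<close>). Such a sum lies in the cyclotomic
  field; it is an algebraic integer because it is an eigenvalue of an integer matrix
  (\<open>algebraic_int_sum_roots\<close>); and replacing \<open>r\<close> by \<open>n - r\<close> inverts each summand.

  It remains to see that inverting roots of unity extends to exactly one automorphism of the
  cyclotomic field inside \<open>k\<close>. Let \<open>\<zeta>\<close> be a root in \<open>k\<close> of the minimal polynomial of \<open>exp(2\<pi>i/n)\<close> over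
  the rationals. Then \<open>\<zeta>\<close> and \<open>exp(2\<pi>i/n)\<close> are roots of the same rational polynomials
  (\<open>root_transfer\<close>). Hence \<open>\<zeta>\<close> is primitive, and complex conjugation of \<open>exp(2\<pi>i/n)\<close> shows that \<open>\<zeta>\<close> and its
  inverse are roots of the same rational polynomials, so that \<open>p(\<zeta>) \<mapsto> p(\<zeta>\<inverse>)\<close> is well defined
  (\<open>cyclotomic_conj_eval\<close>).
\<close>

section \<open>Isomorphisms in a category\<close>

context category
begin

text \<open>Typing of morphisms is done by the simplifier throughout: it computes domains and codomains
  bottom-up, whereas membership in \<open>Hom\<close> would leave the intermediate objects of a composite to be
  guessed. Composites are kept associated to the right.\<close>

lemma Hom_iff: "f \<in> Hom C X Y \<longleftrightarrow> f \<in> Arr C \<and> Dom C f = X \<and> Cod C f = Y"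
  by (auto simp: Hom_def)

lemma Comp_type [simp]:
  assumes "f \<in> Arr C" "g \<in> Arr C" "Dom C g = Cod C f"
  shows "g \<cdot> f \<in> Arr C" "Dom C (g \<cdot> f) = Dom C f" "Cod C (g \<cdot> f) = Cod C g"
  using Comp_Hom[of f "Dom C f" "Cod C f" g "Cod C g"] assms by (auto simp: Hom_def)

lemma Idn_type [simp]:
  assumes "X \<in> Obj C"
  shows "Idn C X \<in> Arr C" "Dom C (Idn C X) = X" "Cod C (Idn C X) = X"
  using Idn_Hom[OF assms] by (auto simp: Hom_def)

lemma Obj_type [simp]: "f \<in> Arr C \<Longrightarrow> Dom C f \<in> Obj C" "f \<in> Arr C \<Longrightarrow> Cod C f \<in> Obj C"
  by (auto simp: Dom_closed Cod_closed)

lemma id_right [simp]: "f \<in> Arr C \<Longrightarrow> Dom C f = X \<Longrightarrow> f \<cdot> Idn C X = f"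
  using Comp_Idn[of f X "Cod C f"] by (auto simp: Hom_def)

lemma id_left [simp]: "f \<in> Arr C \<Longrightarrow> Cod C f = X \<Longrightarrow> Idn C X \<cdot> f = f"
  using Idn_Comp[of f "Dom C f" X] by (auto simp: Hom_def)

lemma Comp_assoc_Arr [simp]:
  "\<lbrakk>f \<in> Arr C; g \<in> Arr C; h \<in> Arr C; Dom C g = Cod C f; Dom C h = Cod C g\<rbrakk>
    \<Longrightarrow> (h \<cdot> g) \<cdot> f = h \<cdot> (g \<cdot> f)"
  using Comp_assoc[of f "Dom C f" "Cod C f" g "Cod C g" h "Cod C h"] by (auto simp: Hom_def)

lemma is_inverse_unique:
  assumes "f \<in> Arr C" "is_inverse C f g" "is_inverse C f h" shows "g = h"
proof -
  have g: "g \<in> Arr C" "Dom C g = Cod C f" "Cod C g = Dom C f" "g \<cdot> f = Idn C (Dom C f)"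
    and h: "h \<in> Arr C" "Dom C h = Cod C f" "Cod C h = Dom C f" "f \<cdot> h = Idn C (Cod C f)"
    using assms by (auto simp: is_inverse_def Hom_def)
  have "g = g \<cdot> (f \<cdot> h)" using g h by simp
  also have "\<dots> = (g \<cdot> f) \<cdot> h" using g(1-3) h(1-3) assms(1) by simp
  also have "\<dots> = h" using g h assms(1) by simp
  finally show ?thesis .
qed

lemma Inv_is_inverse:
  assumes "is_iso C f" shows "is_inverse C f (Inv C f)"
  using assms is_inverse_unique theI'[of "is_inverse C f"] unfolding is_iso_def Inv_def by blast

lemma Inv_type [simp]:
  assumes "is_iso C f"
  shows "Inv C f \<in> Arr C" "Dom C (Inv C f) = Cod C f" "Cod C (Inv C f) = Dom C f"
    "Inv C f \<cdot> f = Idn C (Dom C f)" "f \<cdot> Inv C f = Idn C (Cod C f)"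
  using Inv_is_inverse[OF assms] by (auto simp: is_inverse_def Hom_def)

lemma Inv_cancel [simp]:
  assumes "is_iso C f" "h \<in> Arr C"
  shows "Cod C h = Dom C f \<Longrightarrow> Inv C f \<cdot> (f \<cdot> h) = h"
    "Cod C h = Cod C f \<Longrightarrow> f \<cdot> (Inv C f \<cdot> h) = h"
proof -
  have f: "f \<in> Arr C" using assms(1) by (simp add: is_iso_def)
  show "Cod C h = Dom C f \<Longrightarrow> Inv C f \<cdot> (f \<cdot> h) = h"
    using assms f by (simp flip: Comp_assoc_Arr)
  show "Cod C h = Cod C f \<Longrightarrow> f \<cdot> (Inv C f \<cdot> h) = h"
    using assms f by (simp flip: Comp_assoc_Arr)
qed

lemma is_isoI:
  assumes "f \<in> Arr C" "g \<in> Arr C" "Dom C g = Cod C f" "Cod C g = Dom C f"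
    "g \<cdot> f = Idn C (Dom C f)" "f \<cdot> g = Idn C (Cod C f)"
  shows "is_iso C f"
  using assms by (auto simp: is_iso_def is_inverse_def Hom_def)

lemma Inv_eqI:
  assumes "f \<in> Arr C" "g \<in> Arr C" "Dom C g = Cod C f" "Cod C g = Dom C f"
    "g \<cdot> f = Idn C (Dom C f)" "f \<cdot> g = Idn C (Cod C f)"
  shows "Inv C f = g"
proof (rule is_inverse_unique[OF assms(1) Inv_is_inverse[OF is_isoI[OF assms]]])
  show "is_inverse C f g" using assms by (auto simp: is_inverse_def Hom_def)
qed

lemma is_iso_Arr: "is_iso C f \<Longrightarrow> f \<in> Arr C"
  by (simp add: is_iso_def)

lemma is_iso_Idn [simp]: "X \<in> Obj C \<Longrightarrow> is_iso C (Idn C X)"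
  by (rule is_isoI[of _ "Idn C X"]) auto

lemma Inv_Idn [simp]: "X \<in> Obj C \<Longrightarrow> Inv C (Idn C X) = Idn C X"
  by (rule Inv_eqI) auto

lemma is_iso_Comp:
  assumes "is_iso C f" "is_iso C g" "Dom C g = Cod C f"
  shows "is_iso C (g \<cdot> f)"
  by (rule is_isoI[of _ "Inv C f \<cdot> Inv C g"]) (use assms is_iso_Arr in auto)

lemma iso_cancel_left:
  assumes "is_iso C f" "a \<in> Arr C" "b \<in> Arr C" "Cod C a = Dom C f" "Cod C b = Dom C f" "f \<cdot> a = f \<cdot> b"
  shows "a = b"
  by (metis Inv_cancel(1) assms)

lemma iso_cancel_right:
  assumes "is_iso C f" "a \<in> Arr C" "b \<in> Arr C" "Dom C a = Cod C f" "Dom C b = Cod C f" "a \<cdot> f = b \<cdot> f"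
  shows "a = b"
proof -
  note f = is_iso_Arr[OF assms(1)]
  have "a = (a \<cdot> f) \<cdot> Inv C f" using assms(1-5) f by simp
  also have "\<dots> = b" unfolding assms(6) using assms(1-5) f by simp
  finally show ?thesis .
qed

text \<open>Used to recognise associators at the unit object as identities.\<close>

lemma iso_idempotent:
  assumes "is_iso C f" "Dom C f = X" "Cod C f = X" "f = f \<cdot> f"
  shows "f = Idn C X"
  by (rule iso_cancel_left[of f]) (use assms is_iso_Arr in auto)

text \<open>Turns an equation for a composite into one that also rewrites inside a longer composite
  associated to the right.\<close>

lemma Comp_tail:
  assumes "a \<cdot> b = c" "a \<in> Arr C" "b \<in> Arr C" "Dom C a = Cod C b" "h \<in> Arr C" "Dom C b = Cod C h"
  shows "a \<cdot> (b \<cdot> h) = c \<cdot> h"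
  using assms by (simp flip: Comp_assoc_Arr)

end

section \<open>Associators\<close>

context monoidal_category
begin

abbreviation idn ("\<iota>") where "idn \<equiv> Idn C"
abbreviation associator ("\<alpha>") where "associator \<equiv> Assoc C"
abbreviation associator_inv ("\<alpha>''") where "associator_inv U V W \<equiv> Inv C (Assoc C U V W)"

lemma tensor_type [simp]:
  assumes "f \<in> Arr C" "g \<in> Arr C"
  shows "f \<otimes>\<^sub>a g \<in> Arr C" "Dom C (f \<otimes>\<^sub>a g) = Dom C f \<otimes>\<^sub>o Dom C g"
    "Cod C (f \<otimes>\<^sub>a g) = Cod C f \<otimes>\<^sub>o Cod C g"
  using TensorA_Hom[of f "Dom C f" "Cod C f" g "Dom C g" "Cod C g"] assms by (auto simp: Hom_def)

lemma assoc_type [simp]: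
  assumes "U \<in> Obj C" "V \<in> Obj C" "W \<in> Obj C"
  shows "\<alpha> U V W \<in> Arr C" "Dom C (\<alpha> U V W) = (U \<otimes>\<^sub>o V) \<otimes>\<^sub>o W" "Cod C (\<alpha> U V W) = U \<otimes>\<^sub>o (V \<otimes>\<^sub>o W)"
  using Assoc_Hom[OF assms] by (auto simp: Hom_def)

declare Unit_Obj [simp] TensorO_Obj [simp] TensorO_Unit [simp] Unit_TensorO [simp]
  Tensor_Unit [simp] Unit_Tensor [simp] TensorA_Idn [simp] Assoc_iso [simp] triangle [simp]

lemma interchange:
  assumes "f \<in> Arr C" "g \<in> Arr C" "f' \<in> Arr C" "g' \<in> Arr C" "Dom C g = Cod C f" "Dom C g' = Cod C f'"
  shows "(g \<otimes>\<^sub>a g') \<cdot> (f \<otimes>\<^sub>a f') = (g \<cdot> f) \<otimes>\<^sub>a (g' \<cdot> f')"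
  using assms TensorA_Comp[of f "Dom C f" "Cod C f" g "Cod C g" f' "Dom C f'" "Cod C f'" g' "Cod C g'"]
  by (auto simp: Hom_def)

lemma interchange_tail:
  assumes "f \<in> Arr C" "g \<in> Arr C" "f' \<in> Arr C" "g' \<in> Arr C" "Dom C g = Cod C f" "Dom C g' = Cod C f'"
    "h \<in> Arr C" "Cod C h = Dom C f \<otimes>\<^sub>o Dom C f'"
  shows "(g \<otimes>\<^sub>a g') \<cdot> ((f \<otimes>\<^sub>a f') \<cdot> h) = ((g \<cdot> f) \<otimes>\<^sub>a (g' \<cdot> f')) \<cdot> h"
  using assms by (simp add: interchange flip: Comp_assoc_Arr)

lemmas merge = interchange interchange_tail

lemma is_iso_tensor:
  assumes "is_iso C f" "is_iso C g" shows "is_iso C (f \<otimes>\<^sub>a g)"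
  by (rule is_isoI[of _ "Inv C f \<otimes>\<^sub>a Inv C g"]) (use assms is_iso_Arr in \<open>auto simp: interchange\<close>)

lemma nat:
  assumes "f \<in> Arr C" "g \<in> Arr C" "h \<in> Arr C"
  shows "\<alpha> (Cod C f) (Cod C g) (Cod C h) \<cdot> ((f \<otimes>\<^sub>a g) \<otimes>\<^sub>a h)
    = (f \<otimes>\<^sub>a (g \<otimes>\<^sub>a h)) \<cdot> \<alpha> (Dom C f) (Dom C g) (Dom C h)"
  using Assoc_natural[of f "Dom C f" "Cod C f" g "Dom C g" "Cod C g" h "Dom C h" "Cod C h"] assms
  by (auto simp: Hom_def)

lemma nat':
  assumes "f \<in> Arr C" "g \<in> Arr C" "h \<in> Arr C"
  shows "\<alpha>' (Cod C f) (Cod C g) (Cod C h) \<cdot> (f \<otimes>\<^sub>a (g \<otimes>\<^sub>a h))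
    = ((f \<otimes>\<^sub>a g) \<otimes>\<^sub>a h) \<cdot> \<alpha>' (Dom C f) (Dom C g) (Dom C h)"
proof (rule iso_cancel_left[of "\<alpha> (Cod C f) (Cod C g) (Cod C h)"])
  have "\<alpha> (Cod C f) (Cod C g) (Cod C h) \<cdot> ((f \<otimes>\<^sub>a g) \<otimes>\<^sub>a h) \<cdot> \<alpha>' (Dom C f) (Dom C g) (Dom C h)
    = ((f \<otimes>\<^sub>a (g \<otimes>\<^sub>a h)) \<cdot> \<alpha> (Dom C f) (Dom C g) (Dom C h)) \<cdot> \<alpha>' (Dom C f) (Dom C g) (Dom C h)"
    using assms by (subst nat[symmetric]) auto
  also have "\<dots> = f \<otimes>\<^sub>a (g \<otimes>\<^sub>a h)" using assms by simp
  finally show "\<alpha> (Cod C f) (Cod C g) (Cod C h) \<cdot> \<alpha>' (Cod C f) (Cod C g) (Cod C h) \<cdot> (f \<otimes>\<^sub>a (g \<otimes>\<^sub>a h))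
    = \<alpha> (Cod C f) (Cod C g) (Cod C h) \<cdot> ((f \<otimes>\<^sub>a g) \<otimes>\<^sub>a h) \<cdot> \<alpha>' (Dom C f) (Dom C g) (Dom C h)"
    using assms by simp
qed (use assms in auto)

text \<open>The pentagon axiom, solved for the two pairs of associators that occur in the diagrams below:
  an associator next to an inverse associator, one of them whiskered on the right.\<close>

lemma pentagon_A:
  assumes [simp]: "U \<in> Obj C" "V \<in> Obj C" "W \<in> Obj C" "X \<in> Obj C"
  shows "\<alpha> (U \<otimes>\<^sub>o V) W X \<cdot> (\<alpha>' U V W \<otimes>\<^sub>a \<iota> X)
    = \<alpha>' U V (W \<otimes>\<^sub>o X) \<cdot> (\<iota> U \<otimes>\<^sub>a \<alpha> V W X) \<cdot> \<alpha> U (V \<otimes>\<^sub>o W) X"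
proof (rule iso_cancel_left[of "\<alpha> U V (W \<otimes>\<^sub>o X)"])
  have "\<alpha> U V (W \<otimes>\<^sub>o X) \<cdot> \<alpha> (U \<otimes>\<^sub>o V) W X \<cdot> (\<alpha>' U V W \<otimes>\<^sub>a \<iota> X)
    = (\<alpha> U V (W \<otimes>\<^sub>o X) \<cdot> \<alpha> (U \<otimes>\<^sub>o V) W X) \<cdot> (\<alpha>' U V W \<otimes>\<^sub>a \<iota> X)" by simp
  also have "\<dots> = (\<iota> U \<otimes>\<^sub>a \<alpha> V W X) \<cdot> \<alpha> U (V \<otimes>\<^sub>o W) X \<cdot> ((\<alpha> U V W \<otimes>\<^sub>a \<iota> X) \<cdot> (\<alpha>' U V W \<otimes>\<^sub>a \<iota> X))"
    by (subst pentagon) auto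
  also have "(\<alpha> U V W \<otimes>\<^sub>a \<iota> X) \<cdot> (\<alpha>' U V W \<otimes>\<^sub>a \<iota> X) = \<iota> ((U \<otimes>\<^sub>o (V \<otimes>\<^sub>o W)) \<otimes>\<^sub>o X)"
    by (simp add: interchange)
  finally show "\<alpha> U V (W \<otimes>\<^sub>o X) \<cdot> \<alpha> (U \<otimes>\<^sub>o V) W X \<cdot> (\<alpha>' U V W \<otimes>\<^sub>a \<iota> X)
    = \<alpha> U V (W \<otimes>\<^sub>o X) \<cdot> \<alpha>' U V (W \<otimes>\<^sub>o X) \<cdot> (\<iota> U \<otimes>\<^sub>a \<alpha> V W X) \<cdot> \<alpha> U (V \<otimes>\<^sub>o W) X"
    by simp
qed auto

lemma pentagon_B:
  assumes [simp]: "U \<in> Obj C" "V \<in> Obj C" "W \<in> Obj C" "X \<in> Obj C"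
  shows "(\<alpha> U V W \<otimes>\<^sub>a \<iota> X) \<cdot> \<alpha>' (U \<otimes>\<^sub>o V) W X
    = \<alpha>' U (V \<otimes>\<^sub>o W) X \<cdot> (\<iota> U \<otimes>\<^sub>a \<alpha>' V W X) \<cdot> \<alpha> U V (W \<otimes>\<^sub>o X)"
proof (rule iso_cancel_right[of "\<alpha> (U \<otimes>\<^sub>o V) W X"])
  have "\<alpha>' U (V \<otimes>\<^sub>o W) X \<cdot> (\<iota> U \<otimes>\<^sub>a \<alpha>' V W X) \<cdot> (\<alpha> U V (W \<otimes>\<^sub>o X) \<cdot> \<alpha> (U \<otimes>\<^sub>o V) W X)
    = \<alpha>' U (V \<otimes>\<^sub>o W) X \<cdot> ((\<iota> U \<otimes>\<^sub>a \<alpha>' V W X) \<cdot> (\<iota> U \<otimes>\<^sub>a \<alpha> V W X)) \<cdot> \<alpha> U (V \<otimes>\<^sub>o W) X \<cdot> (\<alpha> U V W \<otimes>\<^sub>a \<iota> X)"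
    by (subst pentagon) auto
  also have "(\<iota> U \<otimes>\<^sub>a \<alpha>' V W X) \<cdot> (\<iota> U \<otimes>\<^sub>a \<alpha> V W X) = \<iota> (U \<otimes>\<^sub>o ((V \<otimes>\<^sub>o W) \<otimes>\<^sub>o X))"
    by (simp add: interchange)
  finally show "((\<alpha> U V W \<otimes>\<^sub>a \<iota> X) \<cdot> \<alpha>' (U \<otimes>\<^sub>o V) W X) \<cdot> \<alpha> (U \<otimes>\<^sub>o V) W X
    = (\<alpha>' U (V \<otimes>\<^sub>o W) X \<cdot> (\<iota> U \<otimes>\<^sub>a \<alpha>' V W X) \<cdot> \<alpha> U V (W \<otimes>\<^sub>o X)) \<cdot> \<alpha> (U \<otimes>\<^sub>o V) W X"
    by simp
qed auto

text \<open>The triangle axiom only speaks about the unit in the middle. With the unit in an outer position,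
  the pentagon makes the associator idempotent, and an idempotent isomorphism is an identity.\<close>

lemma assoc_Unit_right [simp]:
  assumes [simp]: "U \<in> Obj C" "V \<in> Obj C"
  shows "\<alpha> U V (Unit C) = \<iota> (U \<otimes>\<^sub>o V)"
  by (rule iso_idempotent) (use pentagon[of U V "Unit C" "Unit C"] in simp_all)

lemma assoc_Unit_left [simp]:
  assumes [simp]: "V \<in> Obj C" "W \<in> Obj C"
  shows "\<alpha> (Unit C) V W = \<iota> (V \<otimes>\<^sub>o W)"
  by (rule iso_idempotent) (use pentagon[of "Unit C" "Unit C" V W] in simp_all)

text \<open>Naturality for a morphism in a single argument, oriented so that rewriting moves associators
  towards the source and inverse associators towards the target. With \<open>pentagon_A\<close> and \<open>pentagon_B\<close>
  this brings the composites below into a common form.\<close>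

lemma nat_right:
  assumes "k \<in> Arr C" "U \<in> Obj C" "V \<in> Obj C" "Cod C k = W"
  shows "\<alpha> U V W \<cdot> (\<iota> (U \<otimes>\<^sub>o V) \<otimes>\<^sub>a k) = (\<iota> U \<otimes>\<^sub>a (\<iota> V \<otimes>\<^sub>a k)) \<cdot> \<alpha> U V (Dom C k)"
  using nat[of "\<iota> U" "\<iota> V" k] assms by simp

lemma nat'_right:
  assumes "k \<in> Arr C" "U \<in> Obj C" "V \<in> Obj C" "Dom C k = W"
  shows "(\<iota> (U \<otimes>\<^sub>o V) \<otimes>\<^sub>a k) \<cdot> \<alpha>' U V W = \<alpha>' U V (Cod C k) \<cdot> (\<iota> U \<otimes>\<^sub>a (\<iota> V \<otimes>\<^sub>a k))"
  using nat'[of "\<iota> U" "\<iota> V" k] assms by simp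

lemma nat_mid:
  assumes "k \<in> Arr C" "U \<in> Obj C" "W \<in> Obj C" "Cod C k = V"
  shows "\<alpha> U V W \<cdot> ((\<iota> U \<otimes>\<^sub>a k) \<otimes>\<^sub>a \<iota> W) = (\<iota> U \<otimes>\<^sub>a (k \<otimes>\<^sub>a \<iota> W)) \<cdot> \<alpha> U (Dom C k) W"
  using nat[of "\<iota> U" k "\<iota> W"] assms by simp

lemma nat'_mid:
  assumes "k \<in> Arr C" "U \<in> Obj C" "W \<in> Obj C" "Dom C k = V"
  shows "((\<iota> U \<otimes>\<^sub>a k) \<otimes>\<^sub>a \<iota> W) \<cdot> \<alpha>' U V W = \<alpha>' U (Cod C k) W \<cdot> (\<iota> U \<otimes>\<^sub>a (k \<otimes>\<^sub>a \<iota> W))"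
  using nat'[of "\<iota> U" k "\<iota> W"] assms by simp

lemma nat_left:
  assumes "k \<in> Arr C" "V \<in> Obj C" "W \<in> Obj C" "Cod C k = U"
  shows "\<alpha> U V W \<cdot> ((k \<otimes>\<^sub>a \<iota> V) \<otimes>\<^sub>a \<iota> W) = (k \<otimes>\<^sub>a \<iota> (V \<otimes>\<^sub>o W)) \<cdot> \<alpha> (Dom C k) V W"
  using nat[of k "\<iota> V" "\<iota> W"] assms by simp

lemma nat'_left:
  assumes "k \<in> Arr C" "V \<in> Obj C" "W \<in> Obj C" "Dom C k = U"
  shows "((k \<otimes>\<^sub>a \<iota> V) \<otimes>\<^sub>a \<iota> W) \<cdot> \<alpha>' U V W = \<alpha>' (Cod C k) V W \<cdot> (k \<otimes>\<^sub>a \<iota> (V \<otimes>\<^sub>o W))"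
  using nat'[of k "\<iota> V" "\<iota> W"] assms by simp

lemmas whisker_nats = nat_right nat_mid nat_left nat'_right nat'_mid nat'_left
lemmas pentagons = pentagon_A pentagon_B
lemmas whisker_nats_tail = whisker_nats[THEN Comp_tail]
lemmas pentagons_tail = pentagons[THEN Comp_tail]

end

section \<open>Duals and the adjunction between tensoring with an object and with its dual\<close>

context rigid_category
begin

abbreviation dual ("_\<^sup>\<or>" [1000] 1000) where "V\<^sup>\<or> \<equiv> Dual C V"
abbreviation ev where "ev \<equiv> Ev C"
abbreviation db where "db \<equiv> Db C"

declare Dual_Obj [simp] zigzag_Obj [simp] zigzag_Dual [simp] Dual_Unit [simp] Ev_Unit [simp] Db_Unit [simp]

lemma ev_type [simp]:
  assumes "V \<in> Obj C"
  shows "ev V \<in> Arr C" "Dom C (ev V) = V\<^sup>\<or> \<otimes>\<^sub>o V" "Cod C (ev V) = Unit C"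
  using Ev_Hom[OF assms] by (auto simp: Hom_def)

lemma db_type [simp]:
  assumes "V \<in> Obj C"
  shows "db V \<in> Arr C" "Dom C (db V) = Unit C" "Cod C (db V) = V \<otimes>\<^sub>o V\<^sup>\<or>"
  using Db_Hom[OF assms] by (auto simp: Hom_def)

text \<open>The two directions of the bijection between morphisms \<open>Z \<rightarrow> Y \<otimes> X\<^sup>\<or>\<close> and morphisms \<open>Z \<otimes> X \<rightarrow> Y\<close>.
  For \<open>Y = I\<close> it is the universal property of \<open>ev\<^sub>X\<close>, which determines dual morphisms.\<close>

definition uncurry :: "'a \<Rightarrow> 'a \<Rightarrow> 'b \<Rightarrow> 'b" where
  "uncurry Y X g = (\<iota> Y \<otimes>\<^sub>a ev X) \<cdot> \<alpha> Y (X\<^sup>\<or>) X \<cdot> (g \<otimes>\<^sub>a \<iota> X)"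

definition curry :: "'a \<Rightarrow> 'a \<Rightarrow> 'b \<Rightarrow> 'b" where
  "curry Z X t = (t \<otimes>\<^sub>a \<iota> (X\<^sup>\<or>)) \<cdot> \<alpha>' Z X (X\<^sup>\<or>) \<cdot> (\<iota> Z \<otimes>\<^sub>a db X)"

text \<open>The triangle identities of the adjunction. After the pentagon, each is one of the two zigzag
  axioms, tensored with \<open>Z\<close> or \<open>Y\<close>.\<close>

lemma triangle_unit:
  assumes [simp]: "Z \<in> Obj C" "X \<in> Obj C"
  shows "(\<iota> (Z \<otimes>\<^sub>o X) \<otimes>\<^sub>a ev X) \<cdot> \<alpha> (Z \<otimes>\<^sub>o X) (X\<^sup>\<or>) X \<cdot> (\<alpha>' Z X (X\<^sup>\<or>) \<otimes>\<^sub>a \<iota> X)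
      \<cdot> ((\<iota> Z \<otimes>\<^sub>a db X) \<otimes>\<^sub>a \<iota> X) = \<iota> (Z \<otimes>\<^sub>o X)"
proof -
  have "\<alpha> (Z \<otimes>\<^sub>o X) (X\<^sup>\<or>) X \<cdot> (\<alpha>' Z X (X\<^sup>\<or>) \<otimes>\<^sub>a \<iota> X) \<cdot> ((\<iota> Z \<otimes>\<^sub>a db X) \<otimes>\<^sub>a \<iota> X)
    = \<alpha>' Z X (X\<^sup>\<or> \<otimes>\<^sub>o X) \<cdot> (\<iota> Z \<otimes>\<^sub>a \<alpha> X (X\<^sup>\<or>) X) \<cdot> (\<iota> Z \<otimes>\<^sub>a (db X \<otimes>\<^sub>a \<iota> X))"
    by (simp add: pentagons_tail whisker_nats whisker_nats_tail)
  then show ?thesis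
    by (simp add: whisker_nats_tail merge)
qed

lemma triangle_counit:
  assumes [simp]: "Y \<in> Obj C" "X \<in> Obj C"
  shows "((\<iota> Y \<otimes>\<^sub>a ev X) \<otimes>\<^sub>a \<iota> (X\<^sup>\<or>)) \<cdot> (\<alpha> Y (X\<^sup>\<or>) X \<otimes>\<^sub>a \<iota> (X\<^sup>\<or>)) \<cdot> \<alpha>' (Y \<otimes>\<^sub>o X\<^sup>\<or>) X (X\<^sup>\<or>)
      \<cdot> (\<iota> (Y \<otimes>\<^sub>o X\<^sup>\<or>) \<otimes>\<^sub>a db X) = \<iota> (Y \<otimes>\<^sub>o X\<^sup>\<or>)"
  by (simp add: pentagons_tail whisker_nats whisker_nats_tail) (simp add: merge)

lemma uncurry_type [simp]:
  assumes [simp]: "Y \<in> Obj C" "X \<in> Obj C" "g \<in> Arr C" "Cod C g = Y \<otimes>\<^sub>o X\<^sup>\<or>"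
  shows "uncurry Y X g \<in> Arr C" "Dom C (uncurry Y X g) = Dom C g \<otimes>\<^sub>o X" "Cod C (uncurry Y X g) = Y"
  by (simp_all add: uncurry_def)

lemma curry_type [simp]:
  assumes [simp]: "Z \<in> Obj C" "X \<in> Obj C" "t \<in> Arr C" "Dom C t = Z \<otimes>\<^sub>o X"
  shows "curry Z X t \<in> Arr C" "Dom C (curry Z X t) = Z" "Cod C (curry Z X t) = Cod C t \<otimes>\<^sub>o X\<^sup>\<or>"
  by (simp_all add: curry_def)

lemma uncurry_curry:
  assumes [simp]: "Z \<in> Obj C" "X \<in> Obj C" "t \<in> Arr C" "Dom C t = Z \<otimes>\<^sub>o X" "Cod C t = Y"
  shows "uncurry Y X (curry Z X t) = t"
proof -
  have [simp]: "Y \<in> Obj C" using Obj_type(2)[of t] by simp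
  have "curry Z X t \<otimes>\<^sub>a \<iota> X = ((t \<otimes>\<^sub>a \<iota> (X\<^sup>\<or>)) \<otimes>\<^sub>a \<iota> X) \<cdot> (\<alpha>' Z X (X\<^sup>\<or>) \<otimes>\<^sub>a \<iota> X)
      \<cdot> ((\<iota> Z \<otimes>\<^sub>a db X) \<otimes>\<^sub>a \<iota> X)"
    by (simp add: curry_def merge)
  then have "uncurry Y X (curry Z X t) = (\<iota> Y \<otimes>\<^sub>a ev X) \<cdot> \<alpha> Y (X\<^sup>\<or>) X \<cdot> ((t \<otimes>\<^sub>a \<iota> (X\<^sup>\<or>)) \<otimes>\<^sub>a \<iota> X) \<cdot> (\<alpha>' Z X (X\<^sup>\<or>) \<otimes>\<^sub>a \<iota> X)
      \<cdot> ((\<iota> Z \<otimes>\<^sub>a db X) \<otimes>\<^sub>a \<iota> X)"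
    by (simp add: uncurry_def)
  also have "\<dots> = ((\<iota> Y \<otimes>\<^sub>a ev X) \<cdot> (t \<otimes>\<^sub>a \<iota> (X\<^sup>\<or> \<otimes>\<^sub>o X))) \<cdot> \<alpha> (Z \<otimes>\<^sub>o X) (X\<^sup>\<or>) X \<cdot> (\<alpha>' Z X (X\<^sup>\<or>) \<otimes>\<^sub>a \<iota> X)
      \<cdot> ((\<iota> Z \<otimes>\<^sub>a db X) \<otimes>\<^sub>a \<iota> X)"
    by (simp add: nat_left[THEN Comp_tail])
  also have "(\<iota> Y \<otimes>\<^sub>a ev X) \<cdot> (t \<otimes>\<^sub>a \<iota> (X\<^sup>\<or> \<otimes>\<^sub>o X)) = (t \<otimes>\<^sub>a \<iota> (Unit C)) \<cdot> (\<iota> (Z \<otimes>\<^sub>o X) \<otimes>\<^sub>a ev X)"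
    by (simp only: interchange assms ev_type Idn_type \<open>Y \<in> Obj C\<close> Dual_Obj TensorO_Obj Unit_Obj id_left id_right)
  finally show ?thesis
    using triangle_unit[of Z X] by simp
qed

lemma curry_uncurry:
  assumes [simp]: "Y \<in> Obj C" "X \<in> Obj C" "g \<in> Arr C" "Cod C g = Y \<otimes>\<^sub>o X\<^sup>\<or>" "Dom C g = Z"
  shows "curry Z X (uncurry Y X g) = g"
proof -
  have [simp]: "Z \<in> Obj C" using Obj_type(1)[of g] by simp
  have "uncurry Y X g \<otimes>\<^sub>a \<iota> (X\<^sup>\<or>) = ((\<iota> Y \<otimes>\<^sub>a ev X) \<otimes>\<^sub>a \<iota> (X\<^sup>\<or>)) \<cdot> (\<alpha> Y (X\<^sup>\<or>) X \<otimes>\<^sub>a \<iota> (X\<^sup>\<or>))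
     \<cdot> ((g \<otimes>\<^sub>a \<iota> X) \<otimes>\<^sub>a \<iota> (X\<^sup>\<or>))"
    by (simp add: uncurry_def merge)
  then have "curry Z X (uncurry Y X g) = ((\<iota> Y \<otimes>\<^sub>a ev X) \<otimes>\<^sub>a \<iota> (X\<^sup>\<or>)) \<cdot> (\<alpha> Y (X\<^sup>\<or>) X \<otimes>\<^sub>a \<iota> (X\<^sup>\<or>))
     \<cdot> ((g \<otimes>\<^sub>a \<iota> X) \<otimes>\<^sub>a \<iota> (X\<^sup>\<or>)) \<cdot> \<alpha>' Z X (X\<^sup>\<or>) \<cdot> (\<iota> Z \<otimes>\<^sub>a db X)"
    by (simp add: curry_def)
  also have "\<dots> = ((\<iota> Y \<otimes>\<^sub>a ev X) \<otimes>\<^sub>a \<iota> (X\<^sup>\<or>)) \<cdot> (\<alpha> Y (X\<^sup>\<or>) X \<otimes>\<^sub>a \<iota> (X\<^sup>\<or>))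
     \<cdot> \<alpha>' (Y \<otimes>\<^sub>o X\<^sup>\<or>) X (X\<^sup>\<or>) \<cdot> ((g \<otimes>\<^sub>a \<iota> (X \<otimes>\<^sub>o X\<^sup>\<or>)) \<cdot> (\<iota> Z \<otimes>\<^sub>a db X))"
    by (simp add: nat'_left[THEN Comp_tail])
  also have "(g \<otimes>\<^sub>a \<iota> (X \<otimes>\<^sub>o X\<^sup>\<or>)) \<cdot> (\<iota> Z \<otimes>\<^sub>a db X) = (\<iota> (Y \<otimes>\<^sub>o X\<^sup>\<or>) \<otimes>\<^sub>a db X) \<cdot> (g \<otimes>\<^sub>a \<iota> (Unit C))"
    by (simp only: interchange assms db_type Idn_type \<open>Z \<in> Obj C\<close> Dual_Obj TensorO_Obj Unit_Obj id_left id_right)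
  finally have "curry Z X (uncurry Y X g) = (((\<iota> Y \<otimes>\<^sub>a ev X) \<otimes>\<^sub>a \<iota> (X\<^sup>\<or>)) \<cdot> (\<alpha> Y (X\<^sup>\<or>) X \<otimes>\<^sub>a \<iota> (X\<^sup>\<or>))
     \<cdot> \<alpha>' (Y \<otimes>\<^sub>o X\<^sup>\<or>) X (X\<^sup>\<or>) \<cdot> (\<iota> (Y \<otimes>\<^sub>o X\<^sup>\<or>) \<otimes>\<^sub>a db X)) \<cdot> g"
    by simp
  then show ?thesis
    by (simp only: triangle_counit[OF assms(1,2)]) simp
qed

lemma uncurry_inject:
  assumes "Y \<in> Obj C" "X \<in> Obj C" "f \<in> Arr C" "g \<in> Arr C" "Cod C f = Y \<otimes>\<^sub>o X\<^sup>\<or>" "Cod C g = Y \<otimes>\<^sub>o X\<^sup>\<or>"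
    "Dom C f = Dom C g" "uncurry Y X f = uncurry Y X g"
  shows "f = g"
proof -
  have "curry (Dom C g) X (uncurry Y X f) = f" by (rule curry_uncurry) (use assms in auto)
  moreover have "curry (Dom C g) X (uncurry Y X g) = g" by (rule curry_uncurry) (use assms in auto)
  ultimately show ?thesis using assms(8) by metis
qed

text \<open>The bijection for \<open>Y = I\<close>: a morphism into \<open>X\<^sup>\<or>\<close> is the same as its pairing with \<open>X\<close>.\<close>

lemma ev_inject:
  assumes "X \<in> Obj C" "f \<in> Arr C" "g \<in> Arr C" "Cod C f = X\<^sup>\<or>" "Cod C g = X\<^sup>\<or>"
    "Dom C f = Dom C g" "ev X \<cdot> (f \<otimes>\<^sub>a \<iota> X) = ev X \<cdot> (g \<otimes>\<^sub>a \<iota> X)"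
  shows "f = g"
  using assms by (intro uncurry_inject[of "Unit C" X f g]) (simp_all add: uncurry_def)

lemma ev_surject:
  assumes "X \<in> Obj C" "t \<in> Arr C" "Z \<in> Obj C" "Dom C t = Z \<otimes>\<^sub>o X" "Cod C t = Unit C"
  shows "\<exists>g. g \<in> Arr C \<and> Dom C g = Z \<and> Cod C g = X\<^sup>\<or> \<and> ev X \<cdot> (g \<otimes>\<^sub>a \<iota> X) = t"
proof (intro exI conjI)
  show "ev X \<cdot> (curry Z X t \<otimes>\<^sub>a \<iota> X) = t"
    using uncurry_curry[of Z X t "Unit C"] assms by (simp add: uncurry_def)
qed (use assms in simp_all)

text \<open>Justifies the definite description in the definition of \<open>dual_arr\<close>.\<close>

lemma dual_arr_spec:
  assumes "f \<in> Arr C"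
  shows "dual_arr C f \<in> Arr C \<and> Dom C (dual_arr C f) = (Cod C f)\<^sup>\<or> \<and> Cod C (dual_arr C f) = (Dom C f)\<^sup>\<or>
    \<and> ev (Dom C f) \<cdot> (dual_arr C f \<otimes>\<^sub>a \<iota> (Dom C f)) = ev (Cod C f) \<cdot> (\<iota> ((Cod C f)\<^sup>\<or>) \<otimes>\<^sub>a f)"
proof -
  let ?P = "\<lambda>g. g \<in> Hom C ((Cod C f)\<^sup>\<or>) ((Dom C f)\<^sup>\<or>)
    \<and> ev (Dom C f) \<cdot> (g \<otimes>\<^sub>a \<iota> (Dom C f)) = ev (Cod C f) \<cdot> (\<iota> ((Cod C f)\<^sup>\<or>) \<otimes>\<^sub>a f)"
  obtain g where g: "?P g"
    using ev_surject[of "Dom C f" "ev (Cod C f) \<cdot> (\<iota> ((Cod C f)\<^sup>\<or>) \<otimes>\<^sub>a f)" "(Cod C f)\<^sup>\<or>"] assms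
    by (auto simp: Hom_def)
  have uniq: "g = h" if "?P g" "?P h" for g h
    using that assms by (intro ev_inject[of "Dom C f" g h]) (auto simp: Hom_def)
  have "?P (THE g. ?P g)"
    by (rule theI[of ?P g]) (use g in blast, rule uniq[OF _ g])
  then show ?thesis by (auto simp: dual_arr_def Let_def Hom_def)
qed

lemma dual_arr_type [simp]:
  assumes "f \<in> Arr C"
  shows "dual_arr C f \<in> Arr C" "Dom C (dual_arr C f) = (Cod C f)\<^sup>\<or>" "Cod C (dual_arr C f) = (Dom C f)\<^sup>\<or>"
  using dual_arr_spec[OF assms] by auto

lemma ev_dual_arr:
  assumes "f \<in> Arr C" "Dom C f = V" "Cod C f = W"
  shows "ev V \<cdot> (dual_arr C f \<otimes>\<^sub>a \<iota> V) = ev W \<cdot> (\<iota> (W\<^sup>\<or>) \<otimes>\<^sub>a f)"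
  using dual_arr_spec[OF assms(1)] assms by auto

lemma dual_arr_eqI:
  assumes "f \<in> Arr C" "Dom C f = V" "Cod C f = W" "g \<in> Arr C" "Dom C g = W\<^sup>\<or>" "Cod C g = V\<^sup>\<or>"
    "ev V \<cdot> (g \<otimes>\<^sub>a \<iota> V) = ev W \<cdot> (\<iota> (W\<^sup>\<or>) \<otimes>\<^sub>a f)"
  shows "dual_arr C f = g"
proof (rule ev_inject[of V])
  show "V \<in> Obj C" using assms Obj_type(1)[of f] by simp
  show "ev V \<cdot> (dual_arr C f \<otimes>\<^sub>a \<iota> V) = ev V \<cdot> (g \<otimes>\<^sub>a \<iota> V)"
    using ev_dual_arr[OF assms(1-3)] assms(7) by simp
qed (use assms in simp_all)

lemma dual_arr_Comp:
  assumes [simp]: "f \<in> Arr C" "g \<in> Arr C" "Dom C g = Cod C f"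
  shows "dual_arr C (g \<cdot> f) = dual_arr C f \<cdot> dual_arr C g"
proof (rule dual_arr_eqI)
  let ?U = "Dom C f" and ?V = "Cod C f" and ?W = "Cod C g"
  have "ev ?U \<cdot> ((dual_arr C f \<cdot> dual_arr C g) \<otimes>\<^sub>a \<iota> ?U)
    = (ev ?U \<cdot> (dual_arr C f \<otimes>\<^sub>a \<iota> ?U)) \<cdot> (dual_arr C g \<otimes>\<^sub>a \<iota> ?U)"
    by (simp add: interchange)
  also have "\<dots> = (ev ?V \<cdot> (\<iota> (?V\<^sup>\<or>) \<otimes>\<^sub>a f)) \<cdot> (dual_arr C g \<otimes>\<^sub>a \<iota> ?U)"
    by (subst ev_dual_arr[of f ?U ?V]) simp_all
  also have "\<dots> = (ev ?V \<cdot> (dual_arr C g \<otimes>\<^sub>a \<iota> ?V)) \<cdot> (\<iota> (?W\<^sup>\<or>) \<otimes>\<^sub>a f)"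
    by (simp add: interchange)
  also have "\<dots> = (ev ?W \<cdot> (\<iota> (?W\<^sup>\<or>) \<otimes>\<^sub>a g)) \<cdot> (\<iota> (?W\<^sup>\<or>) \<otimes>\<^sub>a f)"
    by (subst ev_dual_arr[of g ?V ?W]) simp_all
  also have "\<dots> = ev ?W \<cdot> (\<iota> (?W\<^sup>\<or>) \<otimes>\<^sub>a (g \<cdot> f))"
    by (simp add: interchange)
  finally show "ev ?U \<cdot> ((dual_arr C f \<cdot> dual_arr C g) \<otimes>\<^sub>a \<iota> ?U) = ev ?W \<cdot> (\<iota> (?W\<^sup>\<or>) \<otimes>\<^sub>a (g \<cdot> f))" .
qed simp_all

lemma dual_arr_Idn:
  assumes [simp]: "X \<in> Obj C"
  shows "dual_arr C (\<iota> X) = \<iota> (X\<^sup>\<or>)"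
  by (rule dual_arr_eqI) simp_all

lemma is_iso_dual_arr:
  assumes "is_iso C f" shows "is_iso C (dual_arr C f)"
proof (rule is_isoI)
  note [simp] = is_iso_Arr[OF assms] assms
  show "dual_arr C (Inv C f) \<cdot> dual_arr C f = Idn C (Dom C (dual_arr C f))"
    by (subst dual_arr_Comp[symmetric]) (simp_all add: dual_arr_Idn)
  show "dual_arr C f \<cdot> dual_arr C (Inv C f) = Idn C (Cod C (dual_arr C f))"
    by (subst dual_arr_Comp[symmetric]) (simp_all add: dual_arr_Idn)
qed (use assms is_iso_Arr in simp_all)

section \<open>The dual of a tensor product\<close>

lemma tensor_ev_type [simp]:
  assumes [simp]: "V \<in> Obj C" "W \<in> Obj C"
  shows "tensor_ev C V W \<in> Arr C" "Dom C (tensor_ev C V W) = (W\<^sup>\<or> \<otimes>\<^sub>o V\<^sup>\<or>) \<otimes>\<^sub>o (V \<otimes>\<^sub>o W)"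
    "Cod C (tensor_ev C V W) = Unit C"
  by (simp_all add: tensor_ev_def)

text \<open>Pairing with \<open>V \<otimes> W\<close> through \<open>tensor_ev\<close> means pairing off \<open>V\<close> first and then \<open>W\<close>. This is what
  gives \<open>W\<^sup>\<or> \<otimes> V\<^sup>\<or>\<close> the universal property of a dual of \<open>V \<otimes> W\<close>, as a composite of two instances of the
  adjunction.\<close>

lemma tensor_ev_uncurry:
  assumes [simp]: "V \<in> Obj C" "W \<in> Obj C" "g \<in> Arr C" "Dom C g = Z" "Cod C g = W\<^sup>\<or> \<otimes>\<^sub>o V\<^sup>\<or>"
  shows "tensor_ev C V W \<cdot> (g \<otimes>\<^sub>a \<iota> (V \<otimes>\<^sub>o W))
    = ev W \<cdot> (uncurry (W\<^sup>\<or>) V g \<otimes>\<^sub>a \<iota> W) \<cdot> \<alpha>' Z V W"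
proof -
  have [simp]: "Z \<in> Obj C" using Obj_type(1)[of g] by simp
  have "uncurry (W\<^sup>\<or>) V g \<otimes>\<^sub>a \<iota> W = ((\<iota> (W\<^sup>\<or>) \<otimes>\<^sub>a ev V) \<otimes>\<^sub>a \<iota> W) \<cdot> (\<alpha> (W\<^sup>\<or>) (V\<^sup>\<or>) V \<otimes>\<^sub>a \<iota> W)
    \<cdot> ((g \<otimes>\<^sub>a \<iota> V) \<otimes>\<^sub>a \<iota> W)"
    by (simp add: uncurry_def merge)
  then have "ev W \<cdot> (uncurry (W\<^sup>\<or>) V g \<otimes>\<^sub>a \<iota> W) \<cdot> \<alpha>' Z V W = ev W \<cdot> ((\<iota> (W\<^sup>\<or>) \<otimes>\<^sub>a ev V) \<otimes>\<^sub>a \<iota> W) 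
    \<cdot> (\<alpha> (W\<^sup>\<or>) (V\<^sup>\<or>) V \<otimes>\<^sub>a \<iota> W) \<cdot> ((g \<otimes>\<^sub>a \<iota> V) \<otimes>\<^sub>a \<iota> W) \<cdot> \<alpha>' Z V W"
    by simp
  also have "\<dots> = ev W \<cdot> (\<iota> (W\<^sup>\<or>) \<otimes>\<^sub>a (ev V \<otimes>\<^sub>a \<iota> W)) \<cdot> (\<iota> (W\<^sup>\<or>) \<otimes>\<^sub>a \<alpha>' (V\<^sup>\<or>) V W)
     \<cdot> \<alpha> (W\<^sup>\<or>) (V\<^sup>\<or>) (V \<otimes>\<^sub>o W) \<cdot> (g \<otimes>\<^sub>a \<iota> (V \<otimes>\<^sub>o W))"
    by (simp add: whisker_nats whisker_nats_tail pentagons_tail)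
  also have "\<dots> = tensor_ev C V W \<cdot> (g \<otimes>\<^sub>a \<iota> (V \<otimes>\<^sub>o W))"
    by (simp add: tensor_ev_def merge)
  finally show ?thesis by simp
qed

lemma tensor_ev_inject:
  assumes [simp]: "V \<in> Obj C" "W \<in> Obj C" "f \<in> Arr C" "g \<in> Arr C" "Cod C f = W\<^sup>\<or> \<otimes>\<^sub>o V\<^sup>\<or>" "Cod C g = W\<^sup>\<or> \<otimes>\<^sub>o V\<^sup>\<or>"
    and [simp]: "Dom C f = Dom C g"
    and eq: "tensor_ev C V W \<cdot> (f \<otimes>\<^sub>a \<iota> (V \<otimes>\<^sub>o W)) = tensor_ev C V W \<cdot> (g \<otimes>\<^sub>a \<iota> (V \<otimes>\<^sub>o W))"
  shows "f = g"
proof (rule uncurry_inject[of "W\<^sup>\<or>" V])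
  show "uncurry (W\<^sup>\<or>) V f = uncurry (W\<^sup>\<or>) V g"
  proof (rule ev_inject[of W])
    show "ev W \<cdot> (uncurry (W\<^sup>\<or>) V f \<otimes>\<^sub>a \<iota> W) = ev W \<cdot> (uncurry (W\<^sup>\<or>) V g \<otimes>\<^sub>a \<iota> W)"
      by (rule iso_cancel_right[of "\<alpha>' (Dom C g) V W"])
        (use eq in \<open>simp_all add: tensor_ev_uncurry is_isoI[of _ "\<alpha> (Dom C g) V W"]\<close>)
  qed simp_all
qed simp_all

lemma tensor_ev_surject:
  assumes [simp]: "V \<in> Obj C" "W \<in> Obj C" "t \<in> Arr C" "Z \<in> Obj C" "Dom C t = Z \<otimes>\<^sub>o (V \<otimes>\<^sub>o W)" "Cod C t = Unit C"
  shows "\<exists>g. g \<in> Arr C \<and> Dom C g = Z \<and> Cod C g = W\<^sup>\<or> \<otimes>\<^sub>o V\<^sup>\<or> \<and> tensor_ev C V W \<cdot> (g \<otimes>\<^sub>a \<iota> (V \<otimes>\<^sub>o W)) = t"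
proof -
  obtain h where [simp]: "h \<in> Arr C" "Dom C h = Z \<otimes>\<^sub>o V" "Cod C h = W\<^sup>\<or>"
    and h: "ev W \<cdot> (h \<otimes>\<^sub>a \<iota> W) = t \<cdot> \<alpha> Z V W"
    using ev_surject[of W "t \<cdot> \<alpha> Z V W" "Z \<otimes>\<^sub>o V"] by auto
  have "tensor_ev C V W \<cdot> (curry Z V h \<otimes>\<^sub>a \<iota> (V \<otimes>\<^sub>o W)) = (ev W \<cdot> (h \<otimes>\<^sub>a \<iota> W)) \<cdot> \<alpha>' Z V W"
    by (subst tensor_ev_uncurry) (simp_all add: uncurry_curry)
  also have "\<dots> = t" unfolding h by simp
  finally show ?thesis by (intro exI[of _ "curry Z V h"]) simp
qed

lemma dual_tensor_spec:
  assumes [simp]: "V \<in> Obj C" "W \<in> Obj C"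
  shows "dual_tensor C V W \<in> Hom C (W\<^sup>\<or> \<otimes>\<^sub>o V\<^sup>\<or>) ((V \<otimes>\<^sub>o W)\<^sup>\<or>)
    \<and> ev (V \<otimes>\<^sub>o W) \<cdot> (dual_tensor C V W \<otimes>\<^sub>a \<iota> (V \<otimes>\<^sub>o W)) = tensor_ev C V W"
proof -
  let ?P = "\<lambda>g. g \<in> Hom C (W\<^sup>\<or> \<otimes>\<^sub>o V\<^sup>\<or>) ((V \<otimes>\<^sub>o W)\<^sup>\<or>)
    \<and> ev (V \<otimes>\<^sub>o W) \<cdot> (g \<otimes>\<^sub>a \<iota> (V \<otimes>\<^sub>o W)) = tensor_ev C V W"
  obtain g where g: "?P g"
    using ev_surject[of "V \<otimes>\<^sub>o W" "tensor_ev C V W" "W\<^sup>\<or> \<otimes>\<^sub>o V\<^sup>\<or>"] by (auto simp: Hom_def)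
  have uniq: "g = h" if "?P g" "?P h" for g h
    using that by (intro ev_inject[of "V \<otimes>\<^sub>o W" g h]) (auto simp: Hom_def)
  have "?P (THE g. ?P g)"
    by (rule theI[of ?P g]) (use g in blast, rule uniq[OF _ g])
  then show ?thesis by (simp add: dual_tensor_def)
qed

lemma dual_tensor_type [simp]:
  assumes "V \<in> Obj C" "W \<in> Obj C"
  shows "dual_tensor C V W \<in> Arr C" "Dom C (dual_tensor C V W) = W\<^sup>\<or> \<otimes>\<^sub>o V\<^sup>\<or>"
    "Cod C (dual_tensor C V W) = (V \<otimes>\<^sub>o W)\<^sup>\<or>"
  using dual_tensor_spec[OF assms] by (auto simp: Hom_def)

lemmas ev_dual_tensor = conjunct2[OF dual_tensor_spec]

text \<open>\<open>W\<^sup>\<or> \<otimes> V\<^sup>\<or>\<close> and \<open>(V \<otimes> W)\<^sup>\<or>\<close> have the same universal property, so the comparison morphism is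
  invertible.\<close>

lemma is_iso_dual_tensor [simp]:
  assumes [simp]: "V \<in> Obj C" "W \<in> Obj C"
  shows "is_iso C (dual_tensor C V W)"
proof -
  let ?d = "dual_tensor C V W"
  obtain e where [simp]: "e \<in> Arr C" "Dom C e = (V \<otimes>\<^sub>o W)\<^sup>\<or>" "Cod C e = W\<^sup>\<or> \<otimes>\<^sub>o V\<^sup>\<or>"
    and e: "tensor_ev C V W \<cdot> (e \<otimes>\<^sub>a \<iota> (V \<otimes>\<^sub>o W)) = ev (V \<otimes>\<^sub>o W)"
    using tensor_ev_surject[of V W "ev (V \<otimes>\<^sub>o W)" "(V \<otimes>\<^sub>o W)\<^sup>\<or>"] by auto
  have "ev (V \<otimes>\<^sub>o W) \<cdot> ((?d \<cdot> e) \<otimes>\<^sub>a \<iota> (V \<otimes>\<^sub>o W))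
    = (ev (V \<otimes>\<^sub>o W) \<cdot> (?d \<otimes>\<^sub>a \<iota> (V \<otimes>\<^sub>o W))) \<cdot> (e \<otimes>\<^sub>a \<iota> (V \<otimes>\<^sub>o W))"
    by (simp add: interchange)
  also have "\<dots> = ev (V \<otimes>\<^sub>o W) \<cdot> (\<iota> ((V \<otimes>\<^sub>o W)\<^sup>\<or>) \<otimes>\<^sub>a \<iota> (V \<otimes>\<^sub>o W))"
    by (simp only: ev_dual_tensor[OF assms] e) simp
  finally have de: "?d \<cdot> e = \<iota> ((V \<otimes>\<^sub>o W)\<^sup>\<or>)"
    by (rule ev_inject[of "V \<otimes>\<^sub>o W", rotated -1]) simp_all
  have "tensor_ev C V W \<cdot> ((e \<cdot> ?d) \<otimes>\<^sub>a \<iota> (V \<otimes>\<^sub>o W))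
    = (tensor_ev C V W \<cdot> (e \<otimes>\<^sub>a \<iota> (V \<otimes>\<^sub>o W))) \<cdot> (?d \<otimes>\<^sub>a \<iota> (V \<otimes>\<^sub>o W))"
    by (simp add: interchange)
  also have "\<dots> = tensor_ev C V W \<cdot> (\<iota> (W\<^sup>\<or> \<otimes>\<^sub>o V\<^sup>\<or>) \<otimes>\<^sub>a \<iota> (V \<otimes>\<^sub>o W))"
    by (simp only: ev_dual_tensor[OF assms] e) simp
  finally have ed: "e \<cdot> ?d = \<iota> (W\<^sup>\<or> \<otimes>\<^sub>o V\<^sup>\<or>)"
    by (rule tensor_ev_inject[of V W, rotated -1]) simp_all
  show ?thesis by (rule is_isoI[of _ e]) (simp_all add: de ed)
qed

section \<open>Bending legs on the left and on the right\<close>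

lemma A_map_type [simp]:
  assumes "V \<in> Obj C" "W \<in> Obj C" "f \<in> Arr C" "Cod C f = V \<otimes>\<^sub>o W"
  shows "A_map C V W f \<in> Arr C" "Dom C (A_map C V W f) = V\<^sup>\<or> \<otimes>\<^sub>o Dom C f" "Cod C (A_map C V W f) = W"
  using assms by (simp_all add: A_map_def)

text \<open>Bending \<open>V \<otimes> W\<close> down on the left is bending \<open>V\<close> and then \<open>W\<close>: the evaluation of \<open>V\<close> sits inside
  that of \<open>W\<close>. The outer bending applies to a morphism with domain \<open>V\<^sup>\<or>\<close>, which is why the
  typing of \<open>A_map\<close> does not fix the domain to be \<open>I\<close>.\<close>

lemma A_map_dual_tensor:
  assumes [simp]: "V \<in> Obj C" "W \<in> Obj C" "U \<in> Obj C"
    "f \<in> Arr C" "Dom C f = Unit C" "Cod C f = V \<otimes>\<^sub>o (W \<otimes>\<^sub>o U)"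
  shows "A_map C (V \<otimes>\<^sub>o W) U (\<alpha>' V W U \<cdot> f) \<cdot> dual_tensor C V W
    = A_map C W U (A_map C V (W \<otimes>\<^sub>o U) f)"
proof -
  let ?d = "dual_tensor C V W" and ?X = "W\<^sup>\<or>" and ?Y = "V\<^sup>\<or>"
  define q where "q = \<alpha>' V W U \<cdot> f"
  have [simp]: "q \<in> Arr C" "Dom C q = Unit C" "Cod C q = (V \<otimes>\<^sub>o W) \<otimes>\<^sub>o U"
    by (simp_all add: q_def)
  have "A_map C (V \<otimes>\<^sub>o W) U q \<cdot> ?d
    = (ev (V \<otimes>\<^sub>o W) \<otimes>\<^sub>a \<iota> U) \<cdot> \<alpha>' ((V \<otimes>\<^sub>o W)\<^sup>\<or>) (V \<otimes>\<^sub>o W) U \<cdot> ((\<iota> ((V \<otimes>\<^sub>o W)\<^sup>\<or>) \<otimes>\<^sub>a q) \<cdot> (?d \<otimes>\<^sub>a \<iota> (Unit C)))"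
    by (simp add: A_map_def)
  also have "(\<iota> ((V \<otimes>\<^sub>o W)\<^sup>\<or>) \<otimes>\<^sub>a q) \<cdot> (?d \<otimes>\<^sub>a \<iota> (Unit C))
    = (?d \<otimes>\<^sub>a \<iota> ((V \<otimes>\<^sub>o W) \<otimes>\<^sub>o U)) \<cdot> (\<iota> (?X \<otimes>\<^sub>o ?Y) \<otimes>\<^sub>a q)"
    by (simp add: interchange del: Tensor_Unit)
  also have "(ev (V \<otimes>\<^sub>o W) \<otimes>\<^sub>a \<iota> U) \<cdot> \<alpha>' ((V \<otimes>\<^sub>o W)\<^sup>\<or>) (V \<otimes>\<^sub>o W) U \<cdot> \<dots>
    = ((ev (V \<otimes>\<^sub>o W) \<otimes>\<^sub>a \<iota> U) \<cdot> ((?d \<otimes>\<^sub>a \<iota> (V \<otimes>\<^sub>o W)) \<otimes>\<^sub>a \<iota> U)) \<cdot> \<alpha>' (?X \<otimes>\<^sub>o ?Y) (V \<otimes>\<^sub>o W) U \<cdot> (\<iota> (?X \<otimes>\<^sub>o ?Y) \<otimes>\<^sub>a q)"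
    by (simp add: nat'_left[THEN Comp_tail])
  also have "(ev (V \<otimes>\<^sub>o W) \<otimes>\<^sub>a \<iota> U) \<cdot> ((?d \<otimes>\<^sub>a \<iota> (V \<otimes>\<^sub>o W)) \<otimes>\<^sub>a \<iota> U) = tensor_ev C V W \<otimes>\<^sub>a \<iota> U"
    by (simp add: interchange ev_dual_tensor)
  also have "\<dots> = (ev W \<otimes>\<^sub>a \<iota> U) \<cdot> ((\<iota> ?X \<otimes>\<^sub>a (ev V \<otimes>\<^sub>a \<iota> W)) \<otimes>\<^sub>a \<iota> U)
      \<cdot> ((\<iota> ?X \<otimes>\<^sub>a \<alpha>' ?Y V W) \<otimes>\<^sub>a \<iota> U) \<cdot> (\<alpha> ?X ?Y (V \<otimes>\<^sub>o W) \<otimes>\<^sub>a \<iota> U)"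
    by (simp add: tensor_ev_def merge)
  also have "\<dots> \<cdot> \<alpha>' (?X \<otimes>\<^sub>o ?Y) (V \<otimes>\<^sub>o W) U \<cdot> (\<iota> (?X \<otimes>\<^sub>o ?Y) \<otimes>\<^sub>a q)
    = (ev W \<otimes>\<^sub>a \<iota> U) \<cdot> \<alpha>' ?X W U \<cdot> (\<iota> ?X \<otimes>\<^sub>a ((ev V \<otimes>\<^sub>a \<iota> W) \<otimes>\<^sub>a \<iota> U))
      \<cdot> (\<iota> ?X \<otimes>\<^sub>a (\<alpha>' ?Y V W \<otimes>\<^sub>a \<iota> U)) \<cdot> (\<iota> ?X \<otimes>\<^sub>a \<alpha>' ?Y (V \<otimes>\<^sub>o W) U) \<cdot> (\<iota> ?X \<otimes>\<^sub>a (\<iota> ?Y \<otimes>\<^sub>a q))"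
    by (simp add: whisker_nats whisker_nats_tail pentagons_tail)
  also have "\<dots> = (ev W \<otimes>\<^sub>a \<iota> U) \<cdot> \<alpha>' ?X W U \<cdot> (\<iota> ?X \<otimes>\<^sub>a (((ev V \<otimes>\<^sub>a \<iota> W) \<otimes>\<^sub>a \<iota> U)
      \<cdot> (\<alpha>' ?Y V W \<otimes>\<^sub>a \<iota> U) \<cdot> \<alpha>' ?Y (V \<otimes>\<^sub>o W) U \<cdot> (\<iota> ?Y \<otimes>\<^sub>a q)))"
    by (simp add: merge)
  also have "((ev V \<otimes>\<^sub>a \<iota> W) \<otimes>\<^sub>a \<iota> U) \<cdot> (\<alpha>' ?Y V W \<otimes>\<^sub>a \<iota> U) \<cdot> \<alpha>' ?Y (V \<otimes>\<^sub>o W) U \<cdot> (\<iota> ?Y \<otimes>\<^sub>a q)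
    = A_map C V (W \<otimes>\<^sub>o U) f"
  proof -
    have "((ev V \<otimes>\<^sub>a \<iota> W) \<otimes>\<^sub>a \<iota> U) = (ev V \<otimes>\<^sub>a \<iota> (W \<otimes>\<^sub>o U)) \<cdot> \<alpha> (?Y \<otimes>\<^sub>o V) W U"
      using nat_left[of "ev V" W U "Unit C"] by simp
    then have "((ev V \<otimes>\<^sub>a \<iota> W) \<otimes>\<^sub>a \<iota> U) \<cdot> (\<alpha>' ?Y V W \<otimes>\<^sub>a \<iota> U) \<cdot> \<alpha>' ?Y (V \<otimes>\<^sub>o W) U \<cdot> (\<iota> ?Y \<otimes>\<^sub>a q)
      = (ev V \<otimes>\<^sub>a \<iota> (W \<otimes>\<^sub>o U)) \<cdot> \<alpha>' ?Y V (W \<otimes>\<^sub>o U) \<cdot> (\<iota> ?Y \<otimes>\<^sub>a \<alpha> V W U) \<cdot> (\<iota> ?Y \<otimes>\<^sub>a q)"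
      by (simp add: pentagons_tail)
    also have "(\<iota> ?Y \<otimes>\<^sub>a \<alpha> V W U) \<cdot> (\<iota> ?Y \<otimes>\<^sub>a q) = \<iota> ?Y \<otimes>\<^sub>a f"
      by (simp add: interchange q_def)
    finally show ?thesis by (simp add: A_map_def)
  qed
  finally show ?thesis
    by (simp add: A_map_def[of C W U] q_def)
qed

end

context pivotal_category
begin

abbreviation piv where "piv \<equiv> Piv C"

lemma piv_type [simp]:
  assumes "V \<in> Obj C"
  shows "piv V \<in> Arr C" "Dom C (piv V) = V" "Cod C (piv V) = V\<^sup>\<or>\<^sup>\<or>" "is_iso C (piv V)"
  using Piv_Hom[OF assms] Piv_iso[OF assms] by (auto simp: Hom_def)

text \<open>The pivotal structure makes \<open>V\<close> a dual of \<open>V\<^sup>\<or>\<close>; \<open>ev_right\<close> is the corresponding evaluation, and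
  \<open>A_right\<close> is the mirror image of \<open>A_map\<close> that it defines.\<close>

definition ev_right where "ev_right V = ev (V\<^sup>\<or>) \<cdot> (piv V \<otimes>\<^sub>a \<iota> (V\<^sup>\<or>))"

lemma ev_right_type [simp]:
  assumes "V \<in> Obj C"
  shows "ev_right V \<in> Arr C" "Dom C (ev_right V) = V \<otimes>\<^sub>o V\<^sup>\<or>" "Cod C (ev_right V) = Unit C"
  using assms by (simp_all add: ev_right_def)

definition A_right where
  "A_right V W g = (\<iota> W \<otimes>\<^sub>a ev_right V) \<cdot> \<alpha> W V (V\<^sup>\<or>) \<cdot> (g \<otimes>\<^sub>a \<iota> (V\<^sup>\<or>))"

lemma A_right_type [simp]:
  assumes "V \<in> Obj C" "W \<in> Obj C" "g \<in> Arr C" "Cod C g = W \<otimes>\<^sub>o V"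
  shows "A_right V W g \<in> Arr C" "Dom C (A_right V W g) = Dom C g \<otimes>\<^sub>o V\<^sup>\<or>" "Cod C (A_right V W g) = W"
  using assms by (simp_all add: A_right_def)

lemma A_right_uncurry:
  assumes [simp]: "V \<in> Obj C" "W \<in> Obj C" "g \<in> Arr C" "Cod C g = W \<otimes>\<^sub>o V"
  shows "A_right V W g = uncurry W (V\<^sup>\<or>) ((\<iota> W \<otimes>\<^sub>a piv V) \<cdot> g)"
proof -
  have "A_right V W g = (\<iota> W \<otimes>\<^sub>a ev (V\<^sup>\<or>)) \<cdot> (\<iota> W \<otimes>\<^sub>a (piv V \<otimes>\<^sub>a \<iota> (V\<^sup>\<or>))) \<cdot> \<alpha> W V (V\<^sup>\<or>) \<cdot> (g \<otimes>\<^sub>a \<iota> (V\<^sup>\<or>))"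
    by (simp add: A_right_def ev_right_def merge)
  also have "\<dots> = (\<iota> W \<otimes>\<^sub>a ev (V\<^sup>\<or>)) \<cdot> \<alpha> W (V\<^sup>\<or>\<^sup>\<or>) (V\<^sup>\<or>) \<cdot> (((\<iota> W \<otimes>\<^sub>a piv V) \<otimes>\<^sub>a \<iota> (V\<^sup>\<or>)) \<cdot> (g \<otimes>\<^sub>a \<iota> (V\<^sup>\<or>)))"
    by (simp add: nat_mid[THEN Comp_tail])
  also have "\<dots> = uncurry W (V\<^sup>\<or>) ((\<iota> W \<otimes>\<^sub>a piv V) \<cdot> g)"
    by (simp add: uncurry_def interchange)
  finally show ?thesis .
qed

lemma A_right_inject:
  assumes [simp]: "V \<in> Obj C" "W \<in> Obj C" "f \<in> Arr C" "g \<in> Arr C" "Cod C f = W \<otimes>\<^sub>o V" "Cod C g = W \<otimes>\<^sub>o V"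
    "Dom C f = Dom C g" and eq: "A_right V W f = A_right V W g"
  shows "f = g"
proof (rule iso_cancel_left)
  show "(\<iota> W \<otimes>\<^sub>a piv V) \<cdot> f = (\<iota> W \<otimes>\<^sub>a piv V) \<cdot> g"
    by (rule uncurry_inject[of W "V\<^sup>\<or>"]) (simp_all add: eq flip: A_right_uncurry)
qed (simp_all add: is_iso_tensor)

lemma T_map_type [simp]:
  assumes "V \<in> Obj C" "W \<in> Obj C" "f \<in> Arr C" "Dom C f = V\<^sup>\<or>" "Cod C f = W"
  shows "T_map C V W f \<in> Arr C" "Dom C (T_map C V W f) = W\<^sup>\<or>" "Cod C (T_map C V W f) = V"
  using assms by (simp_all add: T_map_def)

lemma E_map_type [simp]:
  assumes "V \<in> Obj C" "W \<in> Obj C" "f \<in> Arr C" "Dom C f = Unit C" "Cod C f = V \<otimes>\<^sub>o W"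
  shows "E_map C V W f \<in> Arr C" "Dom C (E_map C V W f) = Unit C" "Cod C (E_map C V W f) = W \<otimes>\<^sub>o V"
  using assms by (simp_all add: E_map_def A_inv_def)

text \<open>By definition \<open>E\<close> attaches \<open>h\<^sup>\<or>\<close>, for \<open>h = A f\<close>, to the coevaluation of \<open>W\<close> and corrects by the
  pivotal isomorphism. Bending the last leg down cancels the correction; the defining property of
  \<open>h\<^sup>\<or>\<close> then moves \<open>h\<close> to the other leg, where a zigzag of \<open>W\<close> straightens out and leaves \<open>h\<close>.\<close>

lemma A_right_E_map:
  assumes [simp]: "V \<in> Obj C" "W \<in> Obj C" "f \<in> Arr C" "Dom C f = Unit C" "Cod C f = V \<otimes>\<^sub>o W"
  shows "A_right V W (E_map C V W f) = A_map C V W f"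
proof -
  define h where "h = A_map C V W f"
  have [simp]: "h \<in> Arr C" "Dom C h = V\<^sup>\<or>" "Cod C h = W" by (simp_all add: h_def)
  \<comment> \<open>The pivotal isomorphism in \<open>ev_right\<close> cancels against its inverse in \<open>T_map\<close>.\<close>
  have "(\<iota> W \<otimes>\<^sub>a piv V) \<cdot> E_map C V W f = (\<iota> W \<otimes>\<^sub>a dual_arr C h) \<cdot> db W"
    by (simp add: E_map_def A_inv_def T_map_def merge flip: h_def)
  then have "A_right V W (E_map C V W f) = (\<iota> W \<otimes>\<^sub>a ev (V\<^sup>\<or>)) \<cdot> \<alpha> W (V\<^sup>\<or>\<^sup>\<or>) (V\<^sup>\<or>)
      \<cdot> (((\<iota> W \<otimes>\<^sub>a dual_arr C h) \<cdot> db W) \<otimes>\<^sub>a \<iota> (V\<^sup>\<or>))"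
    by (simp add: A_right_uncurry uncurry_def)
  also have "((\<iota> W \<otimes>\<^sub>a dual_arr C h) \<cdot> db W) \<otimes>\<^sub>a \<iota> (V\<^sup>\<or>)
    = ((\<iota> W \<otimes>\<^sub>a dual_arr C h) \<otimes>\<^sub>a \<iota> (V\<^sup>\<or>)) \<cdot> (db W \<otimes>\<^sub>a \<iota> (V\<^sup>\<or>))"
    by (simp add: interchange)
  also have "(\<iota> W \<otimes>\<^sub>a ev (V\<^sup>\<or>)) \<cdot> \<alpha> W (V\<^sup>\<or>\<^sup>\<or>) (V\<^sup>\<or>) \<cdot> \<dots>
    = (\<iota> W \<otimes>\<^sub>a (ev (V\<^sup>\<or>) \<cdot> (dual_arr C h \<otimes>\<^sub>a \<iota> (V\<^sup>\<or>)))) \<cdot> \<alpha> W (W\<^sup>\<or>) (V\<^sup>\<or>) \<cdot> (db W \<otimes>\<^sub>a \<iota> (V\<^sup>\<or>))"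
    by (simp add: nat_mid[THEN Comp_tail]) (simp add: merge)
  also have "ev (V\<^sup>\<or>) \<cdot> (dual_arr C h \<otimes>\<^sub>a \<iota> (V\<^sup>\<or>)) = ev W \<cdot> (\<iota> (W\<^sup>\<or>) \<otimes>\<^sub>a h)"
    by (rule ev_dual_arr) simp_all
  also have "(\<iota> W \<otimes>\<^sub>a (ev W \<cdot> (\<iota> (W\<^sup>\<or>) \<otimes>\<^sub>a h))) \<cdot> \<alpha> W (W\<^sup>\<or>) (V\<^sup>\<or>) \<cdot> (db W \<otimes>\<^sub>a \<iota> (V\<^sup>\<or>))
    = (\<iota> W \<otimes>\<^sub>a ev W) \<cdot> ((\<iota> W \<otimes>\<^sub>a (\<iota> (W\<^sup>\<or>) \<otimes>\<^sub>a h)) \<cdot> \<alpha> W (W\<^sup>\<or>) (V\<^sup>\<or>)) \<cdot> (db W \<otimes>\<^sub>a \<iota> (V\<^sup>\<or>))"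
    by (simp add: merge)
  also have "(\<iota> W \<otimes>\<^sub>a (\<iota> (W\<^sup>\<or>) \<otimes>\<^sub>a h)) \<cdot> \<alpha> W (W\<^sup>\<or>) (V\<^sup>\<or>) = \<alpha> W (W\<^sup>\<or>) W \<cdot> (\<iota> (W \<otimes>\<^sub>o W\<^sup>\<or>) \<otimes>\<^sub>a h)"
    by (simp add: nat_right)
  also have "(\<iota> W \<otimes>\<^sub>a ev W) \<cdot> (\<alpha> W (W\<^sup>\<or>) W \<cdot> (\<iota> (W \<otimes>\<^sub>o W\<^sup>\<or>) \<otimes>\<^sub>a h)) \<cdot> (db W \<otimes>\<^sub>a \<iota> (V\<^sup>\<or>))
    = (\<iota> W \<otimes>\<^sub>a ev W) \<cdot> \<alpha> W (W\<^sup>\<or>) W \<cdot> ((\<iota> (W \<otimes>\<^sub>o W\<^sup>\<or>) \<otimes>\<^sub>a h) \<cdot> (db W \<otimes>\<^sub>a \<iota> (V\<^sup>\<or>)))"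
    by simp
  also have "(\<iota> (W \<otimes>\<^sub>o W\<^sup>\<or>) \<otimes>\<^sub>a h) \<cdot> (db W \<otimes>\<^sub>a \<iota> (V\<^sup>\<or>)) = (db W \<otimes>\<^sub>a \<iota> W) \<cdot> (\<iota> (Unit C) \<otimes>\<^sub>a h)"
    by (simp add: interchange del: Unit_Tensor)
  also have "(\<iota> W \<otimes>\<^sub>a ev W) \<cdot> \<alpha> W (W\<^sup>\<or>) W \<cdot> \<dots>
    = ((\<iota> W \<otimes>\<^sub>a ev W) \<cdot> \<alpha> W (W\<^sup>\<or>) W \<cdot> (db W \<otimes>\<^sub>a \<iota> W)) \<cdot> h"
    by (simp del: zigzag_Obj)
  also have "\<dots> = h"
    by (simp only: zigzag_Obj assms) simp
  finally show ?thesis by (simp add: h_def)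
qed

lemma E_map_eqI:
  assumes "V \<in> Obj C" "W \<in> Obj C" "f \<in> Arr C" "Dom C f = Unit C" "Cod C f = V \<otimes>\<^sub>o W"
    "g \<in> Arr C" "Dom C g = Unit C" "Cod C g = W \<otimes>\<^sub>o V" "A_right V W g = A_map C V W f"
  shows "E_map C V W f = g"
  by (rule A_right_inject[of V W]) (use assms in \<open>simp_all add: A_right_E_map\<close>)

text \<open>The mirror image of \<open>ev_dual_tensor\<close>. Compatibility of the pivotal
  structure with tensor products turns the pivotal isomorphism of \<open>V \<otimes> W\<close> into those of \<open>V\<close> and \<open>W\<close>, up to the
  canonical isomorphisms between duals, and these cancel against \<open>dual_tensor\<close>.\<close>

lemma ev_right_dual_tensor:
  assumes [simp]: "V \<in> Obj C" "W \<in> Obj C"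
  shows "ev_right (V \<otimes>\<^sub>o W) \<cdot> (\<iota> (V \<otimes>\<^sub>o W) \<otimes>\<^sub>a dual_tensor C V W)
    = ev_right V \<cdot> (\<iota> V \<otimes>\<^sub>a ((ev_right W \<otimes>\<^sub>a \<iota> (V\<^sup>\<or>)) \<cdot> \<alpha>' W (W\<^sup>\<or>) (V\<^sup>\<or>))) \<cdot> \<alpha> V W (W\<^sup>\<or> \<otimes>\<^sub>o V\<^sup>\<or>)"
proof -
  let ?d = "dual_tensor C V W" and ?d' = "dual_tensor C (W\<^sup>\<or>) (V\<^sup>\<or>)" and ?X = "W\<^sup>\<or> \<otimes>\<^sub>o V\<^sup>\<or>"
  have piv: "dual_arr C ?d \<cdot> piv (V \<otimes>\<^sub>o W) = ?d' \<cdot> (piv V \<otimes>\<^sub>a piv W)"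
    by (simp add: Piv_tensor bidual_tensor_def is_iso_dual_arr)
  have "ev_right (V \<otimes>\<^sub>o W) \<cdot> (\<iota> (V \<otimes>\<^sub>o W) \<otimes>\<^sub>a ?d)
    = (ev ((V \<otimes>\<^sub>o W)\<^sup>\<or>) \<cdot> (\<iota> ((V \<otimes>\<^sub>o W)\<^sup>\<or>\<^sup>\<or>) \<otimes>\<^sub>a ?d)) \<cdot> (piv (V \<otimes>\<^sub>o W) \<otimes>\<^sub>a \<iota> ?X)"
    by (simp add: ev_right_def interchange)
  also have "ev ((V \<otimes>\<^sub>o W)\<^sup>\<or>) \<cdot> (\<iota> ((V \<otimes>\<^sub>o W)\<^sup>\<or>\<^sup>\<or>) \<otimes>\<^sub>a ?d) = ev ?X \<cdot> (dual_arr C ?d \<otimes>\<^sub>a \<iota> ?X)"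
    by (rule ev_dual_arr[symmetric]) simp_all
  also have "\<dots> \<cdot> (piv (V \<otimes>\<^sub>o W) \<otimes>\<^sub>a \<iota> ?X) = ev ?X \<cdot> ((dual_arr C ?d \<cdot> piv (V \<otimes>\<^sub>o W)) \<otimes>\<^sub>a \<iota> ?X)"
    by (simp add: interchange)
  also have "\<dots> = (ev ?X \<cdot> (?d' \<otimes>\<^sub>a \<iota> ?X)) \<cdot> ((piv V \<otimes>\<^sub>a piv W) \<otimes>\<^sub>a \<iota> ?X)"
    unfolding piv by (simp add: interchange)
  also have "ev ?X \<cdot> (?d' \<otimes>\<^sub>a \<iota> ?X) = tensor_ev C (W\<^sup>\<or>) (V\<^sup>\<or>)"
    by (rule ev_dual_tensor) simp_all
  also have "\<dots> \<cdot> ((piv V \<otimes>\<^sub>a piv W) \<otimes>\<^sub>a \<iota> ?X)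
    = ev (V\<^sup>\<or>) \<cdot> (\<iota> (V\<^sup>\<or>\<^sup>\<or>) \<otimes>\<^sub>a ((ev (W\<^sup>\<or>) \<otimes>\<^sub>a \<iota> (V\<^sup>\<or>)) \<cdot> \<alpha>' (W\<^sup>\<or>\<^sup>\<or>) (W\<^sup>\<or>) (V\<^sup>\<or>)))
      \<cdot> (\<alpha> (V\<^sup>\<or>\<^sup>\<or>) (W\<^sup>\<or>\<^sup>\<or>) ?X \<cdot> ((piv V \<otimes>\<^sub>a piv W) \<otimes>\<^sub>a \<iota> ?X))"
    by (simp add: tensor_ev_def)
  also have "\<alpha> (V\<^sup>\<or>\<^sup>\<or>) (W\<^sup>\<or>\<^sup>\<or>) ?X \<cdot> ((piv V \<otimes>\<^sub>a piv W) \<otimes>\<^sub>a \<iota> ?X) = (piv V \<otimes>\<^sub>a (piv W \<otimes>\<^sub>a \<iota> ?X)) \<cdot> \<alpha> V W ?X"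
    using nat[of "piv V" "piv W" "\<iota> ?X"] by simp
  also have "ev (V\<^sup>\<or>) \<cdot> (\<iota> (V\<^sup>\<or>\<^sup>\<or>) \<otimes>\<^sub>a ((ev (W\<^sup>\<or>) \<otimes>\<^sub>a \<iota> (V\<^sup>\<or>)) \<cdot> \<alpha>' (W\<^sup>\<or>\<^sup>\<or>) (W\<^sup>\<or>) (V\<^sup>\<or>))) \<cdot> \<dots>
    = ev (V\<^sup>\<or>) \<cdot> (piv V \<otimes>\<^sub>a ((ev (W\<^sup>\<or>) \<otimes>\<^sub>a \<iota> (V\<^sup>\<or>)) \<cdot> (\<alpha>' (W\<^sup>\<or>\<^sup>\<or>) (W\<^sup>\<or>) (V\<^sup>\<or>) \<cdot> (piv W \<otimes>\<^sub>a \<iota> ?X)))) \<cdot> \<alpha> V W ?X"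
    by (simp add: merge)
  also have "\<alpha>' (W\<^sup>\<or>\<^sup>\<or>) (W\<^sup>\<or>) (V\<^sup>\<or>) \<cdot> (piv W \<otimes>\<^sub>a \<iota> ?X) = ((piv W \<otimes>\<^sub>a \<iota> (W\<^sup>\<or>)) \<otimes>\<^sub>a \<iota> (V\<^sup>\<or>)) \<cdot> \<alpha>' W (W\<^sup>\<or>) (V\<^sup>\<or>)"
    by (simp add: nat'_left)
  also have "ev (V\<^sup>\<or>) \<cdot> (piv V \<otimes>\<^sub>a ((ev (W\<^sup>\<or>) \<otimes>\<^sub>a \<iota> (V\<^sup>\<or>)) \<cdot> \<dots>)) \<cdot> \<alpha> V W ?X
    = ev_right V \<cdot> (\<iota> V \<otimes>\<^sub>a ((ev_right W \<otimes>\<^sub>a \<iota> (V\<^sup>\<or>)) \<cdot> \<alpha>' W (W\<^sup>\<or>) (V\<^sup>\<or>))) \<cdot> \<alpha> V W ?X"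
    by (simp add: ev_right_def merge)
  finally show ?thesis .
qed

text \<open>Bending \<open>V \<otimes> W\<close> down on the right is bending \<open>W\<close>, the last leg, and then \<open>V\<close>.\<close>

lemma A_right_dual_tensor:
  assumes [simp]: "V \<in> Obj C" "W \<in> Obj C" "U \<in> Obj C"
    "h \<in> Arr C" "Dom C h = Unit C" "Cod C h = U \<otimes>\<^sub>o (V \<otimes>\<^sub>o W)"
  shows "A_right (V \<otimes>\<^sub>o W) U h \<cdot> dual_tensor C V W
    = A_right V U (A_right W (U \<otimes>\<^sub>o V) (\<alpha>' U V W \<cdot> h))"
proof -
  let ?d = "dual_tensor C V W" and ?X = "W\<^sup>\<or>" and ?Y = "V\<^sup>\<or>"
  define k where "k = (ev_right W \<otimes>\<^sub>a \<iota> ?Y) \<cdot> \<alpha>' W ?X ?Y"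
  have [simp]: "k \<in> Arr C" "Dom C k = W \<otimes>\<^sub>o (?X \<otimes>\<^sub>o ?Y)" "Cod C k = ?Y" by (simp_all add: k_def)
  have "A_right (V \<otimes>\<^sub>o W) U h \<cdot> ?d
    = (\<iota> U \<otimes>\<^sub>a ev_right (V \<otimes>\<^sub>o W)) \<cdot> \<alpha> U (V \<otimes>\<^sub>o W) ((V \<otimes>\<^sub>o W)\<^sup>\<or>) \<cdot> ((h \<otimes>\<^sub>a \<iota> ((V \<otimes>\<^sub>o W)\<^sup>\<or>)) \<cdot> (\<iota> (Unit C) \<otimes>\<^sub>a ?d))"
    by (simp add: A_right_def)
  also have "(h \<otimes>\<^sub>a \<iota> ((V \<otimes>\<^sub>o W)\<^sup>\<or>)) \<cdot> (\<iota> (Unit C) \<otimes>\<^sub>a ?d) = (\<iota> (U \<otimes>\<^sub>o (V \<otimes>\<^sub>o W)) \<otimes>\<^sub>a ?d) \<cdot> (h \<otimes>\<^sub>a \<iota> (?X \<otimes>\<^sub>o ?Y))"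
    by (simp add: interchange del: Unit_Tensor)
  also have "(\<iota> U \<otimes>\<^sub>a ev_right (V \<otimes>\<^sub>o W)) \<cdot> \<alpha> U (V \<otimes>\<^sub>o W) ((V \<otimes>\<^sub>o W)\<^sup>\<or>) \<cdot> \<dots>
    = (\<iota> U \<otimes>\<^sub>a (ev_right (V \<otimes>\<^sub>o W) \<cdot> (\<iota> (V \<otimes>\<^sub>o W) \<otimes>\<^sub>a ?d))) \<cdot> \<alpha> U (V \<otimes>\<^sub>o W) (?X \<otimes>\<^sub>o ?Y) \<cdot> (h \<otimes>\<^sub>a \<iota> (?X \<otimes>\<^sub>o ?Y))"
    by (simp add: nat_right[THEN Comp_tail]) (simp add: merge)
  also have "ev_right (V \<otimes>\<^sub>o W) \<cdot> (\<iota> (V \<otimes>\<^sub>o W) \<otimes>\<^sub>a ?d) = ev_right V \<cdot> (\<iota> V \<otimes>\<^sub>a k) \<cdot> \<alpha> V W (?X \<otimes>\<^sub>o ?Y)"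
    by (simp add: ev_right_dual_tensor k_def)
  finally have lhs: "A_right (V \<otimes>\<^sub>o W) U h \<cdot> ?d
    = (\<iota> U \<otimes>\<^sub>a (ev_right V \<cdot> (\<iota> V \<otimes>\<^sub>a k) \<cdot> \<alpha> V W (?X \<otimes>\<^sub>o ?Y))) \<cdot> \<alpha> U (V \<otimes>\<^sub>o W) (?X \<otimes>\<^sub>o ?Y) \<cdot> (h \<otimes>\<^sub>a \<iota> (?X \<otimes>\<^sub>o ?Y))" .
  have h: "(h \<otimes>\<^sub>a \<iota> ?X) \<otimes>\<^sub>a \<iota> ?Y = \<alpha>' (U \<otimes>\<^sub>o (V \<otimes>\<^sub>o W)) ?X ?Y \<cdot> (h \<otimes>\<^sub>a \<iota> (?X \<otimes>\<^sub>o ?Y))"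
    using nat'_left[of h ?X ?Y "Unit C"] by simp
  have "A_right W (U \<otimes>\<^sub>o V) (\<alpha>' U V W \<cdot> h) \<otimes>\<^sub>a \<iota> ?Y
    = ((\<iota> (U \<otimes>\<^sub>o V) \<otimes>\<^sub>a ev_right W) \<otimes>\<^sub>a \<iota> ?Y) \<cdot> (\<alpha> (U \<otimes>\<^sub>o V) W ?X \<otimes>\<^sub>a \<iota> ?Y) \<cdot> ((\<alpha>' U V W \<otimes>\<^sub>a \<iota> ?X) \<otimes>\<^sub>a \<iota> ?Y)
      \<cdot> ((h \<otimes>\<^sub>a \<iota> ?X) \<otimes>\<^sub>a \<iota> ?Y)"
    by (simp add: A_right_def merge)
  also have "\<dots> = (\<iota> (U \<otimes>\<^sub>o V) \<otimes>\<^sub>a (ev_right W \<otimes>\<^sub>a \<iota> ?Y)) \<cdot> (\<iota> (U \<otimes>\<^sub>o V) \<otimes>\<^sub>a \<alpha>' W ?X ?Y) \<cdot> \<alpha> (U \<otimes>\<^sub>o V) W (?X \<otimes>\<^sub>o ?Y)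
      \<cdot> (\<alpha>' U V W \<otimes>\<^sub>a \<iota> (?X \<otimes>\<^sub>o ?Y)) \<cdot> (h \<otimes>\<^sub>a \<iota> (?X \<otimes>\<^sub>o ?Y))"
    unfolding h by (simp add: whisker_nats_tail pentagon_B[THEN Comp_tail])
  also have "\<dots> = (\<iota> (U \<otimes>\<^sub>o V) \<otimes>\<^sub>a k) \<cdot> \<alpha> (U \<otimes>\<^sub>o V) W (?X \<otimes>\<^sub>o ?Y)
      \<cdot> (\<alpha>' U V W \<otimes>\<^sub>a \<iota> (?X \<otimes>\<^sub>o ?Y)) \<cdot> (h \<otimes>\<^sub>a \<iota> (?X \<otimes>\<^sub>o ?Y))"
    by (simp add: k_def merge)
  finally have "A_right V U (A_right W (U \<otimes>\<^sub>o V) (\<alpha>' U V W \<cdot> h))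
    = (\<iota> U \<otimes>\<^sub>a ev_right V) \<cdot> \<alpha> U V ?Y \<cdot> (\<iota> (U \<otimes>\<^sub>o V) \<otimes>\<^sub>a k) \<cdot> \<alpha> (U \<otimes>\<^sub>o V) W (?X \<otimes>\<^sub>o ?Y)
      \<cdot> (\<alpha>' U V W \<otimes>\<^sub>a \<iota> (?X \<otimes>\<^sub>o ?Y)) \<cdot> (h \<otimes>\<^sub>a \<iota> (?X \<otimes>\<^sub>o ?Y))"
    by (simp add: A_right_def[of V U])
  also have "\<dots> = (\<iota> U \<otimes>\<^sub>a ev_right V) \<cdot> (\<iota> U \<otimes>\<^sub>a (\<iota> V \<otimes>\<^sub>a k)) \<cdot> (\<iota> U \<otimes>\<^sub>a \<alpha> V W (?X \<otimes>\<^sub>o ?Y)) \<cdot> \<alpha> U (V \<otimes>\<^sub>o W) (?X \<otimes>\<^sub>o ?Y)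
      \<cdot> (h \<otimes>\<^sub>a \<iota> (?X \<otimes>\<^sub>o ?Y))"
    by (simp add: nat_right[THEN Comp_tail] pentagon_A[THEN Comp_tail])
  also have "\<dots> = A_right (V \<otimes>\<^sub>o W) U h \<cdot> ?d"
    unfolding lhs by (simp add: merge)
  finally show ?thesis ..
qed

text \<open>Bending the first leg \<open>W\<close> on the left and the last leg \<open>V\<close> on the right happens on opposite sides
  of \<open>U\<close>, so the order is immaterial; the proof only moves associators out of the way.\<close>

lemma A_right_A_map_commute:
  assumes [simp]: "V \<in> Obj C" "W \<in> Obj C" "U \<in> Obj C"
    "g \<in> Arr C" "Dom C g = Unit C" "Cod C g = W \<otimes>\<^sub>o (U \<otimes>\<^sub>o V)"
  shows "A_map C W U (A_right V (W \<otimes>\<^sub>o U) (\<alpha>' W U V \<cdot> g)) = A_right V U (A_map C W (U \<otimes>\<^sub>o V) g)"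
proof -
  let ?X = "W\<^sup>\<or>" and ?Y = "V\<^sup>\<or>"
  define k where "k = (\<iota> U \<otimes>\<^sub>a ev_right V) \<cdot> \<alpha> U V ?Y"
  have [simp]: "k \<in> Arr C" "Dom C k = (U \<otimes>\<^sub>o V) \<otimes>\<^sub>o ?Y" "Cod C k = U" by (simp_all add: k_def)
  have "A_right V (W \<otimes>\<^sub>o U) (\<alpha>' W U V \<cdot> g)
    = (\<iota> (W \<otimes>\<^sub>o U) \<otimes>\<^sub>a ev_right V) \<cdot> \<alpha> (W \<otimes>\<^sub>o U) V ?Y \<cdot> (\<alpha>' W U V \<otimes>\<^sub>a \<iota> ?Y) \<cdot> (g \<otimes>\<^sub>a \<iota> ?Y)"
    by (simp add: A_right_def merge)
  also have "\<dots> = (\<iota> W \<otimes>\<^sub>a (\<iota> U \<otimes>\<^sub>a ev_right V)) \<cdot> (\<iota> W \<otimes>\<^sub>a \<alpha> U V ?Y) \<cdot> \<alpha> W (U \<otimes>\<^sub>o V) ?Y \<cdot> (g \<otimes>\<^sub>a \<iota> ?Y)"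
    by (simp add: pentagon_A[THEN Comp_tail] nat'_right[THEN Comp_tail])
  also have "\<dots> = (\<iota> W \<otimes>\<^sub>a k) \<cdot> \<alpha> W (U \<otimes>\<^sub>o V) ?Y \<cdot> (g \<otimes>\<^sub>a \<iota> ?Y)"
    by (simp add: k_def merge)
  finally have lhs: "A_map C W U (A_right V (W \<otimes>\<^sub>o U) (\<alpha>' W U V \<cdot> g))
    = (ev W \<otimes>\<^sub>a \<iota> U) \<cdot> \<alpha>' ?X W U \<cdot> (\<iota> ?X \<otimes>\<^sub>a ((\<iota> W \<otimes>\<^sub>a k) \<cdot> \<alpha> W (U \<otimes>\<^sub>o V) ?Y \<cdot> (g \<otimes>\<^sub>a \<iota> ?Y)))"
    by (simp add: A_map_def)
  have g: "(\<iota> ?X \<otimes>\<^sub>a g) \<otimes>\<^sub>a \<iota> ?Y = \<alpha>' ?X (W \<otimes>\<^sub>o (U \<otimes>\<^sub>o V)) ?Y \<cdot> (\<iota> ?X \<otimes>\<^sub>a (g \<otimes>\<^sub>a \<iota> ?Y))"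
    using nat'_mid[of g ?X ?Y "Unit C"] by simp
  have evW: "(ev W \<otimes>\<^sub>a \<iota> (U \<otimes>\<^sub>o V)) \<otimes>\<^sub>a \<iota> ?Y = (ev W \<otimes>\<^sub>a \<iota> ((U \<otimes>\<^sub>o V) \<otimes>\<^sub>o ?Y)) \<cdot> \<alpha> (?X \<otimes>\<^sub>o W) (U \<otimes>\<^sub>o V) ?Y"
    using nat_left[of "ev W" "U \<otimes>\<^sub>o V" ?Y "Unit C"] by simp
  have "A_right V U (A_map C W (U \<otimes>\<^sub>o V) g) = k \<cdot> (A_map C W (U \<otimes>\<^sub>o V) g \<otimes>\<^sub>a \<iota> ?Y)"
    by (simp add: A_right_def k_def)
  also have "A_map C W (U \<otimes>\<^sub>o V) g \<otimes>\<^sub>a \<iota> ?Y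
    = ((ev W \<otimes>\<^sub>a \<iota> (U \<otimes>\<^sub>o V)) \<otimes>\<^sub>a \<iota> ?Y) \<cdot> (\<alpha>' ?X W (U \<otimes>\<^sub>o V) \<otimes>\<^sub>a \<iota> ?Y) \<cdot> ((\<iota> ?X \<otimes>\<^sub>a g) \<otimes>\<^sub>a \<iota> ?Y)"
    by (simp add: A_map_def merge)
  also have "\<dots> = (ev W \<otimes>\<^sub>a \<iota> ((U \<otimes>\<^sub>o V) \<otimes>\<^sub>o ?Y)) \<cdot> \<alpha>' ?X W ((U \<otimes>\<^sub>o V) \<otimes>\<^sub>o ?Y) \<cdot> (\<iota> ?X \<otimes>\<^sub>a \<alpha> W (U \<otimes>\<^sub>o V) ?Y)
      \<cdot> (\<iota> ?X \<otimes>\<^sub>a (g \<otimes>\<^sub>a \<iota> ?Y))"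
    unfolding g evW by (simp add: pentagon_A[THEN Comp_tail])
  also have "k \<cdot> \<dots> = (k \<cdot> (ev W \<otimes>\<^sub>a \<iota> ((U \<otimes>\<^sub>o V) \<otimes>\<^sub>o ?Y))) \<cdot> \<alpha>' ?X W ((U \<otimes>\<^sub>o V) \<otimes>\<^sub>o ?Y)
      \<cdot> (\<iota> ?X \<otimes>\<^sub>a \<alpha> W (U \<otimes>\<^sub>o V) ?Y) \<cdot> (\<iota> ?X \<otimes>\<^sub>a (g \<otimes>\<^sub>a \<iota> ?Y))"
    by simp
  also have "k \<cdot> (ev W \<otimes>\<^sub>a \<iota> ((U \<otimes>\<^sub>o V) \<otimes>\<^sub>o ?Y)) = (ev W \<otimes>\<^sub>a \<iota> U) \<cdot> (\<iota> (?X \<otimes>\<^sub>o W) \<otimes>\<^sub>a k)"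
    using interchange[of "ev W" "\<iota> (Unit C)" "\<iota> ((U \<otimes>\<^sub>o V) \<otimes>\<^sub>o ?Y)" k] by (simp add: interchange)
  also have "\<dots> \<cdot> \<alpha>' ?X W ((U \<otimes>\<^sub>o V) \<otimes>\<^sub>o ?Y) \<cdot> (\<iota> ?X \<otimes>\<^sub>a \<alpha> W (U \<otimes>\<^sub>o V) ?Y) \<cdot> (\<iota> ?X \<otimes>\<^sub>a (g \<otimes>\<^sub>a \<iota> ?Y))
    = (ev W \<otimes>\<^sub>a \<iota> U) \<cdot> \<alpha>' ?X W U \<cdot> (\<iota> ?X \<otimes>\<^sub>a (\<iota> W \<otimes>\<^sub>a k)) \<cdot> (\<iota> ?X \<otimes>\<^sub>a \<alpha> W (U \<otimes>\<^sub>o V) ?Y) \<cdot> (\<iota> ?X \<otimes>\<^sub>a (g \<otimes>\<^sub>a \<iota> ?Y))"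
    by (simp add: nat'_right[THEN Comp_tail])
  also have "\<dots> = A_map C W U (A_right V (W \<otimes>\<^sub>o U) (\<alpha>' W U V \<cdot> g))"
    unfolding lhs by (simp add: merge)
  finally show ?thesis ..
qed

text \<open>Rotating a block \<open>V \<otimes> W\<close> is rotating \<open>V\<close> and then \<open>W\<close>. With \<open>g\<close> and \<open>h\<close> the results of the first
  and the second rotation, the left bending of \<open>f\<close> along \<open>V \<otimes> W\<close> is the left bending along \<open>W\<close> of the
  right bending of \<open>g\<close> along \<open>V\<close>; exchanging the two and using the second rotation gives the right
  bending of \<open>h\<close> along \<open>V \<otimes> W\<close>.\<close>

lemma E_map_tensor:
  assumes [simp]: "V \<in> Obj C" "W \<in> Obj C" "U \<in> Obj C"
    "f \<in> Arr C" "Dom C f = Unit C" "Cod C f = V \<otimes>\<^sub>o (W \<otimes>\<^sub>o U)"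
  shows "E_map C (V \<otimes>\<^sub>o W) U (\<alpha>' V W U \<cdot> f)
    = \<alpha> U V W \<cdot> E_map C W (U \<otimes>\<^sub>o V) (\<alpha> W U V \<cdot> E_map C V (W \<otimes>\<^sub>o U) f)"
proof -
  define e where "e = E_map C V (W \<otimes>\<^sub>o U) f"
  define g where "g = \<alpha> W U V \<cdot> e"
  define h where "h = \<alpha> U V W \<cdot> E_map C W (U \<otimes>\<^sub>o V) g"
  have [simp]: "e \<in> Arr C" "Dom C e = Unit C" "Cod C e = (W \<otimes>\<^sub>o U) \<otimes>\<^sub>o V" by (simp_all add: e_def)
  have [simp]: "g \<in> Arr C" "Dom C g = Unit C" "Cod C g = W \<otimes>\<^sub>o (U \<otimes>\<^sub>o V)" by (simp_all add: g_def)
  have [simp]: "h \<in> Arr C" "Dom C h = Unit C" "Cod C h = U \<otimes>\<^sub>o (V \<otimes>\<^sub>o W)" by (simp_all add: h_def)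
  have e: "A_right V (W \<otimes>\<^sub>o U) (\<alpha>' W U V \<cdot> g) = A_map C V (W \<otimes>\<^sub>o U) f"
    by (simp add: g_def) (simp add: e_def A_right_E_map)
  have g: "A_right W (U \<otimes>\<^sub>o V) (\<alpha>' U V W \<cdot> h) = A_map C W (U \<otimes>\<^sub>o V) g"
    by (simp add: h_def A_right_E_map)
  have "A_right (V \<otimes>\<^sub>o W) U h \<cdot> dual_tensor C V W = A_map C (V \<otimes>\<^sub>o W) U (\<alpha>' V W U \<cdot> f) \<cdot> dual_tensor C V W"
    by (simp only: A_right_dual_tensor A_map_dual_tensor assms g A_right_A_map_commute[symmetric] e
      \<open>g \<in> Arr C\<close> \<open>Dom C g = Unit C\<close> \<open>Cod C g = _\<close> \<open>h \<in> Arr C\<close> \<open>Dom C h = Unit C\<close> \<open>Cod C h = _\<close>)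
  then have "A_right (V \<otimes>\<^sub>o W) U h = A_map C (V \<otimes>\<^sub>o W) U (\<alpha>' V W U \<cdot> f)"
    by (rule iso_cancel_right[of "dual_tensor C V W", rotated -1]) simp_all
  then have "E_map C (V \<otimes>\<^sub>o W) U (\<alpha>' V W U \<cdot> f) = h"
    by (rule E_map_eqI[rotated -1]) simp_all
  then show ?thesis by (simp add: h_def g_def e_def)
qed

section \<open>Naturality of the rotation\<close>

lemma A_map_natural:
  assumes [simp]: "a \<in> Arr C" "Dom C a = V" "Cod C a = V'" "b \<in> Arr C" "Dom C b = W" "Cod C b = W'"
    "f \<in> Arr C" "Dom C f = Unit C" "Cod C f = V \<otimes>\<^sub>o W"
  shows "A_map C V' W' ((a \<otimes>\<^sub>a b) \<cdot> f) = b \<cdot> A_map C V W f \<cdot> dual_arr C a"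
proof -
  have [simp]: "V \<in> Obj C" "V' \<in> Obj C" "W \<in> Obj C" "W' \<in> Obj C"
    using Obj_type[of a] Obj_type[of b] by simp_all
  have "A_map C V' W' ((a \<otimes>\<^sub>a b) \<cdot> f)
    = (ev V' \<otimes>\<^sub>a \<iota> W') \<cdot> (\<alpha>' (V'\<^sup>\<or>) V' W' \<cdot> (\<iota> (V'\<^sup>\<or>) \<otimes>\<^sub>a (a \<otimes>\<^sub>a b))) \<cdot> (\<iota> (V'\<^sup>\<or>) \<otimes>\<^sub>a f)"
    by (simp add: A_map_def interchange)
  also have "\<alpha>' (V'\<^sup>\<or>) V' W' \<cdot> (\<iota> (V'\<^sup>\<or>) \<otimes>\<^sub>a (a \<otimes>\<^sub>a b)) = ((\<iota> (V'\<^sup>\<or>) \<otimes>\<^sub>a a) \<otimes>\<^sub>a b) \<cdot> \<alpha>' (V'\<^sup>\<or>) V W"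
    using nat'[of "\<iota> (V'\<^sup>\<or>)" a b] by simp
  also have "(ev V' \<otimes>\<^sub>a \<iota> W') \<cdot> \<dots> \<cdot> (\<iota> (V'\<^sup>\<or>) \<otimes>\<^sub>a f)
    = ((ev V' \<cdot> (\<iota> (V'\<^sup>\<or>) \<otimes>\<^sub>a a)) \<otimes>\<^sub>a b) \<cdot> \<alpha>' (V'\<^sup>\<or>) V W \<cdot> (\<iota> (V'\<^sup>\<or>) \<otimes>\<^sub>a f)"
    by (simp add: merge)
  also have "ev V' \<cdot> (\<iota> (V'\<^sup>\<or>) \<otimes>\<^sub>a a) = ev V \<cdot> (dual_arr C a \<otimes>\<^sub>a \<iota> V)"
    by (rule ev_dual_arr[symmetric]) simp_all
  also have "((ev V \<cdot> (dual_arr C a \<otimes>\<^sub>a \<iota> V)) \<otimes>\<^sub>a b) \<cdot> \<alpha>' (V'\<^sup>\<or>) V W \<cdot> (\<iota> (V'\<^sup>\<or>) \<otimes>\<^sub>a f)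
    = (\<iota> (Unit C) \<otimes>\<^sub>a b) \<cdot> (ev V \<otimes>\<^sub>a \<iota> W) \<cdot> ((dual_arr C a \<otimes>\<^sub>a \<iota> V) \<otimes>\<^sub>a \<iota> W) \<cdot> \<alpha>' (V'\<^sup>\<or>) V W \<cdot> (\<iota> (V'\<^sup>\<or>) \<otimes>\<^sub>a f)"
    by (simp add: merge del: Unit_Tensor)
  also have "\<dots> = b \<cdot> (ev V \<otimes>\<^sub>a \<iota> W) \<cdot> \<alpha>' (V\<^sup>\<or>) V W \<cdot> (dual_arr C a \<otimes>\<^sub>a \<iota> (V \<otimes>\<^sub>o W)) \<cdot> (\<iota> (V'\<^sup>\<or>) \<otimes>\<^sub>a f)"
    by (simp add: nat'_left[THEN Comp_tail])
  also have "(dual_arr C a \<otimes>\<^sub>a \<iota> (V \<otimes>\<^sub>o W)) \<cdot> (\<iota> (V'\<^sup>\<or>) \<otimes>\<^sub>a f) = (\<iota> (V\<^sup>\<or>) \<otimes>\<^sub>a f) \<cdot> (dual_arr C a \<otimes>\<^sub>a \<iota> (Unit C))"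
    by (simp add: interchange del: Tensor_Unit)
  finally show ?thesis by (simp add: A_map_def)
qed

lemma ev_right_natural:
  assumes [simp]: "a \<in> Arr C" "Dom C a = V" "Cod C a = V'"
  shows "ev_right V' \<cdot> (a \<otimes>\<^sub>a \<iota> (V'\<^sup>\<or>)) = ev_right V \<cdot> (\<iota> V \<otimes>\<^sub>a dual_arr C a)"
proof -
  have [simp]: "V \<in> Obj C" "V' \<in> Obj C"
    using Obj_type[of a] by simp_all
  have "ev_right V' \<cdot> (a \<otimes>\<^sub>a \<iota> (V'\<^sup>\<or>)) = ev (V'\<^sup>\<or>) \<cdot> ((piv V' \<cdot> a) \<otimes>\<^sub>a \<iota> (V'\<^sup>\<or>))"
    by (simp add: ev_right_def interchange)
  also have "piv V' \<cdot> a = dual_arr C (dual_arr C a) \<cdot> piv V"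
    by (rule Piv_natural) (simp add: Hom_def)
  also have "ev (V'\<^sup>\<or>) \<cdot> (\<dots> \<otimes>\<^sub>a \<iota> (V'\<^sup>\<or>)) = (ev (V'\<^sup>\<or>) \<cdot> (dual_arr C (dual_arr C a) \<otimes>\<^sub>a \<iota> (V'\<^sup>\<or>))) \<cdot> (piv V \<otimes>\<^sub>a \<iota> (V'\<^sup>\<or>))"
    by (simp add: interchange)
  also have "ev (V'\<^sup>\<or>) \<cdot> (dual_arr C (dual_arr C a) \<otimes>\<^sub>a \<iota> (V'\<^sup>\<or>)) = ev (V\<^sup>\<or>) \<cdot> (\<iota> (V\<^sup>\<or>\<^sup>\<or>) \<otimes>\<^sub>a dual_arr C a)"
    by (rule ev_dual_arr) simp_all
  finally show ?thesis by (simp add: ev_right_def interchange)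
qed

lemma A_right_natural:
  assumes [simp]: "a \<in> Arr C" "Dom C a = V" "Cod C a = V'" "b \<in> Arr C" "Dom C b = W" "Cod C b = W'"
    "g \<in> Arr C" "Dom C g = Unit C" "Cod C g = W \<otimes>\<^sub>o V"
  shows "A_right V' W' ((b \<otimes>\<^sub>a a) \<cdot> g) = b \<cdot> A_right V W g \<cdot> dual_arr C a"
proof -
  have [simp]: "V \<in> Obj C" "V' \<in> Obj C" "W \<in> Obj C" "W' \<in> Obj C"
    using Obj_type[of a] Obj_type[of b] by simp_all
  have "A_right V' W' ((b \<otimes>\<^sub>a a) \<cdot> g)
    = (\<iota> W' \<otimes>\<^sub>a ev_right V') \<cdot> (\<alpha> W' V' (V'\<^sup>\<or>) \<cdot> ((b \<otimes>\<^sub>a a) \<otimes>\<^sub>a \<iota> (V'\<^sup>\<or>))) \<cdot> (g \<otimes>\<^sub>a \<iota> (V'\<^sup>\<or>))"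
    by (simp add: A_right_def interchange)
  also have "\<alpha> W' V' (V'\<^sup>\<or>) \<cdot> ((b \<otimes>\<^sub>a a) \<otimes>\<^sub>a \<iota> (V'\<^sup>\<or>)) = (b \<otimes>\<^sub>a (a \<otimes>\<^sub>a \<iota> (V'\<^sup>\<or>))) \<cdot> \<alpha> W V (V'\<^sup>\<or>)"
    using nat[of b a "\<iota> (V'\<^sup>\<or>)"] by simp
  also have "(\<iota> W' \<otimes>\<^sub>a ev_right V') \<cdot> \<dots> \<cdot> (g \<otimes>\<^sub>a \<iota> (V'\<^sup>\<or>))
    = (b \<otimes>\<^sub>a (ev_right V' \<cdot> (a \<otimes>\<^sub>a \<iota> (V'\<^sup>\<or>)))) \<cdot> \<alpha> W V (V'\<^sup>\<or>) \<cdot> (g \<otimes>\<^sub>a \<iota> (V'\<^sup>\<or>))"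
    by (simp add: merge)
  also have "ev_right V' \<cdot> (a \<otimes>\<^sub>a \<iota> (V'\<^sup>\<or>)) = ev_right V \<cdot> (\<iota> V \<otimes>\<^sub>a dual_arr C a)"
    by (rule ev_right_natural) simp_all
  also have "(b \<otimes>\<^sub>a (ev_right V \<cdot> (\<iota> V \<otimes>\<^sub>a dual_arr C a))) \<cdot> \<alpha> W V (V'\<^sup>\<or>) \<cdot> (g \<otimes>\<^sub>a \<iota> (V'\<^sup>\<or>))
    = (b \<otimes>\<^sub>a \<iota> (Unit C)) \<cdot> (\<iota> W \<otimes>\<^sub>a ev_right V) \<cdot> (\<iota> W \<otimes>\<^sub>a (\<iota> V \<otimes>\<^sub>a dual_arr C a)) \<cdot> \<alpha> W V (V'\<^sup>\<or>) \<cdot> (g \<otimes>\<^sub>a \<iota> (V'\<^sup>\<or>))"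
    by (simp add: merge del: Tensor_Unit)
  also have "\<dots> = b \<cdot> (\<iota> W \<otimes>\<^sub>a ev_right V) \<cdot> ((\<iota> W \<otimes>\<^sub>a (\<iota> V \<otimes>\<^sub>a dual_arr C a)) \<cdot> \<alpha> W V (V'\<^sup>\<or>)) \<cdot> (g \<otimes>\<^sub>a \<iota> (V'\<^sup>\<or>))"
    by simp
  also have "(\<iota> W \<otimes>\<^sub>a (\<iota> V \<otimes>\<^sub>a dual_arr C a)) \<cdot> \<alpha> W V (V'\<^sup>\<or>) = \<alpha> W V (V\<^sup>\<or>) \<cdot> (\<iota> (W \<otimes>\<^sub>o V) \<otimes>\<^sub>a dual_arr C a)"
    by (simp add: nat_right)
  also have "b \<cdot> (\<iota> W \<otimes>\<^sub>a ev_right V) \<cdot> \<dots> \<cdot> (g \<otimes>\<^sub>a \<iota> (V'\<^sup>\<or>))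
    = b \<cdot> (\<iota> W \<otimes>\<^sub>a ev_right V) \<cdot> \<alpha> W V (V\<^sup>\<or>) \<cdot> ((\<iota> (W \<otimes>\<^sub>o V) \<otimes>\<^sub>a dual_arr C a) \<cdot> (g \<otimes>\<^sub>a \<iota> (V'\<^sup>\<or>)))"
    by simp
  also have "(\<iota> (W \<otimes>\<^sub>o V) \<otimes>\<^sub>a dual_arr C a) \<cdot> (g \<otimes>\<^sub>a \<iota> (V'\<^sup>\<or>)) = (g \<otimes>\<^sub>a \<iota> (V\<^sup>\<or>)) \<cdot> (\<iota> (Unit C) \<otimes>\<^sub>a dual_arr C a)"
    by (simp add: interchange del: Unit_Tensor)
  finally show ?thesis by (simp add: A_right_def)
qed

lemma E_map_natural:
  assumes [simp]: "a \<in> Arr C" "Dom C a = V" "Cod C a = V'" "b \<in> Arr C" "Dom C b = W" "Cod C b = W'"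
    "f \<in> Arr C" "Dom C f = Unit C" "Cod C f = V \<otimes>\<^sub>o W"
  shows "E_map C V' W' ((a \<otimes>\<^sub>a b) \<cdot> f) = (b \<otimes>\<^sub>a a) \<cdot> E_map C V W f"
proof -
  have [simp]: "V \<in> Obj C" "V' \<in> Obj C" "W \<in> Obj C" "W' \<in> Obj C"
    using Obj_type[of a] Obj_type[of b] by simp_all
  show ?thesis
    by (rule E_map_eqI)
      (simp_all add: A_map_natural[where V = V and W = W] A_right_natural[where V = V and W = W] A_right_E_map)
qed

lemma ev_right_Unit: "ev_right (Unit C) = \<iota> (Unit C)"
  by (simp add: ev_right_def Piv_Unit)

lemma E_map_Unit_left:
  assumes [simp]: "f \<in> Arr C" "Dom C f = Unit C" "Cod C f = X"
  shows "E_map C (Unit C) X f = f"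
proof -
  have [simp]: "X \<in> Obj C" using Obj_type[of f] by simp
  show ?thesis
    by (rule E_map_eqI) (simp_all add: A_map_def A_right_def ev_right_Unit)
qed

text \<open>For \<open>W = I\<close> the left bending of \<open>f : I \<rightarrow> X\<close> is the dual morphism \<open>f\<^sup>\<or> : X\<^sup>\<or> \<rightarrow> I\<close>, and so is the right
  bending, by naturality of \<open>ev_right\<close> along \<open>f\<close>.\<close>

lemma E_map_Unit_right:
  assumes [simp]: "f \<in> Arr C" "Dom C f = Unit C" "Cod C f = X"
  shows "E_map C X (Unit C) f = f"
proof -
  have [simp]: "X \<in> Obj C" using Obj_type[of f] by simp
  have "A_map C X (Unit C) f = ev X \<cdot> (\<iota> (X\<^sup>\<or>) \<otimes>\<^sub>a f)"
    by (simp add: A_map_def)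
  also have "\<dots> = dual_arr C f"
    using ev_dual_arr[of f "Unit C" X] by simp
  also have "\<dots> = ev_right (Unit C) \<cdot> (\<iota> (Unit C) \<otimes>\<^sub>a dual_arr C f)"
    by (simp add: ev_right_Unit)
  also have "\<dots> = ev_right X \<cdot> (f \<otimes>\<^sub>a \<iota> (X\<^sup>\<or>))"
    using ev_right_natural[of f "Unit C" X] by simp
  also have "\<dots> = A_right X (Unit C) f"
    by (simp add: A_right_def)
  finally show ?thesis
    by (intro E_map_eqI) simp_all
qed

section \<open>Periodicity on tensor powers\<close>

text \<open>The canonical isomorphism \<open>V\<^sup>\<otimes>\<^sup>a \<otimes> V\<^sup>\<otimes>\<^sup>b \<rightarrow> V\<^sup>\<otimes>\<^sup>(\<^sup>a\<^sup>+\<^sup>b\<^sup>)\<close>. It contains \<open>\<Phi>\<^sup>(\<^sup>n\<^sup>)\<close> as the case \<open>b = 1\<close>, because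
  \<open>V\<^sup>\<otimes>\<^sup>1 = V \<otimes> I = V\<close> by strictness of the unit.\<close>

primrec pow_merge :: "'a \<Rightarrow> nat \<Rightarrow> nat \<Rightarrow> 'b" where
  "pow_merge V 0 b = \<iota> (tensor_pow C V b)"
| "pow_merge V (Suc a) b = (\<iota> V \<otimes>\<^sub>a pow_merge V a b) \<cdot> \<alpha> V (tensor_pow C V a) (tensor_pow C V b)"

context
  fixes V assumes V [simp]: "V \<in> Obj C"
begin

abbreviation pow where "pow \<equiv> tensor_pow C V"

lemma pow_Obj [simp]: "pow n \<in> Obj C"
  by (induction n) auto

lemma pow_merge_type [simp]:
  "pow_merge V a b \<in> Arr C" "Dom C (pow_merge V a b) = pow a \<otimes>\<^sub>o pow b" "Cod C (pow_merge V a b) = pow (a + b)"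
  by (induction a) simp_all

lemma is_iso_pow_merge [simp]: "is_iso C (pow_merge V a b)"
  by (induction a) (auto intro!: is_iso_Comp is_iso_tensor)

lemma pow_merge_zero_right [simp]: "pow_merge V a 0 = \<iota> (pow a)"
  by (induction a) simp_all

lemma assoc_pow_eq_pow_merge: "assoc_pow C V (Suc n) = pow_merge V n (Suc 0)"
  by (induction n) simp_all

text \<open>The instance of Mac Lane coherence that is needed: merging three powers does not depend on the
  bracketing.\<close>

lemma pow_merge_assoc:
  "pow_merge V a (b + c) \<cdot> (\<iota> (pow a) \<otimes>\<^sub>a pow_merge V b c) \<cdot> \<alpha> (pow a) (pow b) (pow c)
    = pow_merge V (a + b) c \<cdot> (pow_merge V a b \<otimes>\<^sub>a \<iota> (pow c))"
proof (induction a)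
  case (Suc a)
  let ?A = "pow a" and ?B = "pow b" and ?D = "pow c"
  have "pow_merge V (Suc a) (b + c) \<cdot> (\<iota> (pow (Suc a)) \<otimes>\<^sub>a pow_merge V b c) \<cdot> \<alpha> (pow (Suc a)) ?B ?D
    = (\<iota> V \<otimes>\<^sub>a pow_merge V a (b + c)) \<cdot> (\<iota> V \<otimes>\<^sub>a (\<iota> ?A \<otimes>\<^sub>a pow_merge V b c)) \<cdot> (\<alpha> V ?A (?B \<otimes>\<^sub>o ?D) \<cdot> \<alpha> (V \<otimes>\<^sub>o ?A) ?B ?D)"
    by (simp add: nat_right[THEN Comp_tail])
  also have "\<alpha> V ?A (?B \<otimes>\<^sub>o ?D) \<cdot> \<alpha> (V \<otimes>\<^sub>o ?A) ?B ?D
    = (\<iota> V \<otimes>\<^sub>a \<alpha> ?A ?B ?D) \<cdot> \<alpha> V (?A \<otimes>\<^sub>o ?B) ?D \<cdot> (\<alpha> V ?A ?B \<otimes>\<^sub>a \<iota> ?D)"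
    by (rule pentagon) simp_all
  also have "(\<iota> V \<otimes>\<^sub>a pow_merge V a (b + c)) \<cdot> (\<iota> V \<otimes>\<^sub>a (\<iota> ?A \<otimes>\<^sub>a pow_merge V b c)) \<cdot> \<dots>
    = (\<iota> V \<otimes>\<^sub>a (pow_merge V a (b + c) \<cdot> (\<iota> ?A \<otimes>\<^sub>a pow_merge V b c) \<cdot> \<alpha> ?A ?B ?D)) \<cdot> \<alpha> V (?A \<otimes>\<^sub>o ?B) ?D \<cdot> (\<alpha> V ?A ?B \<otimes>\<^sub>a \<iota> ?D)"
    by (simp add: merge)
  also have "pow_merge V a (b + c) \<cdot> (\<iota> ?A \<otimes>\<^sub>a pow_merge V b c) \<cdot> \<alpha> ?A ?B ?D = pow_merge V (a + b) c \<cdot> (pow_merge V a b \<otimes>\<^sub>a \<iota> ?D)"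
    by (rule Suc.IH)
  also have "(\<iota> V \<otimes>\<^sub>a \<dots>) \<cdot> \<alpha> V (?A \<otimes>\<^sub>o ?B) ?D \<cdot> (\<alpha> V ?A ?B \<otimes>\<^sub>a \<iota> ?D)
    = (\<iota> V \<otimes>\<^sub>a pow_merge V (a + b) c) \<cdot> ((\<iota> V \<otimes>\<^sub>a (pow_merge V a b \<otimes>\<^sub>a \<iota> ?D)) \<cdot> \<alpha> V (?A \<otimes>\<^sub>o ?B) ?D) \<cdot> (\<alpha> V ?A ?B \<otimes>\<^sub>a \<iota> ?D)"
    by (simp add: merge)
  also have "(\<iota> V \<otimes>\<^sub>a (pow_merge V a b \<otimes>\<^sub>a \<iota> ?D)) \<cdot> \<alpha> V (?A \<otimes>\<^sub>o ?B) ?D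
    = \<alpha> V (pow (a + b)) ?D \<cdot> ((\<iota> V \<otimes>\<^sub>a pow_merge V a b) \<otimes>\<^sub>a \<iota> ?D)"
    by (simp add: nat_mid)
  also have "(\<iota> V \<otimes>\<^sub>a pow_merge V (a + b) c) \<cdot> \<dots> \<cdot> (\<alpha> V ?A ?B \<otimes>\<^sub>a \<iota> ?D)
    = pow_merge V (Suc a + b) c \<cdot> (pow_merge V (Suc a) b \<otimes>\<^sub>a \<iota> ?D)"
    by (simp add: merge)
  finally show ?case .
qed simp

lemma E_pow_type [simp]:
  assumes "f \<in> Arr C" "Dom C f = Unit C" "Cod C f = pow (Suc n)"
  shows "E_pow C V (Suc n) f \<in> Arr C" "Dom C (E_pow C V (Suc n) f) = Unit C"
    "Cod C (E_pow C V (Suc n) f) = pow (Suc n)"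
  using assms by (simp_all add: E_pow_def assoc_pow_eq_pow_merge del: assoc_pow.simps)

text \<open>Rotating the first \<open>a\<close> legs one at a time is rotating them as one block. The induction step splits
  the last leg off a block of \<open>a + 1\<close>: the first \<open>a\<close> legs are rotated as a block by the induction
  hypothesis, one more application of \<open>E_pow\<close> rotates the next leg, and \<open>E_map_tensor\<close> combines both
  rotations.\<close>

lemma E_pow_iterate:
  assumes "f \<in> Arr C" "Dom C f = Unit C" "Cod C f = pow a \<otimes>\<^sub>o pow b"
  shows "(E_pow C V (a + b) ^^ a) (pow_merge V a b \<cdot> f) = pow_merge V b a \<cdot> E_map C (pow a) (pow b) f"
  using assms
proof (induction a arbitrary: b f)
  case 0
  then show ?case by (simp add: E_map_Unit_left)
next
  case (Suc a)
  note [simp] = Suc.prems(1,2) Suc.prems(3)[simplified]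
  let ?A = "pow a" and ?B = "pow b"
  \<comment> \<open>The block \<open>V\<^sup>\<otimes>\<^sup>(\<^sup>a\<^sup>+\<^sup>1\<^sup>)\<close> is \<open>V \<otimes> V\<^sup>\<otimes>\<^sup>a\<close> by definition, but the leg to be split off is the last one;
    \<open>c\<close> mediates, and \<open>f'\<close> is \<open>f\<close> with that leg moved to the second block.\<close>
  define c where "c = pow_merge V a (Suc 0)"
  have c [simp]: "c \<in> Arr C" "Dom C c = ?A \<otimes>\<^sub>o V" "Cod C c = V \<otimes>\<^sub>o ?A" "is_iso C c"
    by (simp_all add: c_def del: pow_merge.simps)
  define f' where "f' = \<alpha> ?A V ?B \<cdot> (Inv C c \<otimes>\<^sub>a \<iota> ?B) \<cdot> f"
  have f' [simp]: "f' \<in> Arr C" "Dom C f' = Unit C" "Cod C f' = ?A \<otimes>\<^sub>o (V \<otimes>\<^sub>o ?B)"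
    by (simp_all add: f'_def)
  define g where "g = E_map C ?A (V \<otimes>\<^sub>o ?B) f'"
  have g [simp]: "g \<in> Arr C" "Dom C g = Unit C" "Cod C g = (V \<otimes>\<^sub>o ?B) \<otimes>\<^sub>o ?A"
    by (simp_all add: g_def)
  have f: "(c \<otimes>\<^sub>a \<iota> ?B) \<cdot> \<alpha>' ?A V ?B \<cdot> f' = f"
    by (simp add: f'_def) (simp add: merge)
  have "pow_merge V (Suc a) b \<cdot> f = (pow_merge V (Suc a) b \<cdot> (c \<otimes>\<^sub>a \<iota> ?B)) \<cdot> \<alpha>' ?A V ?B \<cdot> f'"
    by (simp add: f del: pow_merge.simps)
  also have "pow_merge V (Suc a) b \<cdot> (c \<otimes>\<^sub>a \<iota> ?B) = pow_merge V a (Suc b) \<cdot> \<alpha> ?A V ?B"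
    using pow_merge_assoc[of a "Suc 0" b] by (simp add: c_def)
  finally have "pow_merge V (Suc a) b \<cdot> f = pow_merge V a (Suc b) \<cdot> f'"
    by (simp del: pow_merge.simps)
  then have "(E_pow C V (Suc a + b) ^^ Suc a) (pow_merge V (Suc a) b \<cdot> f)
    = E_pow C V (Suc (a + b)) ((E_pow C V (a + Suc b) ^^ a) (pow_merge V a (Suc b) \<cdot> f'))"
    by simp
  also have "(E_pow C V (a + Suc b) ^^ a) (pow_merge V a (Suc b) \<cdot> f') = pow_merge V (Suc b) a \<cdot> g"
    unfolding g_def by (subst Suc.IH) simp_all
  also have "\<dots> = (\<iota> V \<otimes>\<^sub>a pow_merge V b a) \<cdot> \<alpha> V ?B ?A \<cdot> g"
    by simp
  also have "E_pow C V (Suc (a + b)) \<dots> = pow_merge V (b + a) (Suc 0) \<cdot> E_map C V (pow (b + a)) \<dots>"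
    by (simp add: E_pow_def assoc_pow_eq_pow_merge add.commute del: assoc_pow.simps)
  also have "E_map C V (pow (b + a)) ((\<iota> V \<otimes>\<^sub>a pow_merge V b a) \<cdot> \<alpha> V ?B ?A \<cdot> g)
    = (pow_merge V b a \<otimes>\<^sub>a \<iota> V) \<cdot> E_map C V (?B \<otimes>\<^sub>o ?A) (\<alpha> V ?B ?A \<cdot> g)"
    by (rule E_map_natural) simp_all
  also have "E_map C V (?B \<otimes>\<^sub>o ?A) (\<alpha> V ?B ?A \<cdot> g)
    = \<alpha>' ?B ?A V \<cdot> E_map C (?A \<otimes>\<^sub>o V) ?B (\<alpha>' ?A V ?B \<cdot> f')"
    by (simp add: E_map_tensor flip: g_def)
  finally have "(E_pow C V (Suc a + b) ^^ Suc a) (pow_merge V (Suc a) b \<cdot> f)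
    = (pow_merge V (b + a) (Suc 0) \<cdot> (pow_merge V b a \<otimes>\<^sub>a \<iota> V)) \<cdot> \<alpha>' ?B ?A V \<cdot> E_map C (?A \<otimes>\<^sub>o V) ?B (\<alpha>' ?A V ?B \<cdot> f')"
    by simp
  also have "pow_merge V (b + a) (Suc 0) \<cdot> (pow_merge V b a \<otimes>\<^sub>a \<iota> V) = pow_merge V b (Suc a) \<cdot> (\<iota> ?B \<otimes>\<^sub>a c) \<cdot> \<alpha> ?B ?A V"
    using pow_merge_assoc[of b a "Suc 0"] by (simp add: c_def)
  also have "\<dots> \<cdot> \<alpha>' ?B ?A V \<cdot> E_map C (?A \<otimes>\<^sub>o V) ?B (\<alpha>' ?A V ?B \<cdot> f')
    = pow_merge V b (Suc a) \<cdot> (\<iota> ?B \<otimes>\<^sub>a c) \<cdot> E_map C (?A \<otimes>\<^sub>o V) ?B (\<alpha>' ?A V ?B \<cdot> f')"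
    by simp
  also have "(\<iota> ?B \<otimes>\<^sub>a c) \<cdot> E_map C (?A \<otimes>\<^sub>o V) ?B (\<alpha>' ?A V ?B \<cdot> f')
    = E_map C (pow (Suc a)) ?B ((c \<otimes>\<^sub>a \<iota> ?B) \<cdot> \<alpha>' ?A V ?B \<cdot> f')"
    by (rule E_map_natural[symmetric]) simp_all
  finally show ?case
    unfolding f .
qed

text \<open>The case \<open>b = 0\<close>, where the whole power is rotated past the unit object.\<close>

theorem E_pow_periodic:
  assumes "f \<in> Arr C" "Dom C f = Unit C" "Cod C f = pow n"
  shows "(E_pow C V n ^^ n) f = f"
  using E_pow_iterate[of f n 0] assms by (simp add: E_map_Unit_right)

end

end

section \<open>Traces of periodic linear maps\<close>

locale fin_dim_space = vectorspace class_ring V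
  for V :: "('k::field, 'v, 'z) module_scheme" (structure) +
  assumes finite_dimensional: "fin_dim"
begin

definition linear_functional :: "('v \<Rightarrow> 'k) \<Rightarrow> bool" where
  "linear_functional \<phi> \<longleftrightarrow> (\<forall>v\<in>carrier V. \<forall>w\<in>carrier V. \<phi> (v \<oplus> w) = \<phi> v + \<phi> w)
    \<and> (\<forall>a. \<forall>v\<in>carrier V. \<phi> (a \<odot> v) = a * \<phi> v)"

definition linear_endo :: "('v \<Rightarrow> 'v) \<Rightarrow> bool" where
  "linear_endo T \<longleftrightarrow> (\<forall>v\<in>carrier V. T v \<in> carrier V)
    \<and> (\<forall>v\<in>carrier V. \<forall>w\<in>carrier V. T (v \<oplus> w) = T v \<oplus> T w)
    \<and> (\<forall>a. \<forall>v\<in>carrier V. T (a \<odot> v) = a \<odot> T v)"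

lemma one_smult [simp]: "v \<in> carrier V \<Longrightarrow> 1 \<odot> v = v"
  using smult_one[of v] by simp

lemma linear_functional_zero: "linear_functional \<phi> \<Longrightarrow> \<phi> \<zero> = 0"
  by (metis M.l_zero M.zero_closed add_cancel_left_left linear_functional_def)

lemma linear_functional_lincomb:
  assumes "linear_functional \<phi>" "finite S" "S \<subseteq> carrier V"
  shows "\<phi> (lincomb a S) = (\<Sum>s\<in>S. a s * \<phi> s)"
  using assms(2,3)
proof (induction S)
  case empty
  then show ?case using linear_functional_zero[OF assms(1)] by (simp add: lincomb_def)
next
  case (insert s S)
  have "lincomb a (insert s S) = a s \<odot> s \<oplus> lincomb a S"
    using lincomb_insert[of S a s] insert by simp
  moreover have "lincomb a S \<in> carrier V"
    using insert by (intro lincomb_closed) auto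
  ultimately show ?case using insert assms(1) by (simp add: linear_functional_def)
qed

lemma linear_functional_compose:
  "linear_functional \<phi> \<Longrightarrow> linear_endo T \<Longrightarrow> linear_functional (\<lambda>v. \<phi> (T v))"
  by (simp add: linear_functional_def linear_endo_def)

abbreviation finite_basis where "finite_basis B \<equiv> finite B \<and> basis B"
abbreviation coord where "coord \<equiv> coordinates V"

context
  fixes B assumes B: "finite_basis B"
begin

lemma basis_carrier: "B \<subseteq> carrier V"
  using B by (simp add: basis_def)

lemma coordinates_spec:
  assumes "v \<in> carrier V"
  shows "coord B v \<in> extensional B \<and> lincomb (coord B v) B = v"
    and "\<And>a. a \<in> extensional B \<Longrightarrow> lincomb a B = v \<Longrightarrow> coord B v = a"
proof -
  have ex1: "\<exists>!a. a \<in> extensional B \<and> lincomb a B = v"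
    using basis_criterion[of B] B basis_carrier assms by (auto simp: PiE_def)
  show "coord B v \<in> extensional B \<and> lincomb (coord B v) B = v"
    unfolding coordinates_def by (rule theI'[OF ex1])
  then show "coord B v = a" if "a \<in> extensional B" "lincomb a B = v" for a
    using ex1 that by blast
qed

lemma coordinates_eqI:
  assumes "lincomb a B = v" "b \<in> B"
  shows "coord B v b = a b"
proof -
  have "lincomb (restrict a B) B = lincomb a B"
    using basis_carrier by (intro lincomb_cong) auto
  moreover have "lincomb a B \<in> carrier V"
    using basis_carrier by (intro lincomb_closed) auto
  ultimately have "coord B v = restrict a B"
    using assms by (intro coordinates_spec(2)) auto
  then show ?thesis using assms by simp
qed

lemma linear_functional_coordinates:
  assumes "b \<in> B" shows "linear_functional (\<lambda>v. coord B v b)"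
  unfolding linear_functional_def
proof (intro conjI ballI allI)
  fix v w assume v: "v \<in> carrier V" and w: "w \<in> carrier V"
  have "lincomb (\<lambda>b. coord B v b + coord B w b) B = lincomb (coord B v) B \<oplus> lincomb (coord B w) B"
    using lincomb_sum[of B "coord B v" "coord B w"] B basis_carrier by simp
  then show "coord B (v \<oplus> w) b = coord B v b + coord B w b"
    using coordinates_spec(1) v w assms by (intro coordinates_eqI) auto
next
  fix a v assume v: "v \<in> carrier V"
  have "lincomb (\<lambda>b. a * coord B v b) B = a \<odot> lincomb (coord B v) B"
    using lincomb_smult[of B "coord B v" a] basis_carrier by simp
  then show "coord B (a \<odot> v) b = a * coord B v b"
    using coordinates_spec(1) v assms by (intro coordinates_eqI) auto
qed

lemma coordinates_inject:
  assumes "v \<in> carrier V" "w \<in> carrier V" "\<And>b. b \<in> B \<Longrightarrow> coord B v b = coord B w b"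
  shows "v = w"
proof -
  have "lincomb (coord B v) B = lincomb (coord B w) B"
    using assms(3) basis_carrier by (intro lincomb_cong) auto
  then show ?thesis using coordinates_spec(1) assms by auto
qed

end

text \<open>The trace with respect to a given basis, to compare the basis chosen by \<open>lin_trace\<close> with a basis
  of eigenvectors.\<close>

definition trace_at :: "'v set \<Rightarrow> ('v \<Rightarrow> 'v) \<Rightarrow> 'k" where
  "trace_at B T = (\<Sum>b\<in>B. coord B (T b) b)"

text \<open>Expanding each \<open>b\<close> in the basis \<open>B'\<close> turns the trace into a double sum over \<open>B\<close> and \<open>B'\<close>;
  collecting the terms over \<open>B\<close> gives the trace with respect to \<open>B'\<close>.\<close>

lemma trace_at_independent:
  assumes B: "finite_basis B" and B': "finite_basis B'" and T: "linear_endo T"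
  shows "trace_at B T = trace_at B' T"
proof -
  note car = basis_carrier[OF B] basis_carrier[OF B']
  have Tcar: "T v \<in> carrier V" if "v \<in> carrier V" for v using T that by (simp add: linear_endo_def)
  have "trace_at B T = (\<Sum>b\<in>B. \<Sum>b'\<in>B'. coord B' b b' * coord B (T b') b)"
    unfolding trace_at_def
  proof (rule sum.cong[OF refl])
    fix b assume b: "b \<in> B"
    have "coord B (T b) b = coord B (T (lincomb (coord B' b) B')) b"
      using coordinates_spec(1)[OF B', of b] b car by auto
    also have "\<dots> = (\<Sum>b'\<in>B'. coord B' b b' * coord B (T b') b)"
      using linear_functional_lincomb[OF linear_functional_compose[OF linear_functional_coordinates[OF B b] T]]
        B' car by simp
    finally show "coord B (T b) b = (\<Sum>b'\<in>B'. coord B' b b' * coord B (T b') b)" .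
  qed
  also have "\<dots> = (\<Sum>b'\<in>B'. \<Sum>b\<in>B. coord B (T b') b * coord B' b b')"
    by (subst sum.swap) (simp add: mult.commute)
  also have "\<dots> = trace_at B' T"
    unfolding trace_at_def
  proof (rule sum.cong[OF refl])
    fix b' assume b': "b' \<in> B'"
    have "(\<Sum>b\<in>B. coord B (T b') b * coord B' b b') = coord B' (lincomb (coord B (T b')) B) b'"
      using linear_functional_lincomb[OF linear_functional_coordinates[OF B' b']] B car by simp
    also have "lincomb (coord B (T b')) B = T b'"
      using coordinates_spec(1)[OF B] Tcar b' car by auto
    finally show "(\<Sum>b\<in>B. coord B (T b') b * coord B' b b') = coord B' (T b') b'" .
  qed
  finally show ?thesis .
qed

lemma lin_trace_eq:
  assumes "finite_basis B" "linear_endo T"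
  shows "lin_trace V T = trace_at B T"
proof -
  have "finite_basis (SOME B. finite_basis B)"
    by (rule someI[of finite_basis, OF assms(1)])
  then show ?thesis
    using trace_at_independent[OF _ assms] by (simp add: lin_trace_def trace_at_def)
qed

text \<open>Only the values on the carrier enter, since basis vectors lie there. Needed because maps such as
  \<open>inv_into\<close> are controlled on the morphism space only.\<close>

lemma lin_trace_cong:
  assumes "\<And>v. v \<in> carrier V \<Longrightarrow> S v = T v"
  shows "lin_trace V S = lin_trace V T"
proof -
  have "finite_basis (SOME B. finite_basis B)"
    using finite_basis_exists[OF finite_dimensional] by (rule someI_ex)
  then have "(SOME B. finite_basis B) \<subseteq> carrier V" by (simp add: basis_def)
  then show ?thesis unfolding lin_trace_def Let_def
    using assms by (intro sum.cong) auto
qed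

text \<open>A maximal independent subset of the (possibly infinite) spanning set is a basis; its size is
  bounded by the dimension, so a maximal one exists.\<close>

lemma basis_in_spanning_set:
  assumes "S \<subseteq> carrier V" "carrier V \<subseteq> span S"
  obtains B where "B \<subseteq> S" "finite_basis B"
proof -
  have "\<exists>B. finite B \<and> maximal B (\<lambda>B. B \<subseteq> S \<and> lin_indpt B)"
  proof (rule maximal_exists[where N = dim])
    show "{} \<subseteq> S \<and> lin_indpt {}" by (simp add: lin_dep_def)
    show "finite A \<and> card A \<le> dim" if "A \<subseteq> S \<and> lin_indpt A" for A
      using that assms(1) li_le_dim[OF finite_dimensional, of A] by auto
  qed
  then obtain B where B: "finite B" "maximal B (\<lambda>B. B \<subseteq> S \<and> lin_indpt B)" by blast
  then have BS: "B \<subseteq> S" and li: "lin_indpt B" by (auto simp: maximal_def)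
  have Bcar: "B \<subseteq> carrier V" using BS assms(1) by simp
  have "S \<subseteq> span B"
  proof
    fix s assume s: "s \<in> S"
    show "s \<in> span B"
    proof (cases "s \<in> B")
      case True
      then show ?thesis using in_own_span[OF Bcar] by blast
    next
      case False
      then have "lin_dep (B \<union> {s})"
        using B(2) s BS unfolding maximal_def by blast
      then show ?thesis using lin_dep_iff_in_span[OF Bcar li _ False] s assms(1) by blast
    qed
  qed
  then have "span S \<subseteq> span B"
    by (rule span_is_subset) (rule span_is_submodule[OF Bcar])
  then have "gen_set B" using assms(2) span_is_subset2[OF Bcar] by auto
  then have "finite_basis B" using B(1) li Bcar by (simp add: basis_def)
  with BS show ?thesis by (rule that)
qed

end

text \<open>A linear map of period \<open>n\<close> over a field of characteristic zero that contains a primitive \<open>n\<close>-th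
  root of unity \<open>\<zeta>\<close>.\<close>

locale periodic_endo = fin_dim_space V for V :: "('k::field_char_0, 'v, 'z) module_scheme" (structure) +
  fixes T :: "'v \<Rightarrow> 'v" and n :: nat and \<zeta> :: 'k
  assumes T: "linear_endo T"
    and T_period: "v \<in> carrier V \<Longrightarrow> (T ^^ n) v = v"
    and n_pos: "n > 0"
    and zeta_root: "\<zeta> ^ n = 1"
    and zeta_prim: "0 < i \<Longrightarrow> i < n \<Longrightarrow> \<zeta> ^ i \<noteq> 1"
begin

lemma T_carrier [simp]: "v \<in> carrier V \<Longrightarrow> T v \<in> carrier V"
  using T by (simp add: linear_endo_def)

lemma T_pow_carrier [simp]: "v \<in> carrier V \<Longrightarrow> (T ^^ i) v \<in> carrier V"
  by (induction i) simp_all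

lemma linear_endo_T_pow: "linear_endo (T ^^ i)"
  using T by (induction i) (simp_all add: linear_endo_def)

text \<open>The sum of \<open>c\<^sup>j T\<^sup>j v\<close> over \<open>j < i\<close>. For \<open>i = n\<close> and \<open>c\<^sup>n = 1\<close> it is \<open>n\<close> times the projection of \<open>v\<close>
  to the eigenspace of \<open>c\<inverse>\<close>.\<close>

primrec orbit_sum :: "'k \<Rightarrow> 'v \<Rightarrow> nat \<Rightarrow> 'v" where
  "orbit_sum c v 0 = \<zero>"
| "orbit_sum c v (Suc i) = orbit_sum c v i \<oplus> (c ^ i \<odot> (T ^^ i) v)"

lemma orbit_sum_carrier [simp]: "v \<in> carrier V \<Longrightarrow> orbit_sum c v i \<in> carrier V"
  by (induction i) simp_all

lemma T_zero: "T \<zero> = \<zero>"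
proof -
  have "T (0 \<odot> \<zero>) = 0 \<odot> T \<zero>" using T M.zero_closed unfolding linear_endo_def by blast
  then show ?thesis using lmult_0[of "T \<zero>"] lmult_0[of "\<zero>"] by simp
qed

lemma orbit_sum_shift:
  assumes v: "v \<in> carrier V"
  shows "(c \<odot> T (orbit_sum c v i)) \<oplus> v = orbit_sum c v (Suc i)"
proof (induction i)
  case 0
  show ?case using v by (simp add: T_zero)
next
  case (Suc i)
  have "c \<odot> T (orbit_sum c v (Suc i)) = (c \<odot> T (orbit_sum c v i)) \<oplus> (c ^ Suc i \<odot> (T ^^ Suc i) v)"
    using T v by (simp add: linear_endo_def smult_r_distr smult_assoc1[symmetric])
  then have "(c \<odot> T (orbit_sum c v (Suc i))) \<oplus> v
    = ((c \<odot> T (orbit_sum c v i)) \<oplus> v) \<oplus> (c ^ Suc i \<odot> (T ^^ Suc i) v)"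
    using v by (simp add: M.a_ac)
  also have "\<dots> = orbit_sum c v (Suc (Suc i))"
    unfolding Suc.IH by simp
  finally show ?case .
qed

text \<open>Applying \<open>c T\<close> shifts the summation range by one, and the two end terms agree since
  \<open>c\<^sup>n T\<^sup>n v = v\<close>.\<close>

lemma orbit_sum_eigenvector:
  assumes v: "v \<in> carrier V" and c: "c ^ n = 1"
  shows "T (orbit_sum c v n) = inverse c \<odot> orbit_sum c v n"
proof -
  have c0: "c \<noteq> 0" using c n_pos by (auto simp: power_0_left)
  have "(c \<odot> T (orbit_sum c v n)) \<oplus> v = orbit_sum c v n \<oplus> v"
    unfolding orbit_sum_shift[OF v] using c T_period[OF v] v by simp
  then have eq: "c \<odot> T (orbit_sum c v n) = orbit_sum c v n"
    using v by (simp add: M.add.right_cancel)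
  have "T (orbit_sum c v n) = (inverse c * c) \<odot> T (orbit_sum c v n)"
    using c0 v smult_one[of "T (orbit_sum c v n)"] by simp
  also have "\<dots> = inverse c \<odot> (c \<odot> T (orbit_sum c v n))"
    using v smult_assoc1[of "inverse c" c] by simp
  finally show ?thesis by (simp only: eq)
qed

definition eigenvectors :: "'v set" where
  "eigenvectors = {v \<in> carrier V. \<exists>l. l ^ n = 1 \<and> T v = l \<odot> v}"

lemma eigenvectors_carrier: "eigenvectors \<subseteq> carrier V"
  by (auto simp: eigenvectors_def)

lemma zeta_pow_root: "(\<zeta> ^ j) ^ n = 1"
proof -
  have "(\<zeta> ^ j) ^ n = (\<zeta> ^ n) ^ j" by (metis mult.commute power_mult)
  then show ?thesis by (simp add: zeta_root)
qed

lemma root_orthogonality: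
  assumes "i < n"
  shows "(\<Sum>j<n. (\<zeta> ^ j) ^ i) = (if i = 0 then of_nat n else 0)"
proof (cases "i = 0")
  case False
  have "(\<Sum>j<n. (\<zeta> ^ j) ^ i) = (\<Sum>j<n. (\<zeta> ^ i) ^ j)"
    by (simp add: power_mult[symmetric] mult.commute)
  also have "\<dots> = ((\<zeta> ^ i) ^ n - 1) / (\<zeta> ^ i - 1)"
    using zeta_prim[of i] False assms by (intro geometric_sum) auto
  also have "(\<zeta> ^ i) ^ n = 1" by (rule zeta_pow_root)
  finally show ?thesis using False by simp
qed simp

text \<open>Every \<open>v\<close> is the average of its orbit sums for \<open>c = 1, \<zeta>, \<dots>, \<zeta>\<^sup>n\<^sup>-\<^sup>1\<close>, by orthogonality of the
  powers of \<open>\<zeta>\<close>. The equation is checked in coordinates, where the vector sums become sums in the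
  field.\<close>

lemma eigenvectors_span: "carrier V \<subseteq> span eigenvectors"
proof
  fix v assume v: "v \<in> carrier V"
  interpret sp: submodule class_ring "span eigenvectors" V
    by (rule span_is_submodule[OF eigenvectors_carrier])
  define R where "R = rec_nat \<zero> (\<lambda>j w. w \<oplus> orbit_sum (\<zeta> ^ j) v n)"
  have R: "R 0 = \<zero>" "\<And>j. R (Suc j) = R j \<oplus> orbit_sum (\<zeta> ^ j) v n" by (simp_all add: R_def)
  have ev: "orbit_sum (\<zeta> ^ j) v n \<in> eigenvectors" for j
  proof -
    note c = zeta_pow_root[of j]
    then have "(inverse (\<zeta> ^ j)) ^ n = 1" by (simp add: power_inverse)
    then show ?thesis
      using orbit_sum_eigenvector[OF v c] v unfolding eigenvectors_def by auto
  qed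
  have R_span: "R j \<in> span eigenvectors" for j
    using ev in_own_span[OF eigenvectors_carrier] by (induction j) (auto simp: R)
  have Rcar [simp]: "R j \<in> carrier V" for j using R_span sp.subset by blast
  obtain B where B: "finite_basis B" using finite_basis_exists[OF finite_dimensional] by blast
  have "inverse (of_nat n) \<odot> R n = v"
  proof (rule coordinates_inject[OF B])
    fix b assume b: "b \<in> B"
    define \<phi> where "\<phi> = (\<lambda>v. coord B v b)"
    have \<phi>: "linear_functional \<phi>" unfolding \<phi>_def by (rule linear_functional_coordinates[OF B b])
    note lin = \<phi>[unfolded linear_functional_def]
    have orb: "\<phi> (orbit_sum c v i) = (\<Sum>k<i. c ^ k * \<phi> ((T ^^ k) v))" for c i
      by (induction i) (use v lin linear_functional_zero[OF \<phi>] in auto)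
    have "\<phi> (R m) = (\<Sum>j<m. \<phi> (orbit_sum (\<zeta> ^ j) v n))" for m
      by (induction m) (use v lin linear_functional_zero[OF \<phi>] in \<open>auto simp: R\<close>)
    then have "\<phi> (R n) = (\<Sum>j<n. \<Sum>k<n. (\<zeta> ^ j) ^ k * \<phi> ((T ^^ k) v))"
      by (simp add: orb)
    also have "\<dots> = (\<Sum>k<n. (\<Sum>j<n. (\<zeta> ^ j) ^ k) * \<phi> ((T ^^ k) v))"
      by (subst sum.swap) (simp add: sum_distrib_right)
    \<comment> \<open>Only the summand for \<open>T\<^sup>0 v = v\<close> survives.\<close>
    also have "\<dots> = (\<Sum>k<n. if k = 0 then of_nat n * \<phi> v else 0)"
      by (intro sum.cong) (auto simp: root_orthogonality)
    also have "\<dots> = of_nat n * \<phi> v" using n_pos by simp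
    finally show "coord B (inverse (of_nat n) \<odot> R n) b = coord B v b"
      using lin n_pos unfolding \<phi>_def by simp
  qed (use v in auto)
  moreover have "inverse (of_nat n) \<odot> R n \<in> span eigenvectors"
    using R_span by (intro sp.smult_closed) auto
  ultimately show "v \<in> span eigenvectors" by simp
qed

theorem trace_of_powers:
  "\<exists>(B :: 'v set) l. finite B \<and> (\<forall>b\<in>B. l b ^ n = 1) \<and> (\<forall>r. lin_trace V (T ^^ r) = (\<Sum>b\<in>B. l b ^ r))"
proof -
  obtain B where BE: "B \<subseteq> eigenvectors" and B: "finite_basis B"
    by (rule basis_in_spanning_set[OF eigenvectors_carrier eigenvectors_span])
  have "\<exists>l. \<forall>b\<in>B. l b ^ n = 1 \<and> T b = l b \<odot> b"
    using BE unfolding eigenvectors_def by (intro bchoice) auto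
  then obtain l where l: "\<And>b. b \<in> B \<Longrightarrow> l b ^ n = 1 \<and> T b = l b \<odot> b" by blast
  have "lin_trace V (T ^^ r) = (\<Sum>b\<in>B. l b ^ r)" for r
  proof -
    have "coord B ((T ^^ r) b) b = l b ^ r" if b: "b \<in> B" for b
    proof -
      have bcar [simp]: "b \<in> carrier V" using b basis_carrier[OF B] by auto
      have "(T ^^ r) b = l b ^ r \<odot> b"
      proof (induction r)
        case (Suc r)
        then have "(T ^^ Suc r) b = l b ^ r \<odot> T b" using T by (simp add: linear_endo_def)
        then show ?case using l[OF b] smult_assoc1[of "l b ^ r" "l b" b] by (simp add: mult.commute)
      qed (use smult_one[of b] in simp)
      moreover have "coord B b b = 1"
      proof -
        have "lincomb (\<lambda>x. if x = b then 1 else 0) B = b"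
        proof -
          let ?a = "\<lambda>x. if x = b then 1 else 0 :: 'k"
          have S: "finite (B - {b})" "B - {b} \<subseteq> carrier V" "(B - {b}) \<union> {b} = B"
            using B basis_carrier[OF B] b by auto
          have "lincomb ?a ((B - {b}) \<union> {b}) = ?a b \<odot> b \<oplus> lincomb ?a (B - {b})"
            using S by (intro lincomb_insert) auto
          moreover have "lincomb ?a (B - {b}) = \<zero>"
            using S by (intro lincomb_zero) auto
          ultimately show ?thesis using S(3) by simp
        qed
        from coordinates_eqI[OF B this b] show ?thesis by simp
      qed
      ultimately show ?thesis
        using linear_functional_coordinates[OF B b] by (simp add: linear_functional_def)
    qed
    then show ?thesis using lin_trace_eq[OF B linear_endo_T_pow] by (simp add: trace_at_def)
  qed
  with B l show ?thesis by blast
qed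

end

section \<open>Conjugation on cyclotomic fields\<close>

interpretation rat_poly_hom: map_poly_comm_ring_hom "of_rat :: rat \<Rightarrow> 'k::field_char_0" ..

text \<open>Evaluation of rational polynomials in any field of characteristic zero. It allows a complex
  number and an element of \<open>k\<close> to be compared by the rational polynomials that vanish at them.\<close>

definition rat_eval :: "rat poly \<Rightarrow> 'k::field_char_0 \<Rightarrow> 'k" where
  "rat_eval p x = poly (map_poly of_rat p) x"

lemma rat_eval_simps [simp]:
  "rat_eval 0 x = 0" "rat_eval 1 x = 1" "rat_eval [:c:] x = of_rat c"
  "rat_eval (p + q) x = rat_eval p x + rat_eval q x"
  "rat_eval (p * q) x = rat_eval p x * rat_eval q x"
  "rat_eval (- p) x = - rat_eval p x"
  "rat_eval (p - q) x = rat_eval p x - rat_eval q x"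
  "rat_eval (pCons c p) x = of_rat c + x * rat_eval p x"
  "rat_eval (Polynomial.monom c i) x = of_rat c * x ^ i"
  by (simp_all add: rat_eval_def rat_poly_hom.hom_add rat_poly_hom.hom_mult rat_poly_hom.hom_minus
    rat_poly_hom.hom_uminus of_rat_hom.map_poly_pCons_hom map_poly_monom poly_monom)

lemma rat_eval_sum [simp]: "rat_eval (\<Sum>i\<in>S. p i) x = (\<Sum>i\<in>S. rat_eval (p i) x)"
  by (induction S rule: infinite_finite_induct) simp_all

lemma rat_eval_pcompose: "rat_eval (pcompose p q) x = rat_eval p (rat_eval q x)"
  by (induction p) (simp_all add: pcompose_pCons)

text \<open>The last property is the form in which irreducibility of the minimal polynomial is used: it
  either divides \<open>f\<close> or is coprime to \<open>f\<close>. A nonzero polynomial of least degree vanishing at \<open>z\<close> has it,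
  because if it is a product then one of the factors vanishes at \<open>z\<close> and so has the same degree.\<close>

lemma minimal_polynomial:
  fixes z :: "'a::field_char_0"
  assumes "p \<noteq> 0" "rat_eval p z = 0"
  obtains m where "rat_eval m z = 0" "Polynomial.degree m > 0" "\<And>f. m dvd f \<or> (\<exists>a b. a * f + b * m = 1)"
proof -
  define P where "P = (\<lambda>p. p \<noteq> 0 \<and> rat_eval p z = 0)"
  define m where "m = arg_min Polynomial.degree P"
  have m: "P m" "\<And>f. P f \<Longrightarrow> Polynomial.degree m \<le> Polynomial.degree f"
    using arg_min_nat_lemma[of P p Polynomial.degree] assms by (auto simp: P_def m_def)
  have deg: "Polynomial.degree m > 0"
  proof (rule ccontr)
    assume "\<not> Polynomial.degree m > 0"
    then obtain c where "m = [:c:]" by (auto elim: degree_eq_zeroE)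
    then show False using m(1) by (auto simp: P_def)
  qed
  have dvd: "m dvd f" if "rat_eval f z = 0" for f
  proof -
    have "rat_eval f z = rat_eval (f div m) z * rat_eval m z + rat_eval (f mod m) z"
      by (metis div_mult_mod_eq rat_eval_simps(4,5))
    then have "rat_eval (f mod m) z = 0" using that m(1) by (simp add: P_def)
    then have "f mod m = 0"
      using m degree_mod_less'[of m f] by (force simp: P_def)
    then show ?thesis by auto
  qed
  have "m dvd f \<or> (\<exists>a b. a * f + b * m = 1)" for f
  proof -
    define g where "g = gcd f m"
    obtain h where h: "m = g * h" unfolding g_def by (meson dvdE gcd_dvd2)
    have nz: "g \<noteq> 0" "h \<noteq> 0" using m(1) h by (auto simp: P_def)
    have "rat_eval g z = 0 \<or> rat_eval h z = 0" using m(1) h by (auto simp: P_def)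
    then show ?thesis
    proof
      assume "rat_eval g z = 0"
      then have "m dvd g" by (rule dvd)
      then show ?thesis unfolding g_def by auto
    next
      assume "rat_eval h z = 0"
      then have "Polynomial.degree m \<le> Polynomial.degree h" using m(2) nz by (simp add: P_def)
      then have "Polynomial.degree g = 0" using h nz by (simp add: degree_mult_eq)
      then have "is_unit g" using nz by (simp add: is_unit_iff_degree)
      then have "gcd f m = 1" unfolding g_def by (metis coprime_iff_gcd_eq_1 is_unit_gcd)
      then show ?thesis using bezout_coefficients_fst_snd[of f m] by metis
    qed
  qed
  then show ?thesis using that m(1) deg by (auto simp: P_def)
qed

text \<open>Let \<open>x\<close> be any root in \<open>k\<close> of the minimal polynomial \<open>m\<close> of \<open>z\<close>. Whether \<open>f\<close> vanishes at \<open>x\<close> or at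
  \<open>z\<close> is in both cases decided by divisibility by \<open>m\<close>. If \<open>f\<close> does not vanish, the Bezout identity for
  \<open>f\<close> and \<open>m\<close> yields a polynomial expression for the inverse, so that polynomial values at \<open>x\<close> already
  form a field.\<close>

lemma root_transfer:
  fixes z :: complex
  assumes "p \<noteq> 0" "rat_eval p z = 0"
  obtains x :: "'k::{alg_closed_field, field_char_0}"
  where "\<And>f. rat_eval f x = 0 \<longleftrightarrow> rat_eval f z = 0"
    "\<And>f. rat_eval f x \<noteq> 0 \<Longrightarrow> \<exists>g. rat_eval g x * rat_eval f x = 1"
proof -
  obtain m where m: "rat_eval m z = 0" "Polynomial.degree m > 0" "\<And>f. m dvd f \<or> (\<exists>a b. a * f + b * m = 1)"
    using minimal_polynomial[OF assms] by blast
  have "Polynomial.degree (map_poly of_rat m :: 'k poly) > 0"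
    using m(2) by simp
  then obtain x :: 'k where x: "rat_eval m x = 0"
    unfolding rat_eval_def using alg_closed_imp_poly_has_root by blast
  \<comment> \<open>Used for \<open>y = x\<close> in \<open>k\<close> and for \<open>y = z\<close> in the complex numbers.\<close>
  have dvd: "m dvd f \<and> rat_eval f y = 0 \<or> (\<not> m dvd f \<and> (\<exists>a. rat_eval a y * rat_eval f y = 1))"
    if y: "rat_eval m y = 0" for f and y :: "'l::field_char_0"
  proof (cases "m dvd f")
    case True
    then show ?thesis using y by (auto elim!: dvdE)
  next
    case False
    then obtain a b where "a * f + b * m = 1" using m(3) by blast
    then have "rat_eval (a * f + b * m) y = 1" by simp
    then show ?thesis using False y by auto
  qed
  show ?thesis
  proof (rule that[of x])
    show "rat_eval f x = 0 \<longleftrightarrow> rat_eval f z = 0" for f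
      using dvd[OF x, of f] dvd[OF m(1), of f] by auto
    show "\<exists>g. rat_eval g x * rat_eval f x = 1" if "rat_eval f x \<noteq> 0" for f
      using dvd[OF x, of f] that by auto
  qed
qed

text \<open>Besides primitivity, the two facts about \<open>\<zeta>\<close> that the automorphism needs: \<open>\<zeta>\<close> and its inverse are
  roots of the same rational polynomials, and the polynomial values at \<open>\<zeta>\<close> are closed under
  inverses.\<close>

locale primitive_root =
  fixes \<zeta> :: "'k::field_char_0" and n :: nat
  assumes n_pos: "n > 0"
    and zeta_root: "\<zeta> ^ n = 1"
    and zeta_prim: "0 < i \<Longrightarrow> i < n \<Longrightarrow> \<zeta> ^ i \<noteq> 1"
    and zeta_conj: "rat_eval f (inverse \<zeta>) = 0 \<longleftrightarrow> rat_eval f \<zeta> = 0"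
    and zeta_inv: "rat_eval f \<zeta> \<noteq> 0 \<Longrightarrow> \<exists>g. rat_eval g \<zeta> * rat_eval f \<zeta> = 1"

lemma rat_eval_cnj: "rat_eval f (cnj z) = cnj (rat_eval f z)"
proof (induction f)
  case (pCons a p)
  have "cnj (of_rat a) = of_rat a" by (cases a) (simp add: of_rat_rat)
  with pCons show ?case by simp
qed simp

text \<open>All properties are transferred from \<open>z = exp(2\<pi>i/n)\<close>, for which the inverse is the complex
  conjugate and hence a root of the same rational polynomials.\<close>

lemma primitive_root_exists:
  assumes n: "n > 0"
  obtains \<zeta> :: "'k::{alg_closed_field, field_char_0}" where "primitive_root \<zeta> n"
proof -
  define z where "z = cis (2 * pi / n)"
  have zn: "z ^ n = 1" using n by (simp add: z_def DeMoivre)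
  have z_prim: "z ^ i \<noteq> 1" if "0 < i" "i < n" for i
  proof
    assume "z ^ i = 1"
    then have "cis (2 * pi * real i / real n) = cis (2 * pi * real 0 / real n)"
      by (simp add: z_def DeMoivre mult.commute)
    moreover have "inj_on (\<lambda>k. cis (2 * pi * real k / real n)) {..<n}"
      using bij_betw_roots_unity[OF n] by (simp add: bij_betw_def)
    ultimately have "i = 0" using that inj_onD[of _ _ i 0] by fastforce
    then show False using that by simp
  qed
  have "cnj z = inverse z" by (simp add: z_def cis_cnj)
  then have z_conj: "rat_eval f (inverse z) = 0 \<longleftrightarrow> rat_eval f z = 0" for f
    using rat_eval_cnj[of f z] by simp
  have "Polynomial.coeff (Polynomial.monom 1 n - 1 :: rat poly) n = 1" using n by simp
  then have nz: "Polynomial.monom 1 n - 1 \<noteq> (0 :: rat poly)" by (metis coeff_0 zero_neq_one)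
  \<comment> \<open>The polynomial \<open>X\<^sup>n - 1\<close> shows that \<open>z\<close> is algebraic; its minimal polynomial stays implicit.\<close>
  have rt: "rat_eval (Polynomial.monom 1 n - 1) z = 0" using zn by simp
  obtain x :: 'k where x: "\<And>f. rat_eval f x = 0 \<longleftrightarrow> rat_eval f z = 0"
    "\<And>f. rat_eval f x \<noteq> 0 \<Longrightarrow> \<exists>g. rat_eval g x * rat_eval f x = 1"
    using root_transfer[OF nz rt] by metis
  have pow: "x ^ i = 1 \<longleftrightarrow> z ^ i = 1" for i
    using x(1)[of "Polynomial.monom 1 i - 1"] by simp
  \<comment> \<open>The inverse of a root of unity is one of its powers, so a relation for the inverse is a
    rational polynomial relation for the root itself, and can be transferred from \<open>z\<close> to \<open>x\<close>.\<close>
  have inv: "inverse y = rat_eval (Polynomial.monom 1 (n - 1)) y" if "y ^ n = 1" for y :: "'l::field_char_0"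
    using that n by (intro inverse_unique) (simp add: power_eq_if[of y n] split: if_splits)
  show ?thesis
  proof (rule that[of x], unfold_locales)
    show "x ^ n = 1" using pow zn by simp
    then have "rat_eval f (inverse x) = 0 \<longleftrightarrow> rat_eval (pcompose f (Polynomial.monom 1 (n - 1))) x = 0" for f
      by (simp only: inv rat_eval_pcompose)
    also have "\<dots> f \<longleftrightarrow> rat_eval f (inverse z) = 0" for f
      by (simp only: inv[OF zn] rat_eval_pcompose[symmetric] x(1))
    finally show "rat_eval f (inverse x) = 0 \<longleftrightarrow> rat_eval f x = 0" for f
      using z_conj x(1) by simp
  qed (use n pow z_prim x(2) in auto)
qed

context primitive_root
begin

lemma zeta_nonzero [simp]: "\<zeta> \<noteq> 0"
  using zeta_root n_pos by (auto simp: power_0_left)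

lemma zeta_inj: "inj_on (\<lambda>i. \<zeta> ^ i) {..<n}"
proof -
  have "i = j" if "i \<le> j" "j < n" "\<zeta> ^ i = \<zeta> ^ j" for i j
  proof -
    have "\<zeta> ^ (j - i) = 1" using that by (simp add: power_diff)
    then show ?thesis using zeta_prim[of "j - i"] that by linarith
  qed
  then show ?thesis unfolding inj_on_def by (metis lessThan_iff nle_le)
qed

lemma root_is_power:
  assumes "x ^ n = 1" obtains i where "i < n" "x = \<zeta> ^ i"
proof -
  define p where "p = (Polynomial.monom 1 n - 1 :: 'k poly)"
  have "Polynomial.coeff p n = 1" using n_pos by (simp add: p_def)
  then have p0: "p \<noteq> 0" by (metis coeff_0 zero_neq_one)
  have deg: "Polynomial.degree p \<le> n" unfolding p_def by (rule degree_diff_le) (simp_all add: degree_monom_le)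
  have roots: "{x. poly p x = 0} = {x. x ^ n = 1}" by (simp add: p_def poly_monom)
  have fin: "finite {x :: 'k. x ^ n = 1}"
    using poly_roots_finite[OF p0] by (simp add: roots)
  have card: "card {x :: 'k. x ^ n = 1} \<le> n"
    using card_poly_roots_bound[OF p0] deg by (simp add: roots)
  \<comment> \<open>The \<open>n\<close> distinct powers of \<open>\<zeta>\<close> exhaust the at most \<open>n\<close> roots of \<open>X\<^sup>n - 1\<close>.\<close>
  have sub: "(\<lambda>i. \<zeta> ^ i) ` {..<n} \<subseteq> {x. x ^ n = 1}"
  proof safe
    fix i
    have "(\<zeta> ^ i) ^ n = (\<zeta> ^ n) ^ i" by (metis mult.commute power_mult)
    then show "(\<zeta> ^ i) ^ n = 1" by (simp add: zeta_root)
  qed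
  have "(\<lambda>i. \<zeta> ^ i) ` {..<n} = {x. x ^ n = 1}"
    using card_image[OF zeta_inj] card by (intro card_seteq[OF fin sub]) simp
  then show ?thesis using assms that by blast
qed

text \<open>All \<open>n\<close>-th roots of unity are powers of \<open>\<zeta>\<close>, so the cyclotomic field consists of the polynomial
  values at \<open>\<zeta>\<close>.\<close>

lemma cyclotomic_field_eq: "cyclotomic_field n = range (\<lambda>p. rat_eval p \<zeta>)"
proof (intro equalityI subsetI)
  fix x :: 'k assume "x \<in> cyclotomic_field n"
  then have "x \<in> generate_field class_ring (\<rat> \<union> {\<zeta>. \<zeta> ^ n = 1})" by (simp add: cyclotomic_field_def)
  then show "x \<in> range (\<lambda>p. rat_eval p \<zeta>)"
  proof induction
    case one
    then show ?case using rangeI[of "\<lambda>p. rat_eval p \<zeta>" 1] by simp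
  next
    case (incl h)
    then show ?case
    proof
      assume "h \<in> \<rat>"
      then obtain q where "h = of_rat q" by (rule Rats_cases)
      then show ?thesis using rangeI[of "\<lambda>p. rat_eval p \<zeta>" "[:q:]"] by simp
    next
      assume "h \<in> {\<zeta>. \<zeta> ^ n = 1}"
      then obtain i where "h = \<zeta> ^ i" using root_is_power by blast
      then show ?thesis using rangeI[of "\<lambda>p. rat_eval p \<zeta>" "Polynomial.monom 1 i"] by simp
    qed
  next
    case (a_inv h)
    then obtain p where p: "h = rat_eval p \<zeta>" by blast
    then show ?case using rangeI[of "\<lambda>p. rat_eval p \<zeta>" "- p"] by (simp add: class_ring_simps)
  next
    case (m_inv h)
    then obtain p where p: "h = rat_eval p \<zeta>" by blast
    have h0: "h \<noteq> 0" using m_inv by simp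
    then obtain g where g: "rat_eval g \<zeta> * h = 1" using zeta_inv p by blast
    then have "inverse h = rat_eval g \<zeta>"
      by (intro inverse_unique) (simp add: mult.commute)
    then show ?case using h0 by (simp add: class_ring_simps)
  next
    case (eng_add h1 h2)
    then obtain p q where "h1 = rat_eval p \<zeta>" "h2 = rat_eval q \<zeta>" by blast
    then show ?case using rangeI[of "\<lambda>p. rat_eval p \<zeta>" "p + q"] by simp
  next
    case (eng_mult h1 h2)
    then obtain p q where "h1 = rat_eval p \<zeta>" "h2 = rat_eval q \<zeta>" by blast
    then show ?case using rangeI[of "\<lambda>p. rat_eval p \<zeta>" "p * q"] by simp
  qed
next
  fix x :: 'k assume "x \<in> range (\<lambda>p. rat_eval p \<zeta>)"
  then obtain p where x: "x = rat_eval p \<zeta>" by blast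
  let ?G = "generate_field class_ring (\<rat> \<union> {\<zeta> :: 'k. \<zeta> ^ n = 1})"
  have rat: "of_rat q \<in> ?G" for q by (rule generate_field.incl) simp
  have zeta: "\<zeta> \<in> ?G" by (rule generate_field.incl) (simp add: zeta_root)
  have "rat_eval p \<zeta> \<in> ?G"
  proof (induction p)
    case 0
    then show ?case using rat[of 0] by simp
  next
    case (pCons a p)
    then show ?case
      using generate_field.eng_add[OF rat[of a] generate_field.eng_mult[OF zeta pCons.IH]] by simp
  qed
  then show "x \<in> cyclotomic_field n" by (simp add: x cyclotomic_field_def)
qed

lemma inverse_zeta: "inverse \<zeta> = \<zeta> ^ (n - 1)"
  using zeta_root n_pos by (intro inverse_unique) (simp add: power_eq_if[of \<zeta> n] split: if_splits)

lemma rat_eval_inverse_eq_iff: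
  "rat_eval p (inverse \<zeta>) = rat_eval q (inverse \<zeta>) \<longleftrightarrow> rat_eval p \<zeta> = rat_eval q \<zeta>"
  using zeta_conj[of "p - q"] by simp

text \<open>The map \<open>p(\<zeta>) \<mapsto> p(\<zeta>\<inverse>)\<close>.\<close>

definition conj_zeta :: "'k \<Rightarrow> 'k" where
  "conj_zeta x = (if x \<in> cyclotomic_field n
     then rat_eval (SOME p. rat_eval p \<zeta> = x) (inverse \<zeta>) else undefined)"

lemma conj_zeta_eval: "conj_zeta (rat_eval p \<zeta>) = rat_eval p (inverse \<zeta>)"
proof -
  have "rat_eval (SOME q. rat_eval q \<zeta> = rat_eval p \<zeta>) \<zeta> = rat_eval p \<zeta>"
    by (rule someI[of _ p]) simp
  then show ?thesis
    by (simp add: conj_zeta_def cyclotomic_field_eq rat_eval_inverse_eq_iff)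
qed

text \<open>Since \<open>\<zeta>\<inverse> = \<zeta>\<^sup>n\<^sup>-\<^sup>1\<close>, substituting \<open>X\<^sup>n\<^sup>-\<^sup>1\<close> for \<open>X\<close> exchanges the values at \<open>\<zeta>\<close> and at \<open>\<zeta>\<inverse>\<close>.\<close>

abbreviation flip_poly where "flip_poly p \<equiv> pcompose p (Polynomial.monom 1 (n - 1))"

lemma rat_eval_inverse: "rat_eval p (inverse \<zeta>) = rat_eval (flip_poly p) \<zeta>"
  by (simp add: rat_eval_pcompose inverse_zeta)

lemma rat_eval_flip_inverse: "rat_eval (flip_poly p) (inverse \<zeta>) = rat_eval p \<zeta>"
  by (simp only: rat_eval_pcompose rat_eval_simps of_rat_1 mult_1 power_inverse inverse_zeta[symmetric]
    inverse_inverse_eq)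

lemma conj_zeta_involution: "conj_zeta (conj_zeta (rat_eval p \<zeta>)) = rat_eval p \<zeta>"
  by (simp only: conj_zeta_eval) (simp only: rat_eval_inverse[of p] conj_zeta_eval rat_eval_flip_inverse)

text \<open>The map \<open>p(\<zeta>) \<mapsto> p(\<zeta>\<inverse>)\<close> is an involutive ring homomorphism and thus qualifies. Any other
  qualifying map fixes the rationals and sends \<open>\<zeta>\<close> to \<open>\<zeta>\<inverse>\<close>, so it agrees on all polynomial values.\<close>

theorem cyclotomic_conj_eval: "cyclotomic_conj n (rat_eval p \<zeta>) = rat_eval p (inverse \<zeta>)"
proof -
  define K where "K = (class_ring :: 'k ring)\<lparr>carrier := cyclotomic_field n\<rparr>"
  have carK: "carrier K = range (\<lambda>p. rat_eval p \<zeta>)" by (simp add: K_def cyclotomic_field_eq)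
  define P where "P = (\<lambda>\<sigma>. \<sigma> \<in> ring_iso K K \<and> \<sigma> \<in> extensional (cyclotomic_field n)
       \<and> (\<forall>x. x ^ n = 1 \<longrightarrow> \<sigma> x = inverse x))"
  have "P conj_zeta"
    unfolding P_def
  proof (intro conjI allI impI)
    show "conj_zeta \<in> extensional (cyclotomic_field n)"
      by (simp add: extensional_def conj_zeta_def)
    show "conj_zeta x = inverse x" if root: "x ^ n = 1" for x
    proof -
      obtain i where i: "x = \<zeta> ^ i" using root_is_power[OF root] by blast
      then have "x = rat_eval (Polynomial.monom 1 i) \<zeta>" by simp
      then have "conj_zeta x = rat_eval (Polynomial.monom 1 i) (inverse \<zeta>)" by (simp only: conj_zeta_eval)
      then show ?thesis by (simp add: i power_inverse)
    qed
    show "conj_zeta \<in> ring_iso K K"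
    proof (rule ring_iso_memI)
      fix x assume "x \<in> carrier K"
      then obtain p where x: "x = rat_eval p \<zeta>" by (auto simp: carK)
      show "conj_zeta x \<in> carrier K" by (simp add: x conj_zeta_eval rat_eval_inverse carK)
      fix y assume "y \<in> carrier K"
      then obtain q where y: "y = rat_eval q \<zeta>" by (auto simp: carK)
      show "conj_zeta (x \<otimes>\<^bsub>K\<^esub> y) = conj_zeta x \<otimes>\<^bsub>K\<^esub> conj_zeta y"
        using conj_zeta_eval[of "p * q"] by (simp add: x y conj_zeta_eval K_def)
      show "conj_zeta (x \<oplus>\<^bsub>K\<^esub> y) = conj_zeta x \<oplus>\<^bsub>K\<^esub> conj_zeta y"
        using conj_zeta_eval[of "p + q"] by (simp add: x y conj_zeta_eval K_def)
    next
      show "conj_zeta \<one>\<^bsub>K\<^esub> = \<one>\<^bsub>K\<^esub>" using conj_zeta_eval[of 1] by (simp add: K_def)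
      show "bij_betw conj_zeta (carrier K) (carrier K)"
      proof (rule bij_betw_byWitness[where f' = conj_zeta])
        show "\<forall>x\<in>carrier K. conj_zeta (conj_zeta x) = x" "\<forall>x\<in>carrier K. conj_zeta (conj_zeta x) = x"
          by (auto simp: carK conj_zeta_involution)
        show "conj_zeta ` carrier K \<subseteq> carrier K" "conj_zeta ` carrier K \<subseteq> carrier K"
          by (auto simp: carK conj_zeta_eval rat_eval_inverse)
      qed
    qed
  qed
  moreover have "\<tau> = conj_zeta" if \<tau>: "P \<tau>" for \<tau>
  proof (rule extensionalityI[of _ "cyclotomic_field n"])
    have \<tau>_hom: "\<tau> \<in> Ring.ring_hom K K" using \<tau> by (simp add: P_def ring_iso_def)
    have hom: "\<tau> (rat_eval p \<zeta> + rat_eval q \<zeta>) = \<tau> (rat_eval p \<zeta>) + \<tau> (rat_eval q \<zeta>)"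
      "\<tau> (rat_eval p \<zeta> * rat_eval q \<zeta>) = \<tau> (rat_eval p \<zeta>) * \<tau> (rat_eval q \<zeta>)" for p q
    proof -
      have car: "rat_eval p \<zeta> \<in> carrier K" for p by (simp add: carK)
      show "\<tau> (rat_eval p \<zeta> + rat_eval q \<zeta>) = \<tau> (rat_eval p \<zeta>) + \<tau> (rat_eval q \<zeta>)"
        using ring_hom_add[OF \<tau>_hom car car, of p q] by (simp add: K_def)
      show "\<tau> (rat_eval p \<zeta> * rat_eval q \<zeta>) = \<tau> (rat_eval p \<zeta>) * \<tau> (rat_eval q \<zeta>)"
        using ring_hom_mult[OF \<tau>_hom car car, of p q] by (simp add: K_def)
    qed
    have one: "\<tau> 1 = 1"
      using ring_hom_one[OF \<tau>_hom] by (simp add: K_def)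
    have add: "\<tau> (of_rat a + of_rat b) = \<tau> (of_rat a) + \<tau> (of_rat b)"
      and mult: "\<tau> (of_rat a * of_rat b) = \<tau> (of_rat a) * \<tau> (of_rat b)" for a b
      using hom(1)[of "[:a:]" "[:b:]"] hom(2)[of "[:a:]" "[:b:]"] by simp_all
    have zero: "\<tau> 0 = 0" using add[of 0 0] by simp
    have nat: "\<tau> (of_nat i) = of_nat i" for i
    proof (induction i)
      case (Suc i)
      have "\<tau> (of_nat (Suc i)) = \<tau> (1 + of_nat i)" by simp
      also have "\<dots> = \<tau> 1 + \<tau> (of_nat i)" using add[of 1 "of_nat i"] by simp
      finally show ?case using Suc one by simp
    qed (simp add: zero)
    have int: "\<tau> (of_int i) = of_int i" for i
    proof (cases i)
      case (nonneg j)
      then show ?thesis using nat[of j] by simp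
    next
      case (neg j)
      have "\<tau> (of_int i) + \<tau> (of_nat (Suc j)) = \<tau> (of_int i + of_nat (Suc j))"
        using add[of "of_int i" "of_nat (Suc j)"] by (simp add: of_rat_add)
      also have "of_int i + of_nat (Suc j) = (0 :: 'k)" by (simp add: neg)
      finally have "\<tau> (of_int i) + of_nat (Suc j) = 0" by (simp only: nat zero)
      then have "\<tau> (of_int i) = - of_nat (Suc j)" by (simp only: eq_neg_iff_add_eq_0)
      then show ?thesis by (simp add: neg)
    qed
    have rat: "\<tau> (of_rat a) = of_rat a" for a
    proof -
      obtain u v where uv: "quotient_of a = (u, v)" by fastforce
      then have v: "v > 0" and a: "a = of_int u / of_int v"
        by (auto simp: quotient_of_denom_pos quotient_of_div)
      have "\<tau> (of_rat a) * \<tau> (of_int v) = \<tau> (of_rat a * of_int v)"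
        using mult[of a "of_int v"] by simp
      also have "of_rat a * of_int v = (of_int u :: 'k)"
        using v by (simp add: a of_rat_divide)
      finally show ?thesis using v by (simp add: int a of_rat_divide field_simps)
    qed
    have root: "\<tau> \<zeta> = inverse \<zeta>" using \<tau> zeta_root by (simp add: P_def)
    have eval: "\<tau> (rat_eval p \<zeta>) = rat_eval p (inverse \<zeta>)" for p
    proof (induction p)
      case (pCons a p)
      have "\<tau> (rat_eval (pCons a p) \<zeta>) = \<tau> (of_rat a) + \<tau> (\<zeta> * rat_eval p \<zeta>)"
        using hom(1)[of "[:a:]" "Polynomial.monom 1 1 * p"] by simp
      also have "\<tau> (\<zeta> * rat_eval p \<zeta>) = \<tau> \<zeta> * \<tau> (rat_eval p \<zeta>)"
        using hom(2)[of "Polynomial.monom 1 1" p] by simp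
      finally show ?case by (simp add: pCons rat root)
    qed (simp add: zero)
    show "\<tau> x = conj_zeta x" if "x \<in> cyclotomic_field n" for x
      using that by (auto simp: cyclotomic_field_eq eval conj_zeta_eval)
    show "\<tau> \<in> extensional (cyclotomic_field n)" "conj_zeta \<in> extensional (cyclotomic_field n)"
      using \<tau> by (auto simp: P_def extensional_def conj_zeta_def)
  qed
  ultimately have "(THE \<sigma>. P \<sigma>) = conj_zeta" by (rule the_equality)
  then show ?thesis
    by (simp add: cyclotomic_conj_def P_def K_def Let_def conj_zeta_eval)
qed

text \<open>Multiplication by a root of unity permutes the powers of \<open>\<zeta>\<close>. Hence the vector of these powers is
  an eigenvector of a sum of permutation matrices, with the given sum of roots of unity as
  eigenvalue, and the characteristic polynomial of that integer matrix is monic with integer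
  coefficients.\<close>

lemma algebraic_int_sum_roots:
  fixes l :: "'s \<Rightarrow> 'k"
  assumes S: "finite S" and roots: "\<And>s. s \<in> S \<Longrightarrow> l s ^ n = 1"
  shows "algebraic_int (\<Sum>s\<in>S. l s)"
proof -
  have "\<exists>e. \<forall>s\<in>S. l s = \<zeta> ^ e s"
    using roots root_is_power by (intro bchoice) metis
  then obtain e where e: "\<And>s. s \<in> S \<Longrightarrow> l s = \<zeta> ^ e s" by blast
  define M :: "int mat" where
    "M = mat n n (\<lambda>(i, j). \<Sum>s\<in>S. if (i + e s) mod n = j then 1 else 0)"
  define N :: "'k mat" where "N = map_mat of_int M"
  define v where "v = vec n (\<lambda>i. \<zeta> ^ i)"
  have M: "M \<in> carrier_mat n n" by (simp add: M_def)
  have N: "N \<in> carrier_mat n n" using M by (simp add: N_def)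
  have pow_mod: "\<zeta> ^ (i mod n) = \<zeta> ^ i" for i
    by (metis div_mult_mod_eq mult.commute mult_1 power_add power_mult power_one zeta_root)
  have "N *\<^sub>v v = (\<Sum>s\<in>S. l s) \<cdot>\<^sub>v v"
  proof (rule eq_vecI)
    fix i assume "i < dim_vec ((\<Sum>s\<in>S. l s) \<cdot>\<^sub>v v)"
    then have i: "i < n" by (simp add: v_def)
    have "(N *\<^sub>v v) $ i = (\<Sum>j<n. of_int (M $$ (i, j)) * \<zeta> ^ j)"
      using i M by (auto simp: N_def v_def scalar_prod_def lessThan_atLeast0 intro!: sum.cong)
    also have "\<dots> = (\<Sum>j<n. \<Sum>s\<in>S. if (i + e s) mod n = j then \<zeta> ^ j else 0)"
      using i by (intro sum.cong) (auto simp: M_def sum_distrib_right intro!: sum.cong)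
    also have "\<dots> = (\<Sum>s\<in>S. \<Sum>j<n. if (i + e s) mod n = j then \<zeta> ^ j else 0)"
      by (rule sum.swap)
    also have "\<dots> = (\<Sum>s\<in>S. \<zeta> ^ ((i + e s) mod n))"
      using n_pos by (intro sum.cong) simp_all
    also have "\<dots> = (\<Sum>s\<in>S. l s * \<zeta> ^ i)"
      using e by (intro sum.cong) (simp_all add: pow_mod power_add)
    also have "\<dots> = ((\<Sum>s\<in>S. l s) \<cdot>\<^sub>v v) $ i"
      using i by (simp add: v_def sum_distrib_right)
    finally show "(N *\<^sub>v v) $ i = ((\<Sum>s\<in>S. l s) \<cdot>\<^sub>v v) $ i" .
  qed (use N in \<open>simp add: v_def\<close>)
  moreover have "v \<noteq> 0\<^sub>v n"
  proof
    assume "v = 0\<^sub>v n"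
    then have "v $ 0 = 0" using n_pos by simp
    then show False using n_pos by (simp add: v_def)
  qed
  ultimately have "eigenvalue N (\<Sum>s\<in>S. l s)"
    using N unfolding eigenvalue_def eigenvector_def by (intro exI[of _ v]) (simp add: v_def)
  then have "poly (char_poly N) (\<Sum>s\<in>S. l s) = 0"
    by (simp add: eigenvalue_root_char_poly[OF N])
  moreover have "char_poly N = map_poly of_int (char_poly M)"
    unfolding N_def by (rule of_int_hom.char_poly_hom[OF M])
  moreover have "lead_coeff (char_poly M) = 1"
    using degree_monic_char_poly[OF M] by simp
  ultimately show ?thesis
    unfolding algebraic_int_altdef_ipoly by metis
qed

end

section \<open>Frobenius-Schur indicators\<close>

context linear_pivotal_category
begin

abbreviation add (infixl "\<oplus>\<^sub>h" 54) where "add \<equiv> Add C"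
abbreviation scale (infixr "\<odot>\<^sub>h" 75) where "scale \<equiv> Scale C"

lemma Add_type [simp]:
  assumes "f \<in> Arr C" "g \<in> Arr C" "Dom C g = Dom C f" "Cod C g = Cod C f"
  shows "f \<oplus>\<^sub>h g \<in> Arr C" "Dom C (f \<oplus>\<^sub>h g) = Dom C f" "Cod C (f \<oplus>\<^sub>h g) = Cod C f"
proof -
  interpret vectorspace class_ring "hom_space C (Dom C f) (Cod C f)"
    using assms by (intro Hom_vectorspace) auto
  have "f \<oplus>\<^sub>h g \<in> Hom C (Dom C f) (Cod C f)"
    using M.add.m_closed[of f g] assms by (simp add: hom_space_def Hom_def)
  then show "f \<oplus>\<^sub>h g \<in> Arr C" "Dom C (f \<oplus>\<^sub>h g) = Dom C f" "Cod C (f \<oplus>\<^sub>h g) = Cod C f"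
    by (auto simp: Hom_def)
qed

lemma Scale_type [simp]:
  assumes "f \<in> Arr C"
  shows "a \<odot>\<^sub>h f \<in> Arr C" "Dom C (a \<odot>\<^sub>h f) = Dom C f" "Cod C (a \<odot>\<^sub>h f) = Cod C f"
proof -
  interpret vectorspace class_ring "hom_space C (Dom C f) (Cod C f)"
    using assms by (intro Hom_vectorspace) auto
  have "a \<odot>\<^sub>h f \<in> Hom C (Dom C f) (Cod C f)"
    using smult_closed[of a f] assms by (simp add: hom_space_def Hom_def)
  then show "a \<odot>\<^sub>h f \<in> Arr C" "Dom C (a \<odot>\<^sub>h f) = Dom C f" "Cod C (a \<odot>\<^sub>h f) = Cod C f"
    by (auto simp: Hom_def)
qed

lemma comp_linear:
  assumes "f \<in> Arr C" "g \<in> Arr C" "Dom C g = Cod C f"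
  shows "\<lbrakk>f' \<in> Arr C; Dom C f' = Dom C f; Cod C f' = Cod C f\<rbrakk> \<Longrightarrow> g \<cdot> (f \<oplus>\<^sub>h f') = (g \<cdot> f) \<oplus>\<^sub>h (g \<cdot> f')"
    and "\<lbrakk>g' \<in> Arr C; Dom C g' = Dom C g; Cod C g' = Cod C g\<rbrakk> \<Longrightarrow> (g \<oplus>\<^sub>h g') \<cdot> f = (g \<cdot> f) \<oplus>\<^sub>h (g' \<cdot> f)"
    and "g \<cdot> (a \<odot>\<^sub>h f) = a \<odot>\<^sub>h (g \<cdot> f)" "(a \<odot>\<^sub>h g) \<cdot> f = a \<odot>\<^sub>h (g \<cdot> f)"
  using assms by (auto intro!: Comp_Add_right Comp_Add_left Comp_Scale_right Comp_Scale_left simp: Hom_def)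

lemma tensor_linear:
  assumes "f \<in> Arr C" "g \<in> Arr C"
  shows "\<lbrakk>f' \<in> Arr C; Dom C f' = Dom C f; Cod C f' = Cod C f\<rbrakk> \<Longrightarrow> (f \<oplus>\<^sub>h f') \<otimes>\<^sub>a g = (f \<otimes>\<^sub>a g) \<oplus>\<^sub>h (f' \<otimes>\<^sub>a g)"
    and "\<lbrakk>g' \<in> Arr C; Dom C g' = Dom C g; Cod C g' = Cod C g\<rbrakk> \<Longrightarrow> f \<otimes>\<^sub>a (g \<oplus>\<^sub>h g') = (f \<otimes>\<^sub>a g) \<oplus>\<^sub>h (f \<otimes>\<^sub>a g')"
    and "(a \<odot>\<^sub>h f) \<otimes>\<^sub>a g = a \<odot>\<^sub>h (f \<otimes>\<^sub>a g)" "f \<otimes>\<^sub>a (a \<odot>\<^sub>h g) = a \<odot>\<^sub>h (f \<otimes>\<^sub>a g)"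
  using assms by (auto intro!: TensorA_Add_left TensorA_Add_right TensorA_Scale_left TensorA_Scale_right simp: Hom_def)

lemma dual_arr_linear:
  assumes [simp]: "f \<in> Arr C"
  shows "\<lbrakk>f' \<in> Arr C; Dom C f' = Dom C f; Cod C f' = Cod C f\<rbrakk>
      \<Longrightarrow> dual_arr C (f \<oplus>\<^sub>h f') = dual_arr C f \<oplus>\<^sub>h dual_arr C f'"
    and "dual_arr C (a \<odot>\<^sub>h f) = a \<odot>\<^sub>h dual_arr C f"
proof -
  assume [simp]: "f' \<in> Arr C" "Dom C f' = Dom C f" "Cod C f' = Cod C f"
  show "dual_arr C (f \<oplus>\<^sub>h f') = dual_arr C f \<oplus>\<^sub>h dual_arr C f'"
    by (rule dual_arr_eqI[of _ "Dom C f" "Cod C f"]) (simp_all add: comp_linear tensor_linear ev_dual_arr)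
next
  show "dual_arr C (a \<odot>\<^sub>h f) = a \<odot>\<^sub>h dual_arr C f"
    by (rule dual_arr_eqI[of _ "Dom C f" "Cod C f"]) (simp_all add: comp_linear tensor_linear ev_dual_arr)
qed

lemma E_map_linear:
  assumes [simp]: "V \<in> Obj C" "W \<in> Obj C" "f \<in> Arr C" "Dom C f = Unit C" "Cod C f = V \<otimes>\<^sub>o W"
  shows "\<lbrakk>f' \<in> Arr C; Dom C f' = Unit C; Cod C f' = V \<otimes>\<^sub>o W\<rbrakk>
      \<Longrightarrow> E_map C V W (f \<oplus>\<^sub>h f') = E_map C V W f \<oplus>\<^sub>h E_map C V W f'"
    and "E_map C V W (a \<odot>\<^sub>h f) = a \<odot>\<^sub>h E_map C V W f"
  by (simp_all add: E_map_def A_inv_def T_map_def A_map_def comp_linear tensor_linear dual_arr_linear)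

text \<open>\<open>E_pow\<close> is composed of linear operations; for the dual morphism this follows from the uniqueness of
  a morphism with given pairing.\<close>

lemma E_pow_linear:
  assumes [simp]: "V \<in> Obj C" "f \<in> Arr C" "Dom C f = Unit C" "Cod C f = tensor_pow C V (Suc n)"
  shows "\<lbrakk>f' \<in> Arr C; Dom C f' = Unit C; Cod C f' = tensor_pow C V (Suc n)\<rbrakk>
      \<Longrightarrow> E_pow C V (Suc n) (f \<oplus>\<^sub>h f') = E_pow C V (Suc n) f \<oplus>\<^sub>h E_pow C V (Suc n) f'"
    and "E_pow C V (Suc n) (a \<odot>\<^sub>h f) = a \<odot>\<^sub>h E_pow C V (Suc n) f"
  by (simp_all add: E_pow_def assoc_pow_eq_pow_merge comp_linear E_map_linear del: assoc_pow.simps)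

lemma Hom_fin_dim_space:
  assumes "X \<in> Obj C" "Y \<in> Obj C" shows "fin_dim_space (hom_space C X Y)"
  using Hom_vectorspace[OF assms] Hom_fin_dim[OF assms]
  by (simp add: fin_dim_space_def fin_dim_space_axioms_def)

lemma hom_space_simps: "carrier (hom_space C X Y) = Hom C X Y"
  "x \<oplus>\<^bsub>hom_space C X Y\<^esub> y = x \<oplus>\<^sub>h y" "a \<odot>\<^bsub>hom_space C X Y\<^esub> x = a \<odot>\<^sub>h x"
  by (simp_all add: hom_space_def)

end

text \<open>Characteristic zero is a sort constraint on the scalars, so it needs a locale of its own.\<close>

locale char_0_linear_pivotal_category = linear_pivotal_category C
  for C :: "('o, 'm, 'k::field_char_0, 'z) linear_pivotal_category_scheme" (structure)
begin

lemma E_pow_periodic_endo: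
  fixes \<zeta> :: 'k
  assumes V [simp]: "V \<in> Obj C" and n: "n \<ge> 1" and root: "primitive_root \<zeta> n"
  shows "periodic_endo (hom_space C (Unit C) (tensor_pow C V n)) (E_pow C V n) n \<zeta>"
proof -
  obtain m where m: "n = Suc m" using n by (cases n) auto
  let ?H = "hom_space C (Unit C) (tensor_pow C V n)"
  interpret fin_dim_space ?H by (rule Hom_fin_dim_space) simp_all
  have "linear_endo (E_pow C V n)"
    unfolding linear_endo_def hom_space_simps Hom_iff unfolding m
    by (intro conjI ballI allI) (auto simp: Hom_iff E_pow_linear simp del: tensor_pow.simps)
  moreover have "(E_pow C V n ^^ n) f = f" if "f \<in> carrier ?H" for f
    using E_pow_periodic[OF V, of f n] that by (simp add: hom_space_simps Hom_iff)
  ultimately show ?thesis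
    using root by unfold_locales (auto simp: primitive_root_def)
qed

text \<open>Negative powers reduce to nonnegative ones, as \<open>E\<inverse> = E\<^sup>n\<^sup>-\<^sup>1\<close> by periodicity.\<close>

lemma inv_into_E_pow:
  assumes V [simp]: "V \<in> Obj C" and f: "f \<in> Hom C (Unit C) (tensor_pow C V (Suc m))"
  shows "(inv_into (Hom C (Unit C) (tensor_pow C V (Suc m))) (E_pow C V (Suc m)) ^^ k) f
    = (E_pow C V (Suc m) ^^ (m * k)) f"
proof -
  let ?H = "Hom C (Unit C) (tensor_pow C V (Suc m))" and ?E = "E_pow C V (Suc m)"
  have closed: "?E f \<in> ?H" if "f \<in> ?H" for f
    using that unfolding Hom_iff by (auto simp del: tensor_pow.simps)
  then have closed_pow: "(?E ^^ i) f \<in> ?H" if "f \<in> ?H" for f i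
    using that by (induction i) auto
  have period: "(?E ^^ Suc m) f = f" if "f \<in> ?H" for f
    using E_pow_periodic[OF V, of f "Suc m"] that unfolding Hom_iff by blast
  have inj: "inj_on ?E ?H"
  proof (rule inj_onI)
    fix f g assume "f \<in> ?H" "g \<in> ?H" "?E f = ?E g"
    then show "f = g" using period[of f] period[of g] by (simp add: funpow_swap1)
  qed
  have inv: "inv_into ?H ?E f = (?E ^^ m) f" if f: "f \<in> ?H" for f
  proof -
    have "inv_into ?H ?E (?E ((?E ^^ m) f)) = (?E ^^ m) f"
      by (rule inv_into_f_f[OF inj closed_pow[OF f]])
    then show ?thesis using period[OF f] by simp
  qed
  show ?thesis
  proof (induction k)
    case (Suc k)
    have "(inv_into ?H ?E ^^ Suc k) f = (?E ^^ m) ((?E ^^ (m * k)) f)"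
      using Suc inv closed_pow[OF f] by simp
    then show ?case by (simp add: funpow_add)
  qed simp
qed

theorem FS_indicator_power_sum:
  fixes \<zeta> :: 'k
  assumes V: "V \<in> Obj C" and n: "n \<ge> 1" and root: "primitive_root \<zeta> n"
  shows "\<exists>(B :: 'm set) l. finite B \<and> (\<forall>b\<in>B. l b ^ n = 1)
    \<and> (\<forall>r. FS_indicator C n r V = (\<Sum>b\<in>B. l b powi r))"
proof -
  let ?H = "hom_space C (Unit C) (tensor_pow C V n)"
  interpret periodic_endo ?H "E_pow C V n" n \<zeta>
    by (rule E_pow_periodic_endo[OF V n root])
  obtain B :: "'m set" and l where Bl: "finite B \<and> (\<forall>b\<in>B. l b ^ n = 1)
      \<and> (\<forall>r. lin_trace ?H (E_pow C V n ^^ r) = (\<Sum>b\<in>B. l b ^ r))"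
    using trace_of_powers by (elim exE) (rule that)
  note B = conjunct1[OF Bl] and l = bspec[OF conjunct1[OF conjunct2[OF Bl]]]
    and tr = spec[OF conjunct2[OF conjunct2[OF Bl]]]
  obtain m where m: "n = Suc m" using n by (cases n) auto
  have "FS_indicator C n r V = (\<Sum>b\<in>B. l b powi r)" for r
  proof (cases "0 \<le> r")
    case True
    then show ?thesis by (simp add: FS_indicator_def E_power_def tr power_int_def)
  next
    case False
    define k where "k = nat (- r)"
    have "FS_indicator C n r V = lin_trace ?H (E_pow C V n ^^ (m * k))"
      using False unfolding FS_indicator_def E_power_def m k_def
      by (simp del: tensor_pow.simps) (intro lin_trace_cong[unfolded m] inv_into_E_pow V, simp add: hom_space_simps)
    also have "\<dots> = (\<Sum>b\<in>B. l b powi r)"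
      unfolding tr
    proof (rule sum.cong[OF refl])
      fix b assume "b \<in> B"
      then have "l b * l b ^ m = 1" using l m by simp
      then have "l b ^ m = inverse (l b)" by (simp add: inverse_unique)
      then show "l b ^ (m * k) = l b powi r"
        using False by (simp add: power_mult power_int_def k_def)
    qed
    finally show ?thesis .
  qed
  with B l show ?thesis by blast
qed

text \<open>The \<open>r\<close>-th powers of the eigenvalues are themselves powers of \<open>\<zeta>\<close>, which makes the indicator a
  polynomial value \<open>p(\<zeta>)\<close>; since \<open>\<lambda>\<^sup>n\<^sup>-\<^sup>r = (\<lambda>\<^sup>r)\<inverse>\<close>, the indicator for \<open>n - r\<close> is \<open>p(\<zeta>\<inverse>)\<close>.\<close>

theorem FS_indicator_cyclotomic:
  fixes \<zeta> :: 'k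
  assumes "V \<in> Obj C" "n \<ge> 1" "primitive_root \<zeta> n"
  shows "FS_indicator C n r V \<in> cyclotomic_field n \<and> algebraic_int (FS_indicator C n r V)
    \<and> FS_indicator C n (int n - r) V = cyclotomic_conj n (FS_indicator C n r V)"
proof -
  interpret primitive_root \<zeta> n by fact
  obtain B :: "'m set" and l where Bl: "finite B \<and> (\<forall>b\<in>B. l b ^ n = 1)
      \<and> (\<forall>r. FS_indicator C n r V = (\<Sum>b\<in>B. l b powi r))"
    using FS_indicator_power_sum[OF assms] by (elim exE) (rule that)
  note B = conjunct1[OF Bl] and l = bspec[OF conjunct1[OF conjunct2[OF Bl]]]
    and FS = spec[OF conjunct2[OF conjunct2[OF Bl]]]
  have l0: "l b \<noteq> 0" if "b \<in> B" for b using l[OF that] n_pos by (auto simp: power_0_left)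
  have pow: "(l b powi r) ^ n = 1" if "b \<in> B" for b r
  proof -
    have "(l b powi r) ^ n = l b powi (r * int n)" by (simp add: power_int_mult)
    also have "\<dots> = (l b ^ n) powi r" by (simp add: power_int_mult mult.commute[of r])
    finally have "(l b powi r) ^ n = (l b ^ n) powi r" .
    then show ?thesis using l[OF that] by simp
  qed
  have "\<exists>e. \<forall>b\<in>B. l b powi r = \<zeta> ^ e b"
    using pow root_is_power by (intro bchoice) metis
  then obtain e where e: "\<And>b. b \<in> B \<Longrightarrow> l b powi r = \<zeta> ^ e b" by blast
  define p where "p = (\<Sum>b\<in>B. Polynomial.monom (1::rat) (e b))"
  have val: "FS_indicator C n r V = rat_eval p \<zeta>"
    using e by (simp add: FS p_def)
  have "FS_indicator C n (int n - r) V = (\<Sum>b\<in>B. inverse (\<zeta> ^ e b))"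
    unfolding FS
  proof (rule sum.cong[OF refl])
    fix b assume b: "b \<in> B"
    have "l b powi (int n - r) = l b ^ n / l b powi r"
      using l0[OF b] by (simp add: power_int_diff)
    then show "l b powi (int n - r) = inverse (\<zeta> ^ e b)"
      using l[OF b] e[OF b] by (simp add: inverse_eq_divide)
  qed
  also have "\<dots> = rat_eval p (inverse \<zeta>)" by (simp add: p_def power_inverse)
  also have "\<dots> = cyclotomic_conj n (FS_indicator C n r V)"
    by (simp add: val cyclotomic_conj_eval)
  finally have conj: "FS_indicator C n (int n - r) V = cyclotomic_conj n (FS_indicator C n r V)" .
  have "algebraic_int (FS_indicator C n r V)"
    unfolding FS using pow by (intro algebraic_int_sum_roots[OF B])
  with conj show ?thesis by (simp add: val cyclotomic_field_eq)
qed

end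

theorem theorem5p1:
  fixes C :: "('o, 'm, 'z) pivotal_category_scheme"
    and D :: "('p, 'q, 'k::{alg_closed_field, field_char_0}, 'y) linear_pivotal_category_scheme"
  shows "(pivotal_category C \<longrightarrow>
      (\<forall>V\<in>Obj C. \<forall>n\<ge>1. \<forall>f\<in>Hom C (Unit C) (tensor_pow C V n). (E_pow C V n ^^ n) f = f))
    \<and> (linear_pivotal_category D \<longrightarrow>
      (\<forall>V\<in>Obj D. \<forall>n\<ge>1. \<forall>r\<ge>1.
        FS_indicator D n (int r) V \<in> cyclotomic_field n
        \<and> algebraic_int (FS_indicator D n (int r) V)
        \<and> FS_indicator D n (int n - int r) V = cyclotomic_conj n (FS_indicator D n (int r) V)))"
proof (intro conjI[of "pivotal_category C \<longrightarrow> _"] impI ballI allI)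
  fix V n f
  assume "pivotal_category C" "V \<in> Obj C" "f \<in> Hom C (Unit C) (tensor_pow C V n)"
  then show "(E_pow C V n ^^ n) f = f"
    by (intro pivotal_category.E_pow_periodic) (auto simp: Hom_def)
next
  fix V and n r :: nat
  assume D: "linear_pivotal_category D" and V: "V \<in> Obj D" and n: "n \<ge> 1"
  obtain \<zeta> :: 'k where "primitive_root \<zeta> n"
    using primitive_root_exists[of n] n by auto
  then show "FS_indicator D n (int r) V \<in> cyclotomic_field n
        \<and> algebraic_int (FS_indicator D n (int r) V)
        \<and> FS_indicator D n (int n - int r) V = cyclotomic_conj n (FS_indicator D n (int r) V)"
    by (rule char_0_linear_pivotal_category.FS_indicator_cyclotomic
      [OF char_0_linear_pivotal_category.intro[OF D] V n])
qed

end
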